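(* Let $\mathbf j=(j_1,\dots,j_n)\in\mathbb Z^n$, $A=(A^0|A^1)=((a^0_{s,t})|(a^1_{s,t}))\in M_n(\mathbb N|\mathbb Z_2)'$, $1\le i\le n$, $1\le h\le n-1$. In the $U_\upsilon(\mathfrak q_n)$-module $\widehat{\mathscr T}_\upsilon(n)$ the following hold. (1) $K_i.A(\mathbf j)=\upsilon^{\sum_{1\le j\le n}(a^0_{i,j}+a^1_{i,j})}A(\mathbf j+\mathbf e_i)$. (2) $E_h.A(\mathbf j)$ equals $$\begin{aligned} &\sum_{1\le j\le h-1,\ a^0_{h+1,j}\ge1}\upsilon^{\sigma_E^+(h,j,A)}[a^0_{h,j}+1](A^0+e_{h,j}-e_{h+1,j}|A^1)(\mathbf j-\alpha_h)\\ &+\delta^{\le}_{1,a^0_{h+1,h}}\upsilon^{\sigma_E^+(h,h,A)-j_h}\frac{(A^0-e_{h+1,h}|A^1)(\mathbf j+\beta_h)-(A^0-e_{h+1,h}|A^1)(\mathbf j-\alpha_h)}{\upsilon-\upsilon^{-1}}\\ &+\upsilon^{\sigma_E^+(h,h+1,A)+j_{h+1}}[a^0_{h,h+1}+1](A^0+e_{h,h+1}|A^1)(\mathbf j)\\ &+\sum_{h+2\le j\le n,\ a^0_{h+1,j}\ge1}\upsilon^{\sigma_E^+(h,j,A)}[a^0_{h,j}+1](A^0+e_{h,j}-e_{h+1,j}|A^1)(\mathbf j)\\ &+\sum_{1\le j\le h-1,\ a^1_{h+1,j}=1}\upsilon^{\sigma_E^-(h,j,A)}[a^1_{h,j}+1](A^0|A^1+e_{h,j}-e_{h+1,j})(\mathbf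 j-\alpha_h)\\ &+\delta_{1,a^1_{h+1,h}}\upsilon^{\sigma_E^-(h,h,A)}[a^1_{h,h}+1](A^0|A^1+e_{h,h}-e_{h+1,h})(\mathbf j+\mathbf e_{h+1})\\ &+\delta_{1,a^1_{h+1,h+1}}\upsilon^{\sigma_E^-(h,h+1,A)}[a^1_{h,h+1}+1](A^0|A^1+e_{h,h+1}-e_{h+1,h+1})(\mathbf j-\mathbf e_{h+1})\\ &+\sum_{h+2\le j\le n,\ a^1_{h+1,j}=1}\upsilon^{\sigma_E^-(h,j,A)}[a^1_{h,j}+1](A^0|A^1+e_{h,j}-e_{h+1,j})(\mathbf j). \end{aligned}$$ (3) $F_h.A(\mathbf j)$ equals $$\begin{aligned} &\sum_{1\le j\le h-1,\ a^0_{h,j}\ge1}\upsilon^{\sigma_F^+(h,j,A)}[a^0_{h+1,j}+1](A^0-e_{h,j}+e_{h+1,j}|A^1)(\mathbf j)\\ &+\upsilon^{\sigma_F^+(h,h,A)+j_h}[a^0_{h+1,h}+1](A^0+e_{h+1,h}|A^1)(\mathbf j)\\ &+\delta^{\le}_{1,a^0_{h,h+1}}\upsilon^{\sigma_F^+(h,h+1,A)-j_{h+1}}\frac{(A^0-e_{h,h+1}|A^1)(\mathbf j+\beta_h)-(A^0-e_{h,h+1}|A^1)(\mathbf j+\alpha_h)}{\upsilon-\upsilon^{-1}}\\ &+\sum_{h+2\le j\le n,\ a^0_{h,j}\ge1}\upsilon^{\sigma_F^+(h,j,A)}[a^0_{h+1,j}+1](A^0-e_{h,j}+e_{h+1,j}|A^1)(\mathbf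 j+\alpha_h)\\ &+\sum_{1\le j\le h-1,\ a^1_{h,j}=1}\upsilon^{\sigma_F^-(h,j,A)}[a^1_{h+1,j}+1](A^0|A^1-e_{h,j}+e_{h+1,j})(\mathbf j)\\ &+\delta_{1,a^1_{h,h}}\upsilon^{\sigma_F^-(h,h,A)}[a^1_{h+1,h}+1](A^0|A^1-e_{h,h}+e_{h+1,h})(\mathbf j+\mathbf e_h)\\ &+\delta_{1,a^1_{h,h+1}}\upsilon^{\sigma_F^-(h,h+1,A)}[a^1_{h+1,h+1}+1](A^0|A^1-e_{h,h+1}+e_{h+1,h+1})(\mathbf j+\mathbf e_h)\\ &+\sum_{h+2\le j\le n,\ a^1_{h,j}=1}\upsilon^{\sigma_F^-(h,j,A)}[a^1_{h+1,j}+1](A^0|A^1-e_{h,j}+e_{h+1,j})(\mathbf j+\alpha_h). \end{aligned}$$ (4) $K_{\bar1}.A(\mathbf j)$ equals $$\begin{aligned} &\delta_{1,a^1_{1,1}}\upsilon^{\sigma_K^+(1,A)-j_1+1}\frac{(A^0|A^1-e_{1,1})(\mathbf j)-(A^0|A^1-e_{1,1})(\mathbf j-2\mathbf e_1)}{\upsilon-\upsilon^{-1}}\\ &+\sum_{2\le j\le n,\ a^1_{1,j}=1}(-1)^{\mathfrak s_j(A^1)}\upsilon^{\sigma_K^+(j,A)}[a^0_{1,j}+1](A^0+e_{1,j}|A^1-e_{1,j})(\mathbf j-\mathbf e_1)\\ &+\upsilon^{\sigma_K^-(1,A)+j_1}[a^1_{1,1}+1](A^0|A^1+e_{1,1})(\mathbf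 j)\\ &+\sum_{2\le j\le n,\ a^0_{1,j}\ge1}(-1)^{\mathfrak s_j(A^1)}\upsilon^{\sigma_K^-(j,A)}[a^1_{1,j}+1](A^0-e_{1,j}|A^1+e_{1,j})(\mathbf j-\mathbf e_1). \end{aligned}$$
   Context: Let $n\ge 2$, let $\upsilon$ be an indeterminate, $[c]=\frac{\upsilon^c-\upsilon^{-c}}{\upsilon-\upsilon^{-1}}$, $[m]^!=[m]\cdots[2][1]$, $[0]^!=1$, $Z^{(m)}=Z^m/[m]^!$. $U=U_\upsilon(\mathfrak q_n)$ denotes the unital associative $\mathbb Q(\upsilon)$-superalgebra with even generators $K_i^{\pm1},E_j,F_j$ and odd generators $K_{\bar i},E_{\bar j},F_{\bar j}$ ($1\le i\le n$, $1\le j\le n-1$) and relations (indices in all admissible ranges): (QQ1) $K_iK_i^{-1}=K_i^{-1}K_i=1$, $K_iK_j=K_jK_i$, $K_iK_{\bar j}=K_{\bar j}K_i$, $K_{\bar i}K_{\bar j}+K_{\bar j}K_{\bar i}=2\delta_{ij}\frac{K_i^2-K_i^{-2}}{\upsilon^2-\upsilon^{-2}}$; (QQ2) $K_iE_j=\upsilon^{\delta_{i,j}-\delta_{i,j+1}}E_jK_i$, $K_iF_j=\upsilon^{-(\delta_{i,j}-\delta_{i,j+1})}F_jK_i$, and the same two relations with $E_j,F_j$ replaced by $E_{\bar j},F_{\bar j}$; (QQ3) $K_{\bar i}E_j=E_jK_{\bar i}$, $K_{\bar i}F_j=F_jK_{\bar i}$ for $i\ne j,j+1$; $K_{\bar j}E_j-\upsilon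 E_jK_{\bar j}=E_{\bar j}K_j^{-1}$, $\upsilon K_{\overline{j+1}}E_j-E_jK_{\overline{j+1}}=-K_{j+1}^{-1}E_{\bar j}$, $K_{\bar j}F_j-\upsilon F_jK_{\bar j}=-F_{\bar j}K_j$, $\upsilon K_{\overline{j+1}}F_j-F_jK_{\overline{j+1}}=K_{j+1}F_{\bar j}$; (QQ4) $E_iF_j-F_jE_i=\delta_{ij}\frac{K_iK_{i+1}^{-1}-K_i^{-1}K_{i+1}}{\upsilon-\upsilon^{-1}}$, $E_iF_{\bar j}-F_{\bar j}E_i=\delta_{ij}(K_{i+1}^{-1}K_{\bar i}-K_{\overline{i+1}}K_i^{-1})$, $E_{\bar i}F_j-F_jE_{\bar i}=\delta_{ij}(K_{i+1}K_{\bar i}-K_{\overline{i+1}}K_i)$; (QQ5) $E_iE_j=E_jE_i$, $F_iF_j=F_jF_i$ for $|i-j|>1$; $E_iE_{\bar i}=E_{\bar i}E_i$, $F_iF_{\bar i}=F_{\bar i}F_i$; $E_iE_{i+1}-\upsilon E_{i+1}E_i=E_{\bar i}E_{\overline{i+1}}+\upsilon E_{\overline{i+1}}E_{\bar i}$, $\upsilon F_{i+1}F_i-F_iF_{i+1}=F_{\bar i}F_{\overline{i+1}}+\upsilon F_{\overline{i+1}}F_{\bar i}$; (QQ6) for $|i-j|=1$: $E_i^2Z-(\upsilon+\upsilon^{-1})E_iZE_i+ZE_i^2=0$ for $Z\in\{E_j,E_{\bar j}\}$ and $F_i^2Z-(\upsilon+\upsilon^{-1})F_iZF_i+ZF_i^2=0$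 for $Z\in\{F_j,F_{\bar j}\}$. $U$ is generated by $K_i^{\pm1},E_h,F_h,K_{\bar1}$ and is a Hopf superalgebra with coassociative comultiplication determined by $\Delta(K_i)=K_i\otimes K_i$, $\Delta(E_h)=E_h\otimes \widetilde K_h^{-1}+1\otimes E_h$, $\Delta(F_h)=F_h\otimes1+\widetilde K_h\otimes F_h$, $\Delta(K_{\bar1})=K_{\bar1}\otimes K_1+K_1^{-1}\otimes K_{\bar1}$, where $\widetilde K_h=K_hK_{h+1}^{-1}$. $\mathscr A_\upsilon(n)$ is the $\mathbb Q(\upsilon)$-superalgebra with even generators $X_1,\dots,X_n$, odd generators $X_{\bar1},\dots,X_{\bar n}$ and relations $X_iX_j=X_jX_i$, $X_iX_{\bar j}=X_{\bar j}X_i$, $X_{\bar i}X_{\bar j}=-X_{\bar j}X_{\bar i}$ ($i\ne j$), $X_{\bar i}^2=\frac{\upsilon-\upsilon^{-1}}{\upsilon+\upsilon^{-1}}X_i^2$. Put $X^{\mathbf a}=X_1^{a_1}\cdots X_n^{a_n}X_{\bar1}^{a_{\bar1}}\cdots X_{\bar n}^{a_{\bar n}}$; those with $\mathbf a\in\mathbb N^n\times\{0,1\}^n$ form a basis. $\mathscr A_\upsilon(n)$ is a $U$-supermodule with action determined by (terms with coefficient $[0]$ being $0$) $K_i.X^{\mathbf a}=\upsilon^{a_i+a_{\bar i}}X^{\mathbf a}$, $E_h.X^{\mathbf a}=\upsilon^{a_{\overline{h+1}}}[a_{h+1}]X^{\mathbf a+\mathbf e_h-\mathbf e_{h+1}}+\upsilon^{-a_{h+1}}[a_{\overline{h+1}}]X^{\mathbf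 a+\mathbf e_{\bar h}-\mathbf e_{\overline{h+1}}}$, $F_h.X^{\mathbf a}=\upsilon^{-a_{\bar h}}[a_h]X^{\mathbf a-\mathbf e_h+\mathbf e_{h+1}}+\upsilon^{a_h}[a_{\bar h}]X^{\mathbf a-\mathbf e_{\bar h}+\mathbf e_{\overline{h+1}}}$, $K_{\bar1}.X^{\mathbf a}=\upsilon^{-a_1}[a_{\bar1}]X^{\mathbf a+\mathbf e_1-\mathbf e_{\bar1}}+\upsilon^{a_{\bar1}}[a_1]X^{\mathbf a+\mathbf e_{\bar1}-\mathbf e_1}$. $M_n(\mathbb N|\mathbb N)$ is the set of pairs $A=(A^0|A^1)$ of $n\times n$ matrices $A^s=(a^s_{i,j})$ over $\mathbb N$; $M_n(\mathbb N|\mathbb Z_2)$ is the subset with all $a^1_{i,j}\in\{0,1\}$; a prime ($M_n(\mathbb N|\mathbb N)'$, $M_n(\mathbb N|\mathbb Z_2)'$) means in addition that $A^0$ has zero diagonal. $e_{i,j}$ denotes the $n\times n$ matrix unit. $\mathscr T_\upsilon(n)=\mathscr A_\upsilon(n)^{\otimes n}$ is a $U$-supermodule via the iterated comultiplication and the sign rule $(g_1\otimes g_2)(v_1\otimes v_2)=(-1)^{p(g_2)p(v_1)}g_1v_1\otimes g_2v_2$. For $A\in M_n(\mathbb N|\mathbb N)$, $X^{[A]}=Y_1\otimes\cdots\otimes Y_n$ with $Y_j=X_1^{(a^0_{1,j})}\cdots X_n^{(a^0_{n,j})}X_{\bar1}^{(a^1_{1,j})}\cdots X_{\bar n}^{(a^1_{n,j})}$.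 The $X^{[A]}$ with $A\in M_n(\mathbb N|\mathbb Z_2)$ form a basis of $\mathscr T_\upsilon(n)$; those with sum of all entries equal to $r$ span a finite-dimensional submodule $\mathscr T_\upsilon(n,r)$, and $\mathscr T_\upsilon(n)=\bigoplus_r\mathscr T_\upsilon(n,r)$. $\widehat{\mathscr T}_\upsilon(n)=\prod_{r\ge0}\mathscr T_\upsilon(n,r)$ with the componentwise $U$-action. For $A\in M_n(\mathbb N|\mathbb N)'$, $\mathbf j\in\mathbb Z^n$: $A(\mathbf j)=\sum_{\lambda\in\mathbb N^n}\upsilon^{\lambda_1j_1+\cdots+\lambda_nj_n}X^{[(A^0+\mathrm{diag}(\lambda)|A^1)]}\in\widehat{\mathscr T}_\upsilon(n)$. Notation: $\mathbf e_i$ standard basis vectors (in $\mathbb Z^n$ for the argument $\mathbf j$); $\alpha_h=\mathbf e_h-\mathbf e_{h+1}$, $\beta_h=\mathbf e_h+\mathbf e_{h+1}$; $\delta^{\le}_{1,a}=1$ if $a\ge1$ and $0$ otherwise; $\delta_{i,j}$ is the Kronecker delta. With $b_{i,t}=a^0_{i,t}+a^1_{i,t}$: $\sigma_E^+(h,j,A)=a^1_{h+1,j}+\sum_{j<t\le n}(b_{h+1,t}-b_{h,t})$, $\sigma_E^-(h,j,A)=-a^0_{h+1,j}+\sum_{j<t\le n}(b_{h+1,t}-b_{h,t})$, $\sigma_F^+(h,j,A)=-a^1_{h,j}+\sum_{1\le t<j}(b_{h,t}-b_{h+1,t})$, $\sigma_F^-(h,j,A)=a^0_{h,j}+\sum_{1\le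 t<j}(b_{h,t}-b_{h+1,t})$, $\sigma_K^+(j,A)=-a^0_{1,j}-\sum_{1\le t<j}b_{1,t}+\sum_{j<t\le n}b_{1,t}$, $\sigma_K^-(j,A)=a^1_{1,j}-\sum_{1\le t<j}b_{1,t}+\sum_{j<t\le n}b_{1,t}$, $\mathfrak s_j(A^1)=\sum_{1\le t<j}\sum_{1\le s\le n}a^1_{s,t}$. *)

theory Defs
  imports
    "HOL-Library.Poly_Mapping"
    "HOL-Library.Function_Algebras"
    "HOL-Library.Cardinality"
    "HOL-Computational_Algebra.Polynomial"
    "HOL-Computational_Algebra.Fraction_Field"
begin

section \<open>The field of rational functions and quantum integers\<close>

type_synonym qv = "rat poly fract"

definition \<upsilon> :: qv where "\<upsilon> = Fract [:0, 1:] 1"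

definition qint :: "int \<Rightarrow> qv" where
  "qint c = (\<upsilon> powi c - \<upsilon> powi (- c)) / (\<upsilon> - inverse \<upsilon>)"

definition qfact :: "nat \<Rightarrow> qv" where
  "qfact m = (\<Prod>k = 1..m. qint (int k))"


section \<open>Superspaces and superalgebras\<close>

class qspace = ab_group_add +
  fixes scaleq :: "qv \<Rightarrow> 'a \<Rightarrow> 'a" (infixr "*\<^sub>q" 75)
  assumes scaleq_add_right: "c *\<^sub>q (x + y) = c *\<^sub>q x + c *\<^sub>q y"
    and scaleq_add_left: "(c + d) *\<^sub>q x = c *\<^sub>q x + d *\<^sub>q x"
    and scaleq_scaleq: "c *\<^sub>q d *\<^sub>q x = (c * d) *\<^sub>q x"
    and scaleq_one: "1 *\<^sub>q x = x"

interpretation qspace: vector_space "scaleq :: qv \<Rightarrow> 'a \<Rightarrow> 'a :: qspace"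
  by unfold_locales (simp_all add: scaleq_add_right scaleq_add_left scaleq_scaleq scaleq_one)

text \<open>A \<open>\<int>/2\<close>-grading is recorded by its parity automorphism, which is \<open>+1\<close> on the even and
  \<open>-1\<close> on the odd part; the characteristic is 0, so the homogeneous components are recovered
  by \<open>hpart\<close>.\<close>

class superspace = qspace +
  fixes par :: "'a \<Rightarrow> 'a"
  assumes par_add: "par (x + y) = par x + par y"
    and par_scaleq: "par (c *\<^sub>q x) = c *\<^sub>q par x"
    and par_par: "par (par x) = x"

definition hpart :: "bool \<Rightarrow> 'a \<Rightarrow> 'a :: superspace" where
  "hpart odd_part x = (1 / 2) *\<^sub>q (if odd_part then x - par x else x + par x)"

class superalgebra = superspace + ring + monoid_mult +
  assumes scaleq_mult_left: "(c *\<^sub>q x) * y = c *\<^sub>q (x * y)"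
    and scaleq_mult_right: "x * (c *\<^sub>q y) = c *\<^sub>q (x * y)"
    and par_mult: "par (x * y) = par x * par y"
    and par_one: "par 1 = 1"


section \<open>Free superalgebras\<close>

datatype 'g fword = FW (letters: "'g list")

instantiation fword :: (type) monoid_add
begin

definition "0 = FW []"
definition "u + v = FW (letters u @ letters v)"

instance
  by standard (simp_all add: zero_fword_def plus_fword_def)

end

type_synonym 'g freealg = "'g fword \<Rightarrow>\<^sub>0 qv"

definition fgen :: "'g \<Rightarrow> 'g freealg" where
  "fgen g = Poly_Mapping.single (FW [g]) 1"

definition fconst :: "qv \<Rightarrow> 'g freealg" where
  "fconst c = Poly_Mapping.single 0 c"

class graded_gen =
  fixes odd_gen :: "'a \<Rightarrow> bool"
begin

definition fpar :: "'a freealg \<Rightarrow> 'a freealg" where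
  "fpar = Poly_Mapping.mapp (\<lambda>w c. (- 1) ^ length (filter odd_gen (letters w)) * c)"

end

lemma lookup_fpar:
  "Poly_Mapping.lookup (fpar p) w
    = (- 1) ^ length (filter odd_gen (letters w)) * Poly_Mapping.lookup p w"
  by (simp add: fpar_def mapp.rep_eq when_def in_keys_iff)

lemma fpar_add: "fpar (p + q) = fpar p + fpar q"
  by (rule poly_mapping_eqI) (simp add: lookup_fpar lookup_add distrib_left)

lemma fpar_uminus: "fpar (- p) = - fpar p"
  by (rule poly_mapping_eqI) (simp add: lookup_fpar)

lemma fpar_diff: "fpar (p - q) = fpar p - fpar q"
  using fpar_add[of p "- q"] by (simp add: fpar_uminus)

lemma fpar_zero [simp]: "fpar 0 = 0"
  by (rule poly_mapping_eqI) (simp add: lookup_fpar)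

lemma fpar_single:
  "fpar (Poly_Mapping.single w c)
    = Poly_Mapping.single w ((- 1) ^ length (filter odd_gen (letters w)) * c)"
  by (rule poly_mapping_eqI) (simp add: lookup_fpar lookup_single when_def)

lemma poly_mapping_single_induct [case_names zero single_add]:
  fixes p :: "'b \<Rightarrow>\<^sub>0 'c :: comm_monoid_add"
  assumes "P 0" and "\<And>w c p. P p \<Longrightarrow> P (Poly_Mapping.single w c + p)"
  shows "P p"
proof (induction p rule: update_induct)
  case const
  show ?case by (rule assms(1))
next
  case (update p a b)
  have "Poly_Mapping.update a b p = Poly_Mapping.single a b + p"
    by (rule poly_mapping_eqI)
      (use update in \<open>auto simp: lookup_update lookup_add lookup_single when_def in_keys_iff\<close>)
  then show ?case using assms(2)[OF update.IH] by simp
qed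

lemma fpar_mult: "fpar (p * q) = fpar p * fpar q"
proof (induction p rule: poly_mapping_single_induct)
  case (single_add u c p)
  have "fpar (Poly_Mapping.single u c * q) = fpar (Poly_Mapping.single u c) * fpar q"
    by (induction q rule: poly_mapping_single_induct)
      (simp_all add: distrib_left fpar_add fpar_single mult_single plus_fword_def power_add mult.assoc
        mult.left_commute)
  with single_add show ?case by (simp add: distrib_right fpar_add)
qed simp

lemma fpar_fpar: "fpar (fpar p) = p"
  by (rule poly_mapping_eqI) (simp add: lookup_fpar flip: mult.assoc power_mult_distrib)

lemma fpar_fconst: "fpar (fconst c) = fconst c"
  by (simp add: fconst_def fpar_single zero_fword_def)

lemma fpar_one: "fpar 1 = 1"
  using fpar_fconst[of 1] by (simp add: fconst_def)

lemma fpar_fgen: "fpar (fgen g) = (if odd_gen g then - fgen g else fgen g)"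
  by (simp add: fgen_def fpar_single single_uminus)

lemma fconst_mult: "fconst c * fconst d = fconst (c * d)"
  by (simp add: fconst_def mult_single)

lemma fconst_add: "fconst c + fconst d = fconst (c + d)"
  by (simp add: fconst_def single_add)

lemma fconst_one: "fconst 1 = 1"
  by (simp add: fconst_def)

lemma fconst_central: "p * fconst c = fconst c * p"
  by (induction p rule: poly_mapping_single_induct)
    (simp_all add: distrib_left distrib_right fconst_def mult_single mult.commute)


section \<open>Superalgebras presented by generators and relations\<close>

class presentation = graded_gen +
  fixes relators :: "'a freealg set"
  assumes relators_homogeneous: "r \<in> relators \<Longrightarrow> fpar r = r \<or> fpar r = - r"

inductive_set rel_ideal :: "('g :: presentation) freealg set" where
  zero: "0 \<in> rel_ideal"
| step: "x \<in> rel_ideal \<Longrightarrow> r \<in> relators \<Longrightarrow> x + a * r * b \<in> rel_ideal"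

lemma rel_ideal_add:
  assumes "x \<in> rel_ideal" and "y \<in> rel_ideal"
  shows "x + y \<in> rel_ideal"
  using assms(2,1)
proof (induction y rule: rel_ideal.induct)
  case (step y r a b)
  then have "(x + y) + a * r * b \<in> rel_ideal" by (intro rel_ideal.step) auto
  then show ?case by (simp add: add.assoc)
qed simp

lemma rel_ideal_mult: "x \<in> rel_ideal \<Longrightarrow> c * x * d \<in> rel_ideal"
proof (induction rule: rel_ideal.induct)
  case (step x r a b)
  then have "c * x * d + (c * a) * r * (b * d) \<in> rel_ideal" by (intro rel_ideal.step) auto
  then show ?case by (simp add: distrib_left distrib_right mult.assoc)
qed (simp add: rel_ideal.zero)

lemma rel_ideal_mult_left: "x \<in> rel_ideal \<Longrightarrow> c * x \<in> rel_ideal"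
  using rel_ideal_mult[of x c 1] by simp

lemma rel_ideal_mult_right: "x \<in> rel_ideal \<Longrightarrow> x * c \<in> rel_ideal"
  using rel_ideal_mult[of x 1 c] by simp

lemma rel_ideal_uminus: "x \<in> rel_ideal \<Longrightarrow> - x \<in> rel_ideal"
  using rel_ideal_mult_left[of x "- 1"] by simp

lemma rel_ideal_fpar: "x \<in> rel_ideal \<Longrightarrow> fpar x \<in> rel_ideal"
proof (induction rule: rel_ideal.induct)
  case (step x r a b)
  have "fpar (x + a * r * b) = fpar x + fpar a * r * fpar b
    \<or> fpar (x + a * r * b) = fpar x + (- fpar a) * r * fpar b"
    using relators_homogeneous[OF step.hyps(2)] by (auto simp: fpar_add fpar_mult)
  with step show ?case by (metis rel_ideal.step)
qed (simp add: rel_ideal.zero)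

definition pres_eq :: "('g :: presentation) freealg \<Rightarrow> 'g freealg \<Rightarrow> bool" where
  "pres_eq x y \<longleftrightarrow> x - y \<in> rel_ideal"

lemma equivp_pres_eq: "equivp pres_eq"
proof (rule equivpI)
  show "reflp pres_eq"
    by (rule reflpI) (simp add: pres_eq_def rel_ideal.zero)
  show "symp pres_eq"
    by (rule sympI) (use rel_ideal_uminus in \<open>fastforce simp: pres_eq_def\<close>)
  show "transp pres_eq"
    by (rule transpI) (use rel_ideal_add in \<open>fastforce simp: pres_eq_def\<close>)
qed

quotient_type (overloaded) 'g alg = "('g :: presentation) freealg" / pres_eq
  by (rule equivp_pres_eq)

instantiation alg :: (presentation) superalgebra
begin

lift_definition zero_alg :: "'a alg" is 0 .
lift_definition one_alg :: "'a alg" is 1 .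

lift_definition plus_alg :: "'a alg \<Rightarrow> 'a alg \<Rightarrow> 'a alg" is "(+)"
  unfolding pres_eq_def by (drule (1) rel_ideal_add) (simp add: algebra_simps)

lift_definition uminus_alg :: "'a alg \<Rightarrow> 'a alg" is uminus
  unfolding pres_eq_def by (drule rel_ideal_uminus) (simp add: algebra_simps)

lift_definition minus_alg :: "'a alg \<Rightarrow> 'a alg \<Rightarrow> 'a alg" is "(-)"
  unfolding pres_eq_def
  by (drule rel_ideal_uminus[of "_ - _ :: 'a freealg", THEN rel_ideal_add[rotated]], assumption)
    (simp add: algebra_simps)

lift_definition times_alg :: "'a alg \<Rightarrow> 'a alg \<Rightarrow> 'a alg" is "(*)"
proof -
  fix x x' y y' :: "'a freealg"
  assume "pres_eq x x'" "pres_eq y y'"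
  then have "(x - x') * y + x' * (y - y') \<in> rel_ideal"
    unfolding pres_eq_def by (intro rel_ideal_add rel_ideal_mult_left rel_ideal_mult_right)
  then show "pres_eq (x * y) (x' * y')"
    by (simp add: pres_eq_def algebra_simps)
qed

lift_definition scaleq_alg :: "qv \<Rightarrow> 'a alg \<Rightarrow> 'a alg" is "\<lambda>c x. fconst c * x"
  unfolding pres_eq_def by (drule rel_ideal_mult_left) (simp add: algebra_simps)

lift_definition par_alg :: "'a alg \<Rightarrow> 'a alg" is fpar
  unfolding pres_eq_def by (drule rel_ideal_fpar) (simp add: fpar_diff)

instance
proof
  fix x y z :: "'a alg" and c d :: qv
  show "x + y + z = x + (y + z)" by transfer (simp add: pres_eq_def rel_ideal.zero add.assoc)
  show "x + y = y + x" by transfer (simp add: pres_eq_def rel_ideal.zero add.commute)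
  show "0 + x = x" by transfer (simp add: pres_eq_def rel_ideal.zero)
  show "- x + x = 0" by transfer (simp add: pres_eq_def rel_ideal.zero)
  show "x - y = x + - y" by transfer (simp add: pres_eq_def rel_ideal.zero)
  show "c *\<^sub>q (x + y) = c *\<^sub>q x + c *\<^sub>q y"
    by transfer (simp add: pres_eq_def rel_ideal.zero distrib_left)
  show "(c + d) *\<^sub>q x = c *\<^sub>q x + d *\<^sub>q x"
    by transfer (simp add: pres_eq_def rel_ideal.zero distrib_right flip: fconst_add)
  show "c *\<^sub>q d *\<^sub>q x = (c * d) *\<^sub>q x"
    by transfer (simp add: pres_eq_def rel_ideal.zero flip: mult.assoc fconst_mult)
  show "1 *\<^sub>q x = x" by transfer (simp add: pres_eq_def rel_ideal.zero fconst_one)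
  show "par (x + y) = par x + par y"
    by transfer (simp add: pres_eq_def rel_ideal.zero fpar_add)
  show "par (c *\<^sub>q x) = c *\<^sub>q par x"
    by transfer (simp add: pres_eq_def rel_ideal.zero fpar_mult fpar_fconst)
  show "par (par x) = x" by transfer (simp add: pres_eq_def rel_ideal.zero fpar_fpar)
  show "x * y * z = x * (y * z)" by transfer (simp add: pres_eq_def rel_ideal.zero mult.assoc)
  show "(x + y) * z = x * z + y * z"
    by transfer (simp add: pres_eq_def rel_ideal.zero distrib_right)
  show "x * (y + z) = x * y + x * z"
    by transfer (simp add: pres_eq_def rel_ideal.zero distrib_left)
  show "1 * x = x" by transfer (simp add: pres_eq_def rel_ideal.zero)
  show "x * 1 = x" by transfer (simp add: pres_eq_def rel_ideal.zero)
  show "(c *\<^sub>q x) * y = c *\<^sub>q (x * y)"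
    by transfer (simp add: pres_eq_def rel_ideal.zero mult.assoc)
  show "x * (c *\<^sub>q y) = c *\<^sub>q (x * y)"
  proof transfer
    fix x y :: "'a freealg" and c
    have "x * (fconst c * y) = fconst c * (x * y)"
      by (simp only: mult.assoc[symmetric] fconst_central)
    then show "pres_eq (x * (fconst c * y)) (fconst c * (x * y))"
      by (simp add: pres_eq_def rel_ideal.zero)
  qed
  show "par (x * y) = par x * par y"
    by transfer (simp add: pres_eq_def rel_ideal.zero fpar_mult)
  show "par (1 :: 'a alg) = 1" by transfer (simp add: pres_eq_def rel_ideal.zero fpar_one)
qed

end

lift_definition gen :: "'g :: presentation \<Rightarrow> 'g alg" is fgen .

lemma relator_eqI: "x - y \<in> relators \<Longrightarrow> pres_eq x y"
  using rel_ideal.step[OF rel_ideal.zero, of "x - y" 1 1] by (simp add: pres_eq_def)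


section \<open>Tensor powers\<close>

text \<open>The type \<open>'a tensor\<close> is the direct sum of all tensor powers of \<open>'a\<close> over the rational function
  field: the free space on the lists over \<open>'a\<close> modulo multilinearity.  The list
  \<open>[v\<^sub>1, \<dots>, v\<^sub>m]\<close> represents the pure tensor of \<open>v\<^sub>1, \<dots>, v\<^sub>m\<close>, and \<open>tensor_power m\<close> is
  the \<open>m\<close>-th tensor power.\<close>

inductive_set multilin_rel :: "('a :: qspace list \<Rightarrow>\<^sub>0 qv) set" where
  zero: "0 \<in> multilin_rel"
| add: "x \<in> multilin_rel \<Longrightarrow>
    x + (Poly_Mapping.single (us @ (a + b) # vs) c - Poly_Mapping.single (us @ a # vs) c
      - Poly_Mapping.single (us @ b # vs) c) \<in> multilin_rel"
| scale: "x \<in> multilin_rel \<Longrightarrow>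
    x + (Poly_Mapping.single (us @ (d *\<^sub>q a) # vs) c - Poly_Mapping.single (us @ a # vs) (c * d))
      \<in> multilin_rel"

lemma multilin_rel_add:
  assumes "x \<in> multilin_rel" and "y \<in> multilin_rel"
  shows "x + y \<in> multilin_rel"
  using assms(2,1)
proof (induction y rule: multilin_rel.induct)
  case (add y us a b vs c)
  then show ?case using multilin_rel.add[of "x + y" us a b vs c] by (simp only: add.assoc)
next
  case (scale y us d a vs c)
  then show ?case using multilin_rel.scale[of "x + y" us d a vs c] by (simp only: add.assoc)
qed simp

definition fscale :: "qv \<Rightarrow> ('b \<Rightarrow>\<^sub>0 qv) \<Rightarrow> ('b \<Rightarrow>\<^sub>0 qv)" where
  "fscale d = Poly_Mapping.map ((*) d)"

lemma lookup_fscale: "Poly_Mapping.lookup (fscale d p) w = d * Poly_Mapping.lookup p w"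
  by (simp add: fscale_def map.rep_eq when_def)

lemma fscale_add: "fscale d (p + q) = fscale d p + fscale d q"
  by (rule poly_mapping_eqI) (simp add: lookup_fscale lookup_add distrib_left)

lemma fscale_diff: "fscale d (p - q) = fscale d p - fscale d q"
  by (rule poly_mapping_eqI) (simp add: lookup_fscale lookup_minus right_diff_distrib)

lemma fscale_single: "fscale d (Poly_Mapping.single w c) = Poly_Mapping.single w (d * c)"
  by (rule poly_mapping_eqI) (simp add: lookup_fscale lookup_single when_def)

lemma fscale_zero: "fscale d 0 = 0"
  by (rule poly_mapping_eqI) (simp add: lookup_fscale)

lemma fscale_one: "fscale 1 p = p"
  by (rule poly_mapping_eqI) (simp add: lookup_fscale)

lemma fscale_minus_one: "fscale (- 1) p = - p"
  by (rule poly_mapping_eqI) (simp add: lookup_fscale)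

lemma multilin_rel_fscale: "x \<in> multilin_rel \<Longrightarrow> fscale e x \<in> multilin_rel"
proof (induction rule: multilin_rel.induct)
  case zero
  show ?case by (simp add: fscale_zero multilin_rel.zero)
next
  case (add x us a b vs c)
  then show ?case using multilin_rel.add[of "fscale e x" us a b vs "e * c"]
    by (simp only: fscale_add fscale_diff fscale_single)
next
  case (scale x us d a vs c)
  then show ?case using multilin_rel.scale[of "fscale e x" us d a vs "e * c"]
    by (simp only: fscale_add fscale_diff fscale_single mult.assoc)
qed

lemma multilin_rel_uminus: "x \<in> multilin_rel \<Longrightarrow> - x \<in> multilin_rel"
  using multilin_rel_fscale[of x "- 1"] by (simp add: fscale_minus_one)

definition tensor_eq :: "('a :: qspace list \<Rightarrow>\<^sub>0 qv) \<Rightarrow> ('a list \<Rightarrow>\<^sub>0 qv) \<Rightarrow> bool" where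
  "tensor_eq x y \<longleftrightarrow> x - y \<in> multilin_rel"

lemma equivp_tensor_eq: "equivp tensor_eq"
proof (rule equivpI)
  show "reflp tensor_eq"
    by (rule reflpI) (simp add: tensor_eq_def multilin_rel.zero)
  show "symp tensor_eq"
    by (rule sympI) (use multilin_rel_uminus in \<open>fastforce simp: tensor_eq_def\<close>)
  show "transp tensor_eq"
    by (rule transpI) (use multilin_rel_add in \<open>fastforce simp: tensor_eq_def\<close>)
qed

quotient_type (overloaded) 'a tensor = "('a :: qspace) list \<Rightarrow>\<^sub>0 qv" / tensor_eq
  by (rule equivp_tensor_eq)

instantiation tensor :: (qspace) qspace
begin

lift_definition zero_tensor :: "'a tensor" is 0 .

lift_definition plus_tensor :: "'a tensor \<Rightarrow> 'a tensor \<Rightarrow> 'a tensor" is "(+)"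
  unfolding tensor_eq_def by (drule (1) multilin_rel_add) (simp add: algebra_simps)

lift_definition uminus_tensor :: "'a tensor \<Rightarrow> 'a tensor" is uminus
  unfolding tensor_eq_def by (drule multilin_rel_uminus) (simp add: algebra_simps)

lift_definition minus_tensor :: "'a tensor \<Rightarrow> 'a tensor \<Rightarrow> 'a tensor" is "(-)"
proof -
  fix x x' y y' :: "'a list \<Rightarrow>\<^sub>0 qv"
  assume "tensor_eq x x'" "tensor_eq y y'"
  then have "(x - x') + - (y - y') \<in> multilin_rel"
    unfolding tensor_eq_def by (intro multilin_rel_add multilin_rel_uminus)
  then show "tensor_eq (x - y) (x' - y')"
    by (simp add: tensor_eq_def algebra_simps)
qed

lift_definition scaleq_tensor :: "qv \<Rightarrow> 'a tensor \<Rightarrow> 'a tensor" is fscale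
  unfolding tensor_eq_def by (drule multilin_rel_fscale) (simp add: fscale_diff)

instance
proof
  fix x y z :: "'a tensor" and c d :: qv
  show "x + y + z = x + (y + z)" by transfer (simp add: tensor_eq_def multilin_rel.zero add.assoc)
  show "x + y = y + x" by transfer (simp add: tensor_eq_def multilin_rel.zero add.commute)
  show "0 + x = x" by transfer (simp add: tensor_eq_def multilin_rel.zero)
  show "- x + x = 0" by transfer (simp add: tensor_eq_def multilin_rel.zero)
  show "x - y = x + - y" by transfer (simp add: tensor_eq_def multilin_rel.zero)
  show "c *\<^sub>q (x + y) = c *\<^sub>q x + c *\<^sub>q y"
    by (transfer fixing: c) (simp add: tensor_eq_def multilin_rel.zero fscale_add)
  show "(c + d) *\<^sub>q x = c *\<^sub>q x + d *\<^sub>q x"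
  proof (transfer fixing: c d)
    fix x :: "'a list \<Rightarrow>\<^sub>0 qv"
    have "fscale (c + d) x = fscale c x + fscale d x"
      by (rule poly_mapping_eqI) (simp add: lookup_fscale lookup_add distrib_right)
    then show "tensor_eq (fscale (c + d) x) (fscale c x + fscale d x)"
      by (simp add: tensor_eq_def multilin_rel.zero)
  qed
  show "c *\<^sub>q d *\<^sub>q x = (c * d) *\<^sub>q x"
  proof (transfer fixing: c d)
    fix x :: "'a list \<Rightarrow>\<^sub>0 qv"
    have "fscale c (fscale d x) = fscale (c * d) x"
      by (rule poly_mapping_eqI) (simp add: lookup_fscale mult.assoc)
    then show "tensor_eq (fscale c (fscale d x)) (fscale (c * d) x)"
      by (simp add: tensor_eq_def multilin_rel.zero)
  qed
  show "1 *\<^sub>q x = x"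
    by (induction x rule: tensor.abs_induct) (simp add: scaleq_tensor.abs_eq fscale_one)
qed

end

lift_definition pure :: "'a list \<Rightarrow> 'a :: qspace tensor"
  is "\<lambda>vs. Poly_Mapping.single vs 1" .

definition tensor_power :: "nat \<Rightarrow> 'a :: qspace tensor set" where
  "tensor_power m = qspace.span {pure vs | vs. length vs = m}"

lemma pure_scaleq: "pure (us @ (c *\<^sub>q a) # vs) = c *\<^sub>q pure (us @ a # vs)"
proof (transfer fixing: us c a vs)
  show "tensor_eq (Poly_Mapping.single (us @ (c *\<^sub>q a) # vs) 1)
      (fscale c (Poly_Mapping.single (us @ a # vs) 1))"
    using multilin_rel.scale[OF multilin_rel.zero, of us c a vs 1]
    by (simp add: tensor_eq_def fscale_single)
qed

text \<open>The linear map with prescribed values on pure tensors.  It is given by the formula below on an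
  arbitrarily chosen representative, and is thus the intended map whenever \<open>f\<close> is multilinear.\<close>

definition tensor_lift :: "('a list \<Rightarrow> 'b) \<Rightarrow> 'a :: qspace tensor \<Rightarrow> 'b :: qspace" where
  "tensor_lift f t =
    (let p = rep_tensor t in \<Sum>vs\<in>Poly_Mapping.keys p. Poly_Mapping.lookup p vs *\<^sub>q f vs)"

definition tensor_par :: "'a :: superspace tensor \<Rightarrow> 'a tensor" where
  "tensor_par = tensor_lift (\<lambda>vs. pure (map par vs))"

text \<open>The sign rule
  \<open>(g\<^sub>1 \<otimes> \<dots> \<otimes> g\<^sub>m) (v\<^sub>1 \<otimes> \<dots> \<otimes> v\<^sub>m) = (-1)\<^bsup>N\<^esup> g\<^sub>1 v\<^sub>1 \<otimes> \<dots> \<otimes> g\<^sub>m v\<^sub>m\<close>, where \<open>N\<close> counts the pairs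
  \<open>s < t\<close> with \<open>v\<^sub>s\<close> and \<open>g\<^sub>t\<close> odd; inhomogeneous \<open>g\<^sub>t\<close>, \<open>v\<^sub>s\<close> are split into their homogeneous
  components, \<open>P\<close> and \<open>Q\<close> being the sets of positions at which the odd component is taken.\<close>

definition koszul ::
  "('u :: superspace \<Rightarrow> 'v \<Rightarrow> 'v) \<Rightarrow> 'u list \<Rightarrow> 'v list \<Rightarrow> 'v :: superspace tensor" where
  "koszul act gs vs =
    (if length gs = length vs then
      (let m = length vs in
        \<Sum>P\<in>Pow {..<m}. \<Sum>Q\<in>Pow {..<m}.
          (- 1) ^ card {(s, t). s < t \<and> s \<in> Q \<and> t \<in> P} *\<^sub>q
            pure (map (\<lambda>k. act (hpart (k \<in> P) (gs ! k)) (hpart (k \<in> Q) (vs ! k))) [0..<m]))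
     else 0)"

definition tensor_act ::
  "('u :: superspace \<Rightarrow> 'v \<Rightarrow> 'v) \<Rightarrow> 'u tensor \<Rightarrow> 'v tensor \<Rightarrow> 'v :: superspace tensor" where
  "tensor_act act u t = tensor_lift (\<lambda>gs. tensor_lift (\<lambda>vs. koszul act gs vs) t) u"

definition tensor_mult :: "'u :: superalgebra tensor \<Rightarrow> 'u tensor \<Rightarrow> 'u tensor" where
  "tensor_mult = tensor_act (*)"

text \<open>\<open>apply_at D k\<close> is \<open>id \<otimes> \<dots> \<otimes> D \<otimes> \<dots> \<otimes> id\<close> with \<open>D\<close> in the tensor position \<open>k\<close>, counted
  from 0.\<close>

definition apply_at :: "('u \<Rightarrow> 'u tensor) \<Rightarrow> nat \<Rightarrow> 'u tensor \<Rightarrow> 'u :: qspace tensor" where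
  "apply_at D k = tensor_lift (\<lambda>us.
    if k < length us
    then tensor_lift (\<lambda>ds. pure (take k us @ ds @ drop (Suc k) us)) (D (us ! k))
    else 0)"

text \<open>\<open>iterated_comult D m\<close> takes values in the \<open>(m + 1)\<close>-st tensor power.\<close>

primrec iterated_comult :: "('u \<Rightarrow> 'u tensor) \<Rightarrow> nat \<Rightarrow> 'u \<Rightarrow> 'u :: qspace tensor" where
  "iterated_comult D 0 u = pure [u]"
| "iterated_comult D (Suc m) u = apply_at D 0 (iterated_comult D m u)"


section \<open>The quantum queer superalgebra\<close>

text \<open>\<open>GK i\<close>, \<open>GL i\<close>, \<open>GE j\<close>, \<open>GF j\<close> stand for the even generators \<open>K\<^sub>i\<close>, \<open>K\<^sub>i\<close>-inverse, \<open>E\<^sub>j\<close>, \<open>F\<^sub>j\<close>, and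
  \<open>GKo i\<close>, \<open>GEo j\<close>, \<open>GFo j\<close> for the odd ones (the barred indices).  The type parameter only
  serves to fix \<open>n = CARD('n)\<close>; generators whose index is out of range are set to 0 by a relation.\<close>

datatype 'n ugen = GK nat | GL nat | GE nat | GF nat | GKo nat | GEo nat | GFo nat

instantiation ugen :: (type) graded_gen
begin

primrec odd_gen_ugen :: "'a ugen \<Rightarrow> bool" where
  "odd_gen (GK i :: 'a ugen) = False"
| "odd_gen (GL i :: 'a ugen) = False"
| "odd_gen (GE i :: 'a ugen) = False"
| "odd_gen (GF i :: 'a ugen) = False"
| "odd_gen (GKo i :: 'a ugen) = True"
| "odd_gen (GEo i :: 'a ugen) = True"
| "odd_gen (GFo i :: 'a ugen) = True"

instance ..

end

fun ugen_in_range :: "nat \<Rightarrow> 'n ugen \<Rightarrow> bool" where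
  "ugen_in_range n (GK i) \<longleftrightarrow> 1 \<le> i \<and> i \<le> n"
| "ugen_in_range n (GL i) \<longleftrightarrow> 1 \<le> i \<and> i \<le> n"
| "ugen_in_range n (GKo i) \<longleftrightarrow> 1 \<le> i \<and> i \<le> n"
| "ugen_in_range n (GE j) \<longleftrightarrow> 1 \<le> j \<and> j < n"
| "ugen_in_range n (GF j) \<longleftrightarrow> 1 \<le> j \<and> j < n"
| "ugen_in_range n (GEo j) \<longleftrightarrow> 1 \<le> j \<and> j < n"
| "ugen_in_range n (GFo j) \<longleftrightarrow> 1 \<le> j \<and> j < n"

abbreviation "fK i \<equiv> fgen (GK i)"
abbreviation "fL i \<equiv> fgen (GL i)"
abbreviation "fE j \<equiv> fgen (GE j)"
abbreviation "fF j \<equiv> fgen (GF j)"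
abbreviation "fKo i \<equiv> fgen (GKo i)"
abbreviation "fEo j \<equiv> fgen (GEo j)"
abbreviation "fFo j \<equiv> fgen (GFo j)"

definition kdelta :: "nat \<Rightarrow> nat \<Rightarrow> 'a :: zero_neq_one" where
  "kdelta i j = (if i = j then 1 else 0)"

text \<open>A relation \<open>l = r\<close> is recorded as the element \<open>l - r\<close>.\<close>

inductive_set uq_relators :: "nat \<Rightarrow> 'n ugen freealg set" for n :: nat where
  out_of_range: "\<not> ugen_in_range n g \<Longrightarrow> fgen g \<in> uq_relators n"
| QQ1a: "i \<in> {1..n} \<Longrightarrow> fK i * fL i - 1 \<in> uq_relators n"
| QQ1b: "i \<in> {1..n} \<Longrightarrow> fL i * fK i - 1 \<in> uq_relators n"
| QQ1c: "i \<in> {1..n} \<Longrightarrow> j \<in> {1..n} \<Longrightarrow> fK i * fK j - fK j * fK i \<in> uq_relators n"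
| QQ1d: "i \<in> {1..n} \<Longrightarrow> j \<in> {1..n} \<Longrightarrow> fK i * fKo j - fKo j * fK i \<in> uq_relators n"
| QQ1e: "i \<in> {1..n} \<Longrightarrow> j \<in> {1..n} \<Longrightarrow>
    fKo i * fKo j + fKo j * fKo i
      - fconst (2 * kdelta i j / (\<upsilon> powi 2 - \<upsilon> powi (- 2))) * (fK i ^ 2 - fL i ^ 2)
    \<in> uq_relators n"
| QQ2a: "i \<in> {1..n} \<Longrightarrow> j \<in> {1..<n} \<Longrightarrow>
    fK i * fE j - fconst (\<upsilon> powi (kdelta i j - kdelta i (j + 1))) * fE j * fK i \<in> uq_relators n"
| QQ2b: "i \<in> {1..n} \<Longrightarrow> j \<in> {1..<n} \<Longrightarrow>
    fK i * fF j - fconst (\<upsilon> powi (- (kdelta i j - kdelta i (j + 1)))) * fF j * fK i \<in> uq_relators n"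
| QQ2c: "i \<in> {1..n} \<Longrightarrow> j \<in> {1..<n} \<Longrightarrow>
    fK i * fEo j - fconst (\<upsilon> powi (kdelta i j - kdelta i (j + 1))) * fEo j * fK i \<in> uq_relators n"
| QQ2d: "i \<in> {1..n} \<Longrightarrow> j \<in> {1..<n} \<Longrightarrow>
    fK i * fFo j - fconst (\<upsilon> powi (- (kdelta i j - kdelta i (j + 1)))) * fFo j * fK i \<in> uq_relators n"
| QQ3a: "i \<in> {1..n} \<Longrightarrow> j \<in> {1..<n} \<Longrightarrow> i \<noteq> j \<Longrightarrow> i \<noteq> j + 1 \<Longrightarrow>
    fKo i * fE j - fE j * fKo i \<in> uq_relators n"
| QQ3b: "i \<in> {1..n} \<Longrightarrow> j \<in> {1..<n} \<Longrightarrow> i \<noteq> j \<Longrightarrow> i \<noteq> j + 1 \<Longrightarrow>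
    fKo i * fF j - fF j * fKo i \<in> uq_relators n"
| QQ3c: "j \<in> {1..<n} \<Longrightarrow>
    fKo j * fE j - fconst \<upsilon> * fE j * fKo j - fEo j * fL j \<in> uq_relators n"
| QQ3d: "j \<in> {1..<n} \<Longrightarrow>
    fconst \<upsilon> * fKo (j + 1) * fE j - fE j * fKo (j + 1) - (- (fL (j + 1) * fEo j)) \<in> uq_relators n"
| QQ3e: "j \<in> {1..<n} \<Longrightarrow>
    fKo j * fF j - fconst \<upsilon> * fF j * fKo j - (- (fFo j * fK j)) \<in> uq_relators n"
| QQ3f: "j \<in> {1..<n} \<Longrightarrow>
    fconst \<upsilon> * fKo (j + 1) * fF j - fF j * fKo (j + 1) - fK (j + 1) * fFo j \<in> uq_relators n"
| QQ4a: "i \<in> {1..<n} \<Longrightarrow> j \<in> {1..<n} \<Longrightarrow>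
    fE i * fF j - fF j * fE i
      - fconst (kdelta i j / (\<upsilon> - inverse \<upsilon>)) * (fK i * fL (i + 1) - fL i * fK (i + 1))
    \<in> uq_relators n"
| QQ4b: "i \<in> {1..<n} \<Longrightarrow> j \<in> {1..<n} \<Longrightarrow>
    fE i * fFo j - fFo j * fE i
      - fconst (kdelta i j) * (fL (i + 1) * fKo i - fKo (i + 1) * fL i) \<in> uq_relators n"
| QQ4c: "i \<in> {1..<n} \<Longrightarrow> j \<in> {1..<n} \<Longrightarrow>
    fEo i * fF j - fF j * fEo i
      - fconst (kdelta i j) * (fK (i + 1) * fKo i - fKo (i + 1) * fK i) \<in> uq_relators n"
| QQ5a: "i \<in> {1..<n} \<Longrightarrow> j \<in> {1..<n} \<Longrightarrow> \<bar>int i - int j\<bar> > 1 \<Longrightarrow>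
    fE i * fE j - fE j * fE i \<in> uq_relators n"
| QQ5b: "i \<in> {1..<n} \<Longrightarrow> j \<in> {1..<n} \<Longrightarrow> \<bar>int i - int j\<bar> > 1 \<Longrightarrow>
    fF i * fF j - fF j * fF i \<in> uq_relators n"
| QQ5c: "i \<in> {1..<n} \<Longrightarrow> fE i * fEo i - fEo i * fE i \<in> uq_relators n"
| QQ5d: "i \<in> {1..<n} \<Longrightarrow> fF i * fFo i - fFo i * fF i \<in> uq_relators n"
| QQ5e: "i \<in> {1..<n - 1} \<Longrightarrow>
    fE i * fE (i + 1) - fconst \<upsilon> * fE (i + 1) * fE i
      - (fEo i * fEo (i + 1) + fconst \<upsilon> * fEo (i + 1) * fEo i) \<in> uq_relators n"
| QQ5f: "i \<in> {1..<n - 1} \<Longrightarrow>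
    fconst \<upsilon> * fF (i + 1) * fF i - fF i * fF (i + 1)
      - (fFo i * fFo (i + 1) + fconst \<upsilon> * fFo (i + 1) * fFo i) \<in> uq_relators n"
| QQ6a: "i \<in> {1..<n} \<Longrightarrow> j \<in> {1..<n} \<Longrightarrow> \<bar>int i - int j\<bar> = 1 \<Longrightarrow> Z \<in> {fE j, fEo j} \<Longrightarrow>
    fE i ^ 2 * Z - fconst (\<upsilon> + inverse \<upsilon>) * fE i * Z * fE i + Z * fE i ^ 2 \<in> uq_relators n"
| QQ6b: "i \<in> {1..<n} \<Longrightarrow> j \<in> {1..<n} \<Longrightarrow> \<bar>int i - int j\<bar> = 1 \<Longrightarrow> Z \<in> {fF j, fFo j} \<Longrightarrow>
    fF i ^ 2 * Z - fconst (\<upsilon> + inverse \<upsilon>) * fF i * Z * fF i + Z * fF i ^ 2 \<in> uq_relators n"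

lemma uq_relators_homogeneous: "r \<in> uq_relators n \<Longrightarrow> fpar r = r \<or> fpar r = - r"
  by (induction rule: uq_relators.induct)
    (auto simp: fpar_add fpar_diff fpar_uminus fpar_mult fpar_fgen fpar_fconst fpar_one
      power2_eq_square right_diff_distrib)

instantiation ugen :: (finite) presentation
begin

definition "relators = (uq_relators CARD('a) :: 'a ugen freealg set)"

instance
  by standard (simp add: relators_ugen_def uq_relators_homogeneous)

end

type_synonym 'n uq = "'n ugen alg"

definition uK :: "nat \<Rightarrow> 'n :: finite uq" where "uK i = gen (GK i)"
definition uL :: "nat \<Rightarrow> 'n :: finite uq" where "uL i = gen (GL i)"
definition uE :: "nat \<Rightarrow> 'n :: finite uq" where "uE j = gen (GE j)"
definition uF :: "nat \<Rightarrow> 'n :: finite uq" where "uF j = gen (GF j)"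
definition uKo :: "nat \<Rightarrow> 'n :: finite uq" where "uKo i = gen (GKo i)"

text \<open>The values below determine the comultiplication, since the algebra is generated by the elements
  \<open>uK i\<close>, \<open>uL i\<close>, \<open>uE h\<close>, \<open>uF h\<close> and \<open>uKo 1\<close>.\<close>

definition is_uq_comult :: "('n :: finite uq \<Rightarrow> 'n uq tensor) \<Rightarrow> bool" where
  "is_uq_comult D \<longleftrightarrow>
    Vector_Spaces.linear scaleq scaleq D \<and>
    (\<forall>x. D x \<in> tensor_power 2) \<and>
    (\<forall>x. D (par x) = tensor_par (D x)) \<and>
    D 1 = pure [1, 1] \<and>
    (\<forall>x y. D (x * y) = tensor_mult (D x) (D y)) \<and>
    (\<forall>x. apply_at D 0 (D x) = apply_at D 1 (D x)) \<and>
    (\<forall>i\<in>{1..CARD('n)}. D (uK i) = pure [uK i, uK i]) \<and>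
    (\<forall>h\<in>{1..<CARD('n)}. D (uE h) = pure [uE h, uL h * uK (h + 1)] + pure [1, uE h]) \<and>
    (\<forall>h\<in>{1..<CARD('n)}. D (uF h) = pure [uF h, 1] + pure [uK h * uL (h + 1), uF h]) \<and>
    D (uKo 1) = pure [uKo 1, uK 1] + pure [uL 1, uKo 1]"

definition is_supermodule ::
  "('u :: superalgebra \<Rightarrow> 'v :: superspace \<Rightarrow> 'v) \<Rightarrow> bool" where
  "is_supermodule act \<longleftrightarrow>
    (\<forall>v. Vector_Spaces.linear scaleq scaleq (\<lambda>u. act u v)) \<and>
    (\<forall>u. Vector_Spaces.linear scaleq scaleq (act u)) \<and>
    (\<forall>v. act 1 v = v) \<and>
    (\<forall>x y v. act (x * y) v = act x (act y v)) \<and>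
    (\<forall>u v. par (act u v) = act (par u) (par v))"


section \<open>The quantum superspace\<close>

text \<open>\<open>GX i\<close> is the even generator \<open>X\<^sub>i\<close> and \<open>GXo i\<close> the odd one; indices out of range are treated as
  above.\<close>

datatype 'n xgen = GX nat | GXo nat

instantiation xgen :: (type) graded_gen
begin

primrec odd_gen_xgen :: "'a xgen \<Rightarrow> bool" where
  "odd_gen (GX i :: 'a xgen) = False"
| "odd_gen (GXo i :: 'a xgen) = True"

instance ..

end

abbreviation "fX i \<equiv> fgen (GX i)"
abbreviation "fXo i \<equiv> fgen (GXo i)"

inductive_set xa_relators :: "nat \<Rightarrow> 'n xgen freealg set" for n :: nat where
  out_of_range: "i \<notin> {1..n} \<Longrightarrow> g \<in> {fX i, fXo i} \<Longrightarrow> g \<in> xa_relators n"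
| even_even: "i \<in> {1..n} \<Longrightarrow> j \<in> {1..n} \<Longrightarrow> fX i * fX j - fX j * fX i \<in> xa_relators n"
| even_odd: "i \<in> {1..n} \<Longrightarrow> j \<in> {1..n} \<Longrightarrow> fX i * fXo j - fXo j * fX i \<in> xa_relators n"
| odd_odd: "i \<in> {1..n} \<Longrightarrow> j \<in> {1..n} \<Longrightarrow> i \<noteq> j \<Longrightarrow>
    fXo i * fXo j - (- (fXo j * fXo i)) \<in> xa_relators n"
| odd_square: "i \<in> {1..n} \<Longrightarrow>
    fXo i ^ 2 - fconst ((\<upsilon> - inverse \<upsilon>) / (\<upsilon> + inverse \<upsilon>)) * fX i ^ 2 \<in> xa_relators n"

lemma xa_relators_homogeneous: "r \<in> xa_relators n \<Longrightarrow> fpar r = r \<or> fpar r = - r"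
  by (induction rule: xa_relators.induct)
    (auto simp: fpar_add fpar_diff fpar_uminus fpar_mult fpar_fgen fpar_fconst power2_eq_square)

instantiation xgen :: (finite) presentation
begin

definition "relators = (xa_relators CARD('a) :: 'a xgen freealg set)"

instance
  by standard (simp add: relators_xgen_def xa_relators_homogeneous)

end

type_synonym 'n xa = "'n xgen alg"

definition xX :: "nat \<Rightarrow> 'n :: finite xa" where "xX i = gen (GX i)"
definition xXo :: "nat \<Rightarrow> 'n :: finite xa" where "xXo i = gen (GXo i)"

definition xmono :: "(nat \<Rightarrow> nat) \<Rightarrow> (nat \<Rightarrow> nat) \<Rightarrow> 'n :: finite xa" where
  "xmono a b = prod_list (map (\<lambda>i. xX i ^ a i) [1..<CARD('n) + 1])
    * prod_list (map (\<lambda>i. xXo i ^ b i) [1..<CARD('n) + 1])"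

definition xdivmono :: "(nat \<Rightarrow> nat) \<Rightarrow> (nat \<Rightarrow> nat) \<Rightarrow> 'n :: finite xa" where
  "xdivmono a b = prod_list (map (\<lambda>i. (1 / qfact (a i)) *\<^sub>q xX i ^ a i) [1..<CARD('n) + 1])
    * prod_list (map (\<lambda>i. (1 / qfact (b i)) *\<^sub>q xXo i ^ b i) [1..<CARD('n) + 1])"

definition unit_vec :: "nat \<Rightarrow> nat \<Rightarrow> 'a :: zero_neq_one" where
  "unit_vec i = (\<lambda>k. kdelta i k)"

text \<open>In a monomial \<open>xmono a b\<close> the vector \<open>a\<close> holds the exponents of the even and \<open>b\<close> those of the odd
  generators.  Where the truncated subtraction on \<open>nat\<close> deviates from the true one, the
  coefficient is \<open>qint 0 = 0\<close>.\<close>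

definition is_xa_action :: "('n :: finite uq \<Rightarrow> 'n xa \<Rightarrow> 'n xa) \<Rightarrow> bool" where
  "is_xa_action act \<longleftrightarrow>
    is_supermodule act \<and>
    (\<forall>a b. (\<forall>k\<in>{1..CARD('n)}. b k \<in> {0, 1}) \<longrightarrow>
      (\<forall>i\<in>{1..CARD('n)}. act (uK i) (xmono a b) = \<upsilon> powi int (a i + b i) *\<^sub>q xmono a b) \<and>
      (\<forall>h\<in>{1..<CARD('n)}. act (uE h) (xmono a b) =
        (\<upsilon> powi int (b (h + 1)) * qint (int (a (h + 1))))
          *\<^sub>q xmono (a + unit_vec h - unit_vec (h + 1)) b
        + (\<upsilon> powi (- int (a (h + 1))) * qint (int (b (h + 1))))
          *\<^sub>q xmono a (b + unit_vec h - unit_vec (h + 1))) \<and>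
      (\<forall>h\<in>{1..<CARD('n)}. act (uF h) (xmono a b) =
        (\<upsilon> powi (- int (b h)) * qint (int (a h)))
          *\<^sub>q xmono (a - unit_vec h + unit_vec (h + 1)) b
        + (\<upsilon> powi int (a h) * qint (int (b h)))
          *\<^sub>q xmono a (b - unit_vec h + unit_vec (h + 1))) \<and>
      act (uKo 1) (xmono a b) =
        (\<upsilon> powi (- int (a 1)) * qint (int (b 1))) *\<^sub>q xmono (a + unit_vec 1) (b - unit_vec 1)
        + (\<upsilon> powi int (b 1) * qint (int (a 1))) *\<^sub>q xmono (a - unit_vec 1) (b + unit_vec 1))"


section \<open>The tensor superspace and its completion\<close>

text \<open>Matrices and vectors are functions on \<open>nat\<close> of which only the values at the indices
  \<open>1, \<dots>, n\<close> matter; \<open>A0\<close> and \<open>A1\<close> are the two components of a pair \<open>(A\<^sup>0|A\<^sup>1)\<close>.\<close>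

type_synonym nmat = "nat \<Rightarrow> nat \<Rightarrow> nat"

definition mat_sum :: "nat \<Rightarrow> nmat \<Rightarrow> nmat \<Rightarrow> nat" where
  "mat_sum n A0 A1 = (\<Sum>s = 1..n. \<Sum>t = 1..n. A0 s t + A1 s t)"

definition unit_mat :: "nat \<Rightarrow> nat \<Rightarrow> nmat" where
  "unit_mat i j = (\<lambda>s t. kdelta i s * kdelta j t)"

definition diag_mat :: "(nat \<Rightarrow> nat) \<Rightarrow> nmat" where
  "diag_mat l = (\<lambda>s t. kdelta s t * l s)"

definition xtensor :: "nmat \<Rightarrow> nmat \<Rightarrow> 'n :: finite xa tensor" where
  "xtensor A0 A1 = pure (map (\<lambda>j. xdivmono (\<lambda>i. A0 i j) (\<lambda>i. A1 i j)) [1..<CARD('n) + 1])"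

definition tensor_deg :: "nat \<Rightarrow> 'n :: finite xa tensor set" where
  "tensor_deg r = qspace.span {xtensor A0 A1 | A0 A1.
    (\<forall>s\<in>{1..CARD('n)}. \<forall>t\<in>{1..CARD('n)}. A1 s t \<in> {0, 1}) \<and> mat_sum CARD('n) A0 A1 = r}"

definition uq_tensor_act ::
  "('n :: finite uq \<Rightarrow> 'n uq tensor) \<Rightarrow> ('n uq \<Rightarrow> 'n xa \<Rightarrow> 'n xa) \<Rightarrow>
    'n uq \<Rightarrow> 'n xa tensor \<Rightarrow> 'n xa tensor" where
  "uq_tensor_act D act u t = tensor_act act (iterated_comult D (CARD('n) - 1) u) t"

text \<open>An element of the product over all \<open>r\<close> of the submodules \<open>tensor_deg r\<close> is the function mapping
  \<open>r\<close> to its component in degree \<open>r\<close>.\<close>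

definition tensor_hat :: "(nat \<Rightarrow> 'n :: finite xa tensor) set" where
  "tensor_hat = {x. \<forall>r. x r \<in> tensor_deg r}"

definition uq_hat_act ::
  "('n :: finite uq \<Rightarrow> 'n uq tensor) \<Rightarrow> ('n uq \<Rightarrow> 'n xa \<Rightarrow> 'n xa) \<Rightarrow>
    'n uq \<Rightarrow> (nat \<Rightarrow> 'n xa tensor) \<Rightarrow> (nat \<Rightarrow> 'n xa tensor)" where
  "uq_hat_act D act u x = (\<lambda>r. uq_tensor_act D act u (x r))"

instantiation "fun" :: (type, qspace) qspace
begin

definition scaleq_fun :: "qv \<Rightarrow> ('a \<Rightarrow> 'b) \<Rightarrow> 'a \<Rightarrow> 'b" where
  "c *\<^sub>q f = (\<lambda>x. c *\<^sub>q f x)"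

instance
  by standard
    (simp_all add: fun_eq_iff scaleq_fun_def scaleq_add_right scaleq_add_left scaleq_scaleq scaleq_one)

end

text \<open>The component of \<open>A(j)\<close> in degree \<open>r\<close> is the finite sum of the terms of degree \<open>r\<close> of the defining
  infinite sum.\<close>

definition xseries :: "nmat \<Rightarrow> nmat \<Rightarrow> (nat \<Rightarrow> int) \<Rightarrow> nat \<Rightarrow> 'n :: finite xa tensor" where
  "xseries A0 A1 j r =
    (\<Sum>l\<in>{l. (\<forall>k. k \<notin> {1..CARD('n)} \<longrightarrow> l k = 0) \<and> mat_sum CARD('n) (A0 + diag_mat l) A1 = r}.
      \<upsilon> powi (\<Sum>k = 1..CARD('n). int (l k) * j k) *\<^sub>q xtensor (A0 + diag_mat l) A1)"

text \<open>The terms of the series lie in the submodules \<open>tensor_deg r\<close> even if entries of \<open>A\<^sup>1\<close>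
  exceed 1, since squares of odd generators are multiples of squares of even ones.\<close>

lemma \<upsilon>_power: "\<upsilon> ^ m = Fract (monom 1 m) 1"
  by (induction m) (simp_all add: \<upsilon>_def One_fract_def monom_Suc)

lemma \<upsilon>_power_neq_one: "m > 0 \<Longrightarrow> \<upsilon> ^ m \<noteq> 1"
  by (auto simp: \<upsilon>_power One_fract_def eq_fract monom_eq_1_iff)

lemma \<upsilon>_nonzero: "\<upsilon> \<noteq> 0"
  by (simp add: \<upsilon>_def Zero_fract_def eq_fract)

lemma qint_nonzero:
  assumes "k > 0"
  shows "qint (int k) \<noteq> 0"
proof -
  have "\<upsilon> ^ m \<noteq> inverse (\<upsilon> ^ m)" if "m > 0" for m
  proof
    assume "\<upsilon> ^ m = inverse (\<upsilon> ^ m)"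
    then have "\<upsilon> ^ m * \<upsilon> ^ m = 1" using \<upsilon>_nonzero by (simp add: field_simps)
    then show False using \<upsilon>_power_neq_one[of "m + m"] that by (simp add: power_add)
  qed
  from this[of k] this[of 1] assms show ?thesis
    by (simp add: qint_def power_int_minus)
qed

lemma qfact_nonzero: "qfact m \<noteq> 0"
  by (auto simp: qfact_def qint_nonzero)

lemma xX_out_of_range: "i \<notin> {1..CARD('n)} \<Longrightarrow> (xX i :: 'n :: finite xa) = 0"
  unfolding xX_def
  by transfer (rule relator_eqI, simp add: relators_xgen_def xa_relators.out_of_range)

lemma xXo_out_of_range: "i \<notin> {1..CARD('n)} \<Longrightarrow> (xXo i :: 'n :: finite xa) = 0"
  unfolding xXo_def
  by transfer (rule relator_eqI, simp add: relators_xgen_def xa_relators.out_of_range)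

lemma xX_commute: "xX i * xX k = xX k * (xX i :: 'n :: finite xa)"
proof (cases "i \<in> {1..CARD('n)} \<and> k \<in> {1..CARD('n)}")
  case True
  then show ?thesis unfolding xX_def
    by transfer (rule relator_eqI, simp add: relators_xgen_def xa_relators.even_even)
qed (auto simp: xX_out_of_range)

lemma xX_xXo_commute: "xX i * xXo k = xXo k * (xX i :: 'n :: finite xa)"
proof (cases "i \<in> {1..CARD('n)} \<and> k \<in> {1..CARD('n)}")
  case True
  then show ?thesis unfolding xX_def xXo_def
    by transfer (rule relator_eqI, simp add: relators_xgen_def xa_relators.even_odd)
qed (auto simp: xX_out_of_range xXo_out_of_range)

lemma xXo_square:
  "xXo i ^ 2 = ((\<upsilon> - inverse \<upsilon>) / (\<upsilon> + inverse \<upsilon>)) *\<^sub>q (xX i ^ 2 :: 'n :: finite xa)"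
proof (cases "i \<in> {1..CARD('n)}")
  case True
  define c where "c = (\<upsilon> - inverse \<upsilon>) / (\<upsilon> + inverse \<upsilon>)"
  have "xXo i * xXo i = c *\<^sub>q (xX i * xX i :: 'n xa)"
    unfolding xX_def xXo_def
  proof (transfer fixing: i c)
    show "pres_eq (fXo i * fXo i) (fconst c * (fX i * fX i :: 'n xgen freealg))"
      by (rule relator_eqI)
        (use xa_relators.odd_square[of i "CARD('n)", where 'n = 'n] True in
          \<open>simp add: relators_xgen_def power2_eq_square c_def mult.assoc\<close>)
  qed
  then show ?thesis by (simp add: power2_eq_square c_def)
qed (simp add: xX_out_of_range xXo_out_of_range power2_eq_square)

lemma commute_power:
  fixes x y :: "'a :: monoid_mult"
  assumes "x * y = y * x"
  shows "x ^ m * y = y * x ^ m"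
  by (induction m) (simp_all add: mult.assoc assms, simp add: assms flip: mult.assoc)

lemma commute_prod_list:
  fixes y :: "'a :: monoid_mult"
  assumes "\<And>x. x \<in> set xs \<Longrightarrow> x * y = y * x"
  shows "prod_list xs * y = y * prod_list xs"
  using assms
proof (induction xs)
  case (Cons x xs)
  then have "prod_list xs * y = y * prod_list xs" and "x * y = y * x" by auto
  then show ?case by (simp add: mult.assoc) (simp flip: mult.assoc)
qed simp

lemma prod_list_mult:
  fixes f g :: "'b \<Rightarrow> 'a :: monoid_mult"
  assumes "\<And>i k. f i * g k = g k * f i"
  shows "prod_list (map f l) * prod_list (map g l) = prod_list (map (\<lambda>i. f i * g i) l)"
proof (induction l)
  case (Cons i l)
  have "prod_list (map f l) * g i = g i * prod_list (map f l)"
    by (rule commute_prod_list) (auto simp: assms)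
  then have "prod_list (map f (i # l)) * prod_list (map g (i # l))
      = f i * g i * (prod_list (map f l) * prod_list (map g l))"
    by (simp add: mult.assoc) (simp flip: mult.assoc)
  then show ?case using Cons.IH by simp
qed simp

lemma prod_list_scaleq:
  fixes f :: "'b \<Rightarrow> 'a :: superalgebra"
  shows "prod_list (map (\<lambda>i. c i *\<^sub>q f i) l) = prod_list (map c l) *\<^sub>q prod_list (map f l)"
  by (induction l)
    (simp_all add: scaleq_one scaleq_mult_left scaleq_mult_right scaleq_scaleq mult.commute)

lemma power_scaleq: "(c *\<^sub>q x) ^ m = c ^ m *\<^sub>q (x ^ m :: 'a :: superalgebra)"
  by (induction m)
    (simp_all add: scaleq_one scaleq_mult_left scaleq_mult_right scaleq_scaleq mult.commute)

lemma xmono_reduce: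
  "\<exists>c. (xmono a b :: 'n :: finite xa) = c *\<^sub>q xmono (\<lambda>i. a i + 2 * (b i div 2)) (\<lambda>i. b i mod 2)"
proof -
  define c where "c = (\<upsilon> - inverse \<upsilon>) / (\<upsilon> + inverse \<upsilon>)"
  define l where "l = [1..<CARD('n) + 1]"
  have *: "(xXo i :: 'n xa) ^ b i
      = c ^ (b i div 2) *\<^sub>q (xX i ^ (2 * (b i div 2)) * xXo i ^ (b i mod 2))" for i
  proof -
    have "(xXo i :: 'n xa) ^ b i = xXo i ^ (2 * (b i div 2) + b i mod 2)" by simp
    also have "\<dots> = (xXo i ^ 2) ^ (b i div 2) * xXo i ^ (b i mod 2)"
      by (simp only: power_add power_mult)
    also have "\<dots> = (c *\<^sub>q xX i ^ 2) ^ (b i div 2) * xXo i ^ (b i mod 2)"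
      by (simp only: xXo_square c_def)
    also have "\<dots> = c ^ (b i div 2) *\<^sub>q (xX i ^ (2 * (b i div 2)) * xXo i ^ (b i mod 2))"
      by (simp only: power_scaleq scaleq_mult_left power_mult)
    finally show ?thesis .
  qed
  have XX: "(xX i :: 'n xa) ^ p * xX k ^ q = xX k ^ q * xX i ^ p" for i k p q
    by (rule commute_power, rule sym, rule commute_power, rule xX_commute)
  have XY: "(xX i :: 'n xa) ^ p * xXo k ^ q = xXo k ^ q * xX i ^ p" for i k p q
    by (rule commute_power, rule sym, rule commute_power, rule xX_xXo_commute[symmetric])
  have "(xmono a b :: 'n xa) = prod_list (map (\<lambda>i. xX i ^ a i) l) *
      (prod_list (map (\<lambda>i. c ^ (b i div 2)) l) *\<^sub>q
        (prod_list (map (\<lambda>i. xX i ^ (2 * (b i div 2))) l) * prod_list (map (\<lambda>i. xXo i ^ (b i mod 2)) l)))"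
    unfolding xmono_def l_def[symmetric]
    by (subst *, subst prod_list_scaleq, subst prod_list_mult) (rule XY, rule refl)
  also have "\<dots> = prod_list (map (\<lambda>i. c ^ (b i div 2)) l) *\<^sub>q
      ((prod_list (map (\<lambda>i. xX i ^ a i) l) * prod_list (map (\<lambda>i. xX i ^ (2 * (b i div 2))) l))
        * prod_list (map (\<lambda>i. xXo i ^ (b i mod 2)) l))"
    by (simp only: scaleq_mult_right mult.assoc)
  also have "\<dots> = prod_list (map (\<lambda>i. c ^ (b i div 2)) l) *\<^sub>q
      xmono (\<lambda>i. a i + 2 * (b i div 2)) (\<lambda>i. b i mod 2)"
    unfolding xmono_def l_def[symmetric]
    by (subst prod_list_mult) (rule XX, simp only: power_add)
  finally show ?thesis by blast
qed

lemma xdivmono_xmono: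
  "\<exists>c. c \<noteq> 0 \<and> (xdivmono a b :: 'n :: finite xa) = c *\<^sub>q xmono a b"
proof (intro exI conjI)
  let ?c = "\<lambda>f :: nat \<Rightarrow> nat. prod_list (map (\<lambda>i. 1 / qfact (f i)) [1..<CARD('n) + 1])"
  show "?c a * ?c b \<noteq> 0" by (auto simp: prod_list_zero_iff qfact_nonzero)
  show "(xdivmono a b :: 'n xa) = (?c a * ?c b) *\<^sub>q xmono a b"
    unfolding xdivmono_def xmono_def
    by (simp only: prod_list_scaleq scaleq_mult_left scaleq_mult_right scaleq_scaleq)
      (simp only: mult.commute[of "?c b" "?c a"])
qed

lemma xdivmono_reduce:
  "\<exists>c. (xdivmono a b :: 'n :: finite xa)
    = c *\<^sub>q xdivmono (\<lambda>i. a i + 2 * (b i div 2)) (\<lambda>i. b i mod 2)"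
proof -
  let ?a = "\<lambda>i. a i + 2 * (b i div 2)" and ?b = "\<lambda>i. b i mod 2"
  obtain c where c: "(xdivmono a b :: 'n xa) = c *\<^sub>q xmono a b"
    using xdivmono_xmono by blast
  obtain d where d: "(xmono a b :: 'n xa) = d *\<^sub>q xmono ?a ?b"
    using xmono_reduce by blast
  obtain e where e: "e \<noteq> 0" "(xdivmono ?a ?b :: 'n xa) = e *\<^sub>q xmono ?a ?b"
    using xdivmono_xmono by blast
  have "(xdivmono a b :: 'n xa) = (c * d / e) *\<^sub>q xdivmono ?a ?b"
    using c d e by (simp add: scaleq_scaleq)
  then show ?thesis by blast
qed

lemma pure_map_scaleq:
  "pure (us @ map (\<lambda>k. c k *\<^sub>q f k) l) = prod_list (map c l) *\<^sub>q pure (us @ map f l)"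
proof (induction l arbitrary: us)
  case (Cons k l)
  show ?case
    using Cons.IH[of "us @ [f k]"] by (simp add: pure_scaleq scaleq_scaleq)
qed (simp add: scaleq_one)

lemma xtensor_in_tensor_deg:
  "(xtensor A0 A1 :: 'n :: finite xa tensor) \<in> tensor_deg (mat_sum CARD('n) A0 A1)"
proof -
  let ?B0 = "\<lambda>s t. A0 s t + 2 * (A1 s t div 2)" and ?B1 = "\<lambda>s t. A1 s t mod 2"
  have "\<forall>t. \<exists>c. (xdivmono (\<lambda>s. A0 s t) (\<lambda>s. A1 s t) :: 'n xa)
      = c *\<^sub>q xdivmono (\<lambda>s. ?B0 s t) (\<lambda>s. ?B1 s t)"
    using xdivmono_reduce by blast
  then obtain c where c: "\<And>t. (xdivmono (\<lambda>s. A0 s t) (\<lambda>s. A1 s t) :: 'n xa)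
      = c t *\<^sub>q xdivmono (\<lambda>s. ?B0 s t) (\<lambda>s. ?B1 s t)"
    by metis
  have "(xtensor A0 A1 :: 'n xa tensor)
      = prod_list (map c [1..<CARD('n) + 1]) *\<^sub>q xtensor ?B0 ?B1"
    unfolding xtensor_def c using pure_map_scaleq[of "[]"] by (simp only: append_Nil)
  moreover have "mat_sum CARD('n) ?B0 ?B1 = mat_sum CARD('n) A0 A1"
    unfolding mat_sum_def by (intro sum.cong refl) simp
  then have "(xtensor ?B0 ?B1 :: 'n xa tensor) \<in> tensor_deg (mat_sum CARD('n) A0 A1)"
    unfolding tensor_deg_def by (intro qspace.span_base) fastforce
  ultimately show ?thesis
    unfolding tensor_deg_def by (simp add: qspace.span_scale)
qed

lemma xseries_in_tensor_hat: "(xseries A0 A1 j :: nat \<Rightarrow> 'n :: finite xa tensor) \<in> tensor_hat"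
proof -
  have "(xseries A0 A1 j r :: 'n xa tensor) \<in> tensor_deg r" for r
    using xtensor_in_tensor_deg[of "A0 + diag_mat _" A1, where 'n = 'n]
    unfolding xseries_def tensor_deg_def
    by (intro qspace.span_sum qspace.span_scale) auto
  then show ?thesis by (simp add: tensor_hat_def)
qed

text \<open>The exponents and the sign occurring in the multiplication formulas.\<close>

definition sigE_plus :: "nat \<Rightarrow> nat \<Rightarrow> nat \<Rightarrow> nmat \<Rightarrow> nmat \<Rightarrow> int" where
  "sigE_plus n h k A0 A1 = int (A1 (h + 1) k)
    + (\<Sum>t\<in>{k<..n}. int (A0 (h + 1) t + A1 (h + 1) t) - int (A0 h t + A1 h t))"

definition sigE_minus :: "nat \<Rightarrow> nat \<Rightarrow> nat \<Rightarrow> nmat \<Rightarrow> nmat \<Rightarrow> int" where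
  "sigE_minus n h k A0 A1 = - int (A0 (h + 1) k)
    + (\<Sum>t\<in>{k<..n}. int (A0 (h + 1) t + A1 (h + 1) t) - int (A0 h t + A1 h t))"

definition sigF_plus :: "nat \<Rightarrow> nat \<Rightarrow> nmat \<Rightarrow> nmat \<Rightarrow> int" where
  "sigF_plus h k A0 A1 = - int (A1 h k)
    + (\<Sum>t\<in>{1..<k}. int (A0 h t + A1 h t) - int (A0 (h + 1) t + A1 (h + 1) t))"

definition sigF_minus :: "nat \<Rightarrow> nat \<Rightarrow> nmat \<Rightarrow> nmat \<Rightarrow> int" where
  "sigF_minus h k A0 A1 = int (A0 h k)
    + (\<Sum>t\<in>{1..<k}. int (A0 h t + A1 h t) - int (A0 (h + 1) t + A1 (h + 1) t))"

definition sigK_plus :: "nat \<Rightarrow> nat \<Rightarrow> nmat \<Rightarrow> nmat \<Rightarrow> int" where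
  "sigK_plus n k A0 A1 = - int (A0 1 k)
    - (\<Sum>t\<in>{1..<k}. int (A0 1 t + A1 1 t)) + (\<Sum>t\<in>{k<..n}. int (A0 1 t + A1 1 t))"

definition sigK_minus :: "nat \<Rightarrow> nat \<Rightarrow> nmat \<Rightarrow> nmat \<Rightarrow> int" where
  "sigK_minus n k A0 A1 = int (A1 1 k)
    - (\<Sum>t\<in>{1..<k}. int (A0 1 t + A1 1 t)) + (\<Sum>t\<in>{k<..n}. int (A0 1 t + A1 1 t))"

definition odd_count :: "nat \<Rightarrow> nat \<Rightarrow> nmat \<Rightarrow> nat" where
  "odd_count n k A1 = (\<Sum>t\<in>{1..<k}. \<Sum>s = 1..n. A1 s t)"

abbreviation alpha_vec :: "nat \<Rightarrow> nat \<Rightarrow> int" where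
  "alpha_vec h \<equiv> unit_vec h - unit_vec (h + 1)"

abbreviation beta_vec :: "nat \<Rightarrow> nat \<Rightarrow> int" where
  "beta_vec h \<equiv> unit_vec h + unit_vec (h + 1)"

end

theory Submission
  imports Defs
begin

text \<open>Each of the generators \<open>E\<^sub>h\<close>, \<open>F\<^sub>h\<close>, \<open>K\<^sub>1\<close>-bar is skew primitive,
  \<open>\<Delta>(x) = x \<otimes> b + a \<otimes> x\<close> with \<open>a\<close> and \<open>b\<close> grouplike, so its iterated comultiplication is the
  sum of the tensors \<open>a \<otimes> \<dots> \<otimes> a \<otimes> x \<otimes> b \<otimes> \<dots> \<otimes> b\<close>.  As \<open>a\<close> and \<open>b\<close> are diagonal on monomials,
  \<open>x\<close> sends a tensor monomial to a sum over the columns \<open>k\<close> in which two entries of column \<open>k\<close>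
  are changed.  In the sum over \<open>\<lambda>\<close> the diagonal entries contribute a linear form in \<open>\<lambda>\<close> to the
  exponent, which shifts the vector \<open>j\<close>.  When the changed entry lies on the diagonal, \<open>\<lambda>\<^sub>p\<close> is
  replaced by \<open>\<lambda>\<^sub>p - 1\<close>, giving a power of \<open>\<upsilon>\<close>, or by \<open>\<lambda>\<^sub>p + 1\<close>, where the factor
  \<open>[\<lambda>\<^sub>p + 1]\<close> is expanded into the difference of two series.\<close>

section \<open>Linear maps on tensor powers\<close>

text \<open>Two obstacles shape the argument. Tensors are classes of formal combinations of lists,
  and a map out of them is evaluated on a chosen representative, so a map has to be shown
  multilinear before its value on a pure tensor is known. And truncated subtraction on
  \<open>nat\<close> gives a wrong monomial when the lowered exponent is 0; such a term carries a
  factor \<open>of_bool\<close> that makes it vanish, so the matrices matter only where this factor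
  is 1.

  The coefficients \<open>qint (a + 1)\<close> come from divided powers: a generator multiplies a
  plain monomial by the quantum integer of the exponent that it lowers, and after division by
  quantum factorials the one belonging to the raised exponent is left. An odd exponent may become 2
  in the result; such divided monomials are kept as they are and not rewritten by the square
  relation.

  In the series, the zero diagonal of \<open>A0\<close> is what makes the diagonal entries of
  \<open>A0 + diag_mat l\<close> equal to those of \<open>l\<close>.\<close>

definition multilinear :: "('a :: qspace list \<Rightarrow> 'b :: qspace) \<Rightarrow> bool" where
  "multilinear f \<longleftrightarrow>
    (\<forall>us a b vs. f (us @ (a + b) # vs) = f (us @ a # vs) + f (us @ b # vs)) \<and>
    (\<forall>us c a vs. f (us @ (c *\<^sub>q a) # vs) = c *\<^sub>q f (us @ a # vs))"

lemma multilinearI: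
  assumes "\<And>us a b vs. f (us @ (a + b) # vs) = f (us @ a # vs) + f (us @ b # vs)"
    and "\<And>us c a vs. f (us @ (c *\<^sub>q a) # vs) = c *\<^sub>q f (us @ a # vs)"
  shows "multilinear f"
  using assms by (simp add: multilinear_def)

text \<open>The linear extension of \<open>f\<close> to the free space; \<open>tensor_lift\<close>
  is this map at a representative.\<close>

definition free_ext :: "('b \<Rightarrow> 'c :: qspace) \<Rightarrow> ('b \<Rightarrow>\<^sub>0 qv) \<Rightarrow> 'c" where
  "free_ext f p = (\<Sum>v\<in>Poly_Mapping.keys p. Poly_Mapping.lookup p v *\<^sub>q f v)"

text \<open>Coefficients may cancel in a sum, so the keys of the summands and of the sum differ; a
  common index set makes the sums comparable.\<close>

lemma free_ext_superset:
  assumes "finite S" and "Poly_Mapping.keys p \<subseteq> S"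
  shows "free_ext f p = (\<Sum>v\<in>S. Poly_Mapping.lookup p v *\<^sub>q f v)"
  unfolding free_ext_def using assms
  by (intro sum.mono_neutral_left) (auto simp: in_keys_iff)

lemma free_ext_add: "free_ext f (p + q) = free_ext f p + free_ext f q"
proof -
  let ?S = "Poly_Mapping.keys p \<union> Poly_Mapping.keys q"
  have "free_ext f (p + q) = (\<Sum>v\<in>?S. Poly_Mapping.lookup (p + q) v *\<^sub>q f v)"
    by (rule free_ext_superset) (use Poly_Mapping.keys_add[of p q] in auto)
  moreover have "free_ext f p = (\<Sum>v\<in>?S. Poly_Mapping.lookup p v *\<^sub>q f v)"
    "free_ext f q = (\<Sum>v\<in>?S. Poly_Mapping.lookup q v *\<^sub>q f v)"
    by (rule free_ext_superset; simp)+
  ultimately show ?thesis by (simp add: lookup_add scaleq_add_left sum.distrib)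
qed

lemma free_ext_fscale: "free_ext f (fscale c p) = c *\<^sub>q free_ext f p"
proof -
  have "free_ext f (fscale c p) = (\<Sum>v\<in>Poly_Mapping.keys p. Poly_Mapping.lookup (fscale c p) v *\<^sub>q f v)"
    by (rule free_ext_superset) (auto simp: in_keys_iff lookup_fscale)
  then show ?thesis
    by (simp add: lookup_fscale free_ext_def qspace.scale_sum_right scaleq_scaleq)
qed

lemma free_ext_uminus: "free_ext f (- p) = - free_ext f p"
  using free_ext_fscale[of f "- 1" p] by (simp add: fscale_minus_one)

lemma free_ext_diff: "free_ext f (p - q) = free_ext f p - free_ext f q"
  using free_ext_add[of f p "- q"] by (simp add: free_ext_uminus)

lemma free_ext_single: "free_ext f (Poly_Mapping.single v c) = c *\<^sub>q f v"
  by (simp add: free_ext_def)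

lemma free_ext_zero: "free_ext f 0 = 0"
  by (simp add: free_ext_def)

lemma free_ext_multilin_rel:
  assumes "multilinear f" and "p \<in> multilin_rel"
  shows "free_ext f p = 0"
  using assms(2)
proof induction
  case zero
  show ?case by (rule free_ext_zero)
next
  case (add x us a b vs c)
  then show ?case using assms(1)
    by (simp add: multilinear_def free_ext_add free_ext_diff free_ext_single scaleq_add_right)
next
  case (scale x us d a vs c)
  then show ?case using assms(1)
    by (simp add: multilinear_def free_ext_add free_ext_diff free_ext_single scaleq_scaleq)
qed

lemma tensor_lift_free_ext: "tensor_lift f t = free_ext f (rep_tensor t)"
  by (simp add: tensor_lift_def free_ext_def Let_def)

text \<open>The chosen representative differs from \<open>p\<close> by a multilinearity relation,
  and \<open>f\<close> kills those; so the choice does not affect the value.\<close>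

lemma tensor_lift_abs:
  assumes "multilinear f"
  shows "tensor_lift f (abs_tensor p) = free_ext f p"
proof -
  have "tensor_eq (rep_tensor (abs_tensor p)) p"
    by (rule Quotient3_rep_abs[OF Quotient3_tensor])
      (simp add: tensor_eq_def multilin_rel.zero)
  then have "free_ext f (rep_tensor (abs_tensor p) - p) = 0"
    using free_ext_multilin_rel[OF assms] by (simp add: tensor_eq_def)
  then show ?thesis by (simp add: tensor_lift_free_ext free_ext_diff)
qed

lemma tensor_lift_pure: "multilinear f \<Longrightarrow> tensor_lift f (pure vs) = f vs"
  by (simp add: pure.abs_eq tensor_lift_abs free_ext_single scaleq_one)

lemma tensor_lift_add:
  assumes "multilinear f"
  shows "tensor_lift f (s + t) = tensor_lift f s + tensor_lift f t"
  by (induction s rule: tensor.abs_induct, induction t rule: tensor.abs_induct)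
    (simp add: plus_tensor.abs_eq tensor_lift_abs[OF assms] free_ext_add)

lemma tensor_lift_scaleq:
  assumes "multilinear f"
  shows "tensor_lift f (c *\<^sub>q t) = c *\<^sub>q tensor_lift f t"
  by (induction t rule: tensor.abs_induct)
    (simp add: scaleq_tensor.abs_eq tensor_lift_abs[OF assms] free_ext_fscale)

lemma tensor_lift_zero:
  assumes "multilinear f"
  shows "tensor_lift f 0 = 0"
  using tensor_lift_scaleq[OF assms, of 0 0] by simp

lemma tensor_lift_sum:
  assumes "multilinear f"
  shows "tensor_lift f (\<Sum>i\<in>I. t i) = (\<Sum>i\<in>I. tensor_lift f (t i))"
  by (induction I rule: infinite_finite_induct)
    (simp_all add: tensor_lift_zero[OF assms] tensor_lift_add[OF assms])

text \<open>Both sides use the same representative of \<open>t\<close>, so linearity in the function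
  is immediate.\<close>

lemma tensor_lift_fun_add:
  "tensor_lift (\<lambda>vs. f vs + g vs) t = tensor_lift f t + tensor_lift g t"
  by (simp add: tensor_lift_def Let_def scaleq_add_right sum.distrib)

lemma tensor_lift_fun_scaleq: "tensor_lift (\<lambda>vs. c *\<^sub>q f vs) t = c *\<^sub>q tensor_lift f t"
  by (simp add: tensor_lift_def Let_def qspace.scale_sum_right scaleq_scaleq mult.commute)

lemma multilinear_tensor_lift:
  fixes f :: "'a :: qspace list \<Rightarrow> 'b :: qspace list \<Rightarrow> 'c :: qspace"
  assumes "\<And>vs. multilinear (\<lambda>us. f us vs)"
  shows "multilinear (\<lambda>us. tensor_lift (f us) t)"
proof (rule multilinearI)
  fix us ws :: "'a list" and a b and c
  have "f (us @ (a + b) # ws) = (\<lambda>vs. f (us @ a # ws) vs + f (us @ b # ws) vs)"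
    and "f (us @ (c *\<^sub>q a) # ws) = (\<lambda>vs. c *\<^sub>q f (us @ a # ws) vs)"
    using assms by (simp_all add: multilinear_def fun_eq_iff)
  then show "tensor_lift (f (us @ (a + b) # ws)) t
      = tensor_lift (f (us @ a # ws)) t + tensor_lift (f (us @ b # ws)) t"
    and "tensor_lift (f (us @ (c *\<^sub>q a) # ws)) t = c *\<^sub>q tensor_lift (f (us @ a # ws)) t"
    by (simp_all add: tensor_lift_fun_add tensor_lift_fun_scaleq)
qed

lemma multilinear_sum: "(\<And>i. i \<in> I \<Longrightarrow> multilinear (f i)) \<Longrightarrow> multilinear (\<lambda>vs. \<Sum>i\<in>I. f i vs)"
  by (intro multilinearI) (simp_all add: multilinear_def sum.distrib qspace.scale_sum_right)

lemma multilinear_scaleq: "multilinear f \<Longrightarrow> multilinear (\<lambda>vs. c *\<^sub>q f vs)"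
  by (intro multilinearI)
    (simp_all add: multilinear_def scaleq_add_right scaleq_scaleq mult.commute)

text \<open>Multilinearity compares lists of equal length only, so a parameter that depends on the
  length may be frozen.\<close>

lemma multilinear_length_cong:
  assumes "\<And>m. multilinear (f m)"
  shows "multilinear (\<lambda>vs. f (length vs) vs)"
  using assms by (intro multilinearI) (simp_all add: multilinear_def)

lemma pure_add: "pure (us @ (a + b) # vs) = pure (us @ a # vs) + pure (us @ b # vs)"
proof (transfer fixing: us a b vs)
  show "tensor_eq (Poly_Mapping.single (us @ (a + b) # vs) 1)
      (Poly_Mapping.single (us @ a # vs) 1 + Poly_Mapping.single (us @ b # vs) 1)"
    using multilin_rel.add[OF multilin_rel.zero, of us a b vs 1]
    by (simp add: tensor_eq_def algebra_simps)
qed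

lemma multilinear_pure_append: "multilinear (\<lambda>ds. pure (us @ ds @ vs))"
  using pure_add[of "us @ _" _ _ "_ @ vs"] pure_scaleq[of "us @ _" _ _ "_ @ vs"]
  by (intro multilinearI) simp_all

lemma pure_zero: "pure (us @ 0 # vs) = 0"
  using pure_scaleq[of us 0 0 vs] by simp

lemma pure_zero_in_set:
  assumes "0 \<in> set vs"
  shows "pure vs = 0"
  using assms by (metis pure_zero split_list)

text \<open>Isolates the entry at position \<open>length us\<close>, so that additivity of
  \<open>pure\<close> in that entry applies although \<open>F\<close> depends on the
  position.\<close>

lemma map_nth_append_Cons:
  "map (\<lambda>k. F k ((us @ x # ws) ! k)) [0..<length us + Suc (length ws)]
    = map (\<lambda>k. F k (us ! k)) [0..<length us] @ F (length us) x
      # map (\<lambda>k. F (k + Suc (length us)) (ws ! k)) [0..<length ws]"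
  by (rule nth_equalityI)
    (auto simp: nth_append nth_Cons not_less Suc_diff_le add.commute split: nat.splits
      dest!: less_imp_Suc_add le_Suc_ex)

lemma multilinear_pure_map:
  assumes add: "\<And>k x y. F k (x + y) = F k x + F k y"
    and scale: "\<And>k c x. F k (c *\<^sub>q x) = c *\<^sub>q F k x"
  shows "multilinear (\<lambda>vs. pure (map (\<lambda>k. F k (vs ! k)) [0..<length vs]))"
  by (intro multilinearI)
    (simp_all only: length_append length_Cons map_nth_append_Cons add scale pure_add pure_scaleq)


section \<open>The sign rule\<close>

lemma par_minus: "par (- x) = - par (x :: 'a :: superspace)"
  using par_scaleq[of "- 1" x] by simp

lemma par_diff: "par (x - y) = par x - par (y :: 'a :: superspace)"
  using par_add[of x "- y"] by (simp add: par_minus)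

lemma hpart_add: "hpart p (x + y) = hpart p x + hpart p y"
  by (cases p) (simp_all add: hpart_def par_add scaleq_add_right qspace.scale_right_diff_distrib)

lemma hpart_scaleq: "hpart p (c *\<^sub>q x) = c *\<^sub>q hpart p x"
  by (cases p) (simp_all add: hpart_def par_scaleq scaleq_add_right scaleq_scaleq
      qspace.scale_right_diff_distrib)

lemma hpart_homogeneous:
  assumes "par x = (if q then - x else x)"
  shows "hpart p x = (if p = q then x else (0 :: 'a :: superspace))"
proof -
  have "(1 / 2) *\<^sub>q (x + x) = x"
    by (simp add: scaleq_add_right scaleq_add_left[symmetric] scaleq_one)
  then show ?thesis using assms by (auto simp: hpart_def)
qed

text \<open>There are two instances: the multiplication of a superalgebra, which underlies
  \<open>tensor_mult\<close>, and the action on the quantum superspace.\<close>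

locale bilinear_superaction =
  fixes act :: "'u :: superspace \<Rightarrow> 'v :: superspace \<Rightarrow> 'v"
  assumes act_add_left: "act (x + y) v = act x v + act y v"
    and act_scaleq_left: "act (c *\<^sub>q x) v = c *\<^sub>q act x v"
    and act_add_right: "act x (v + w) = act x v + act x w"
    and act_scaleq_right: "act x (c *\<^sub>q v) = c *\<^sub>q act x v"
begin

lemma act_zero_left: "act 0 v = 0"
  using act_scaleq_left[of 0 0 v] by simp

lemma act_zero_right: "act x 0 = 0"
  using act_scaleq_right[of x 0 0] by simp

lemma multilinear_koszul_right: "multilinear (koszul act gs)"
proof -
  \<comment> \<open>The number of positions bounds the index sets of the sign rule; with it frozen
    as \<open>m\<close>, every summand is a multilinear function of \<open>vs\<close>.\<close>
  define f where "f m vs = (if length gs = m then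
      \<Sum>P\<in>Pow {..<m}. \<Sum>Q\<in>Pow {..<m}.
        (- 1) ^ card {(s, t). s < t \<and> s \<in> Q \<and> t \<in> P} *\<^sub>q
          pure (map (\<lambda>k. act (hpart (k \<in> P) (gs ! k)) (hpart (k \<in> Q) (vs ! k))) [0..<length vs])
      else 0)" for m vs
  have "multilinear (f m)" for m
  proof (cases "length gs = m")
    case True
    then show ?thesis unfolding f_def
      by simp (intro multilinear_sum multilinear_scaleq multilinear_pure_map;
        simp add: hpart_add hpart_scaleq act_add_right act_scaleq_right)
  qed (simp add: f_def multilinear_def)
  moreover have "koszul act gs = (\<lambda>vs. f (length vs) vs)"
    by (simp add: fun_eq_iff koszul_def f_def Let_def)
  ultimately show ?thesis using multilinear_length_cong by metis
qed

lemma multilinear_koszul_left: "multilinear (\<lambda>gs. koszul act gs vs)"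
proof -
  define f where "f m gs = (if m = length vs then
      \<Sum>P\<in>Pow {..<m}. \<Sum>Q\<in>Pow {..<m}.
        (- 1) ^ card {(s, t). s < t \<and> s \<in> Q \<and> t \<in> P} *\<^sub>q
          pure (map (\<lambda>k. act (hpart (k \<in> P) (gs ! k)) (hpart (k \<in> Q) (vs ! k))) [0..<length gs])
      else 0)" for m gs
  have "multilinear (f m)" for m
  proof (cases "m = length vs")
    case True
    then show ?thesis unfolding f_def
      by simp (intro multilinear_sum multilinear_scaleq multilinear_pure_map;
        simp add: hpart_add hpart_scaleq act_add_left act_scaleq_left)
  qed (simp add: f_def multilinear_def)
  moreover have "(\<lambda>gs. koszul act gs vs) = (\<lambda>gs. f (length gs) gs)"
    by (simp add: fun_eq_iff koszul_def f_def Let_def)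
  ultimately show ?thesis using multilinear_length_cong by metis
qed

lemma tensor_act_pure_pure: "tensor_act act (pure gs) (pure vs) = koszul act gs vs"
proof -
  have "multilinear (\<lambda>gs. tensor_lift (\<lambda>vs. koszul act gs vs) (pure vs))"
    by (intro multilinear_tensor_lift multilinear_koszul_left)
  then show ?thesis
    by (simp add: tensor_act_def tensor_lift_pure multilinear_koszul_right)
qed

lemma multilinear_tensor_lift_koszul:
  "multilinear (\<lambda>gs. tensor_lift (\<lambda>vs. koszul act gs vs) t)"
  by (intro multilinear_tensor_lift multilinear_koszul_left)

lemma tensor_act_sum_left: "tensor_act act (\<Sum>i\<in>I. u i) t = (\<Sum>i\<in>I. tensor_act act (u i) t)"
  by (simp only: tensor_act_def tensor_lift_sum[OF multilinear_tensor_lift_koszul])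

lemma tensor_act_add_left: "tensor_act act (u + v) t = tensor_act act u t + tensor_act act v t"
  by (simp only: tensor_act_def tensor_lift_add[OF multilinear_tensor_lift_koszul])

lemma tensor_act_scaleq_left: "tensor_act act (c *\<^sub>q u) t = c *\<^sub>q tensor_act act u t"
  by (simp only: tensor_act_def tensor_lift_scaleq[OF multilinear_tensor_lift_koszul])

lemma tensor_act_zero_left: "tensor_act act 0 t = 0"
  by (simp only: tensor_act_def tensor_lift_zero[OF multilinear_tensor_lift_koszul])

lemma tensor_act_add_right: "tensor_act act u (s + t) = tensor_act act u s + tensor_act act u t"
  by (simp add: tensor_act_def tensor_lift_add[OF multilinear_koszul_right] tensor_lift_fun_add)

lemma tensor_act_scaleq_right: "tensor_act act u (c *\<^sub>q t) = c *\<^sub>q tensor_act act u t"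
  by (simp add: tensor_act_def tensor_lift_scaleq[OF multilinear_koszul_right]
      tensor_lift_fun_scaleq)

lemma tensor_act_sum_right: "tensor_act act u (\<Sum>i\<in>I. t i) = (\<Sum>i\<in>I. tensor_act act u (t i))"
proof (induction I rule: infinite_finite_induct)
  case (insert i I)
  then show ?case by (simp add: tensor_act_add_right)
qed (use tensor_act_scaleq_right[of u 0 0] in simp_all)

text \<open>Only one pair \<open>P\<close>, \<open>Q\<close> survives: any other pair selects, at
  some position, the vanishing component of a homogeneous element, and a pure tensor with a zero
  entry is 0.\<close>

lemma koszul_homogeneous:
  assumes "length gs = length vs"
    and gs: "\<And>k. k < length vs \<Longrightarrow> par (gs ! k) = (if p k then - (gs ! k) else gs ! k)"
    and vs: "\<And>k. k < length vs \<Longrightarrow> par (vs ! k) = (if q k then - (vs ! k) else vs ! k)"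
  shows "koszul act gs vs = (- 1) ^ card {(s, t). s < t \<and> t < length vs \<and> q s \<and> p t} *\<^sub>q
    pure (map (\<lambda>k. act (gs ! k) (vs ! k)) [0..<length vs])"
proof -
  define m where "m = length vs"
  define P0 where "P0 = {k \<in> {..<m}. p k}"
  define Q0 where "Q0 = {k \<in> {..<m}. q k}"
  define f where "f P Q = (- 1) ^ card {(s, t). s < t \<and> s \<in> Q \<and> t \<in> P} *\<^sub>q
      pure (map (\<lambda>k. act (hpart (k \<in> P) (gs ! k)) (hpart (k \<in> Q) (vs ! k))) [0..<m])" for P Q
  have "f P Q = 0" if PQ: "P \<subseteq> {..<m}" "Q \<subseteq> {..<m}" "P \<noteq> P0 \<or> Q \<noteq> Q0" for P Q
  proof -
    have "P = P0 \<and> Q = Q0" if "\<forall>k<m. (k \<in> P) = p k \<and> (k \<in> Q) = q k"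
      using that \<open>P \<subseteq> {..<m}\<close> \<open>Q \<subseteq> {..<m}\<close> by (auto simp: P0_def Q0_def)
    then obtain k where k: "k < m" "(k \<in> P) \<noteq> p k \<or> (k \<in> Q) \<noteq> q k"
      using PQ(3) by blast
    then have "act (hpart (k \<in> P) (gs ! k)) (hpart (k \<in> Q) (vs ! k)) = 0"
      using hpart_homogeneous[OF gs, of k] hpart_homogeneous[OF vs, of k]
      by (auto simp: m_def act_zero_left act_zero_right)
    with k(1) have "pure (map (\<lambda>k. act (hpart (k \<in> P) (gs ! k)) (hpart (k \<in> Q) (vs ! k))) [0..<m]) = 0"
      by (intro pure_zero_in_set) (force simp: image_iff)
    then show ?thesis by (simp add: f_def)
  qed
  then have "f P Q = (if P = P0 then if Q = Q0 then f P0 Q0 else 0 else 0)"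
    if "P \<in> Pow {..<m}" "Q \<in> Pow {..<m}" for P Q
    using that by auto
  then have "(\<Sum>P\<in>Pow {..<m}. \<Sum>Q\<in>Pow {..<m}. f P Q)
      = (\<Sum>P\<in>Pow {..<m}. \<Sum>Q\<in>Pow {..<m}. if P = P0 then if Q = Q0 then f P0 Q0 else 0 else 0)"
    by (intro sum.cong refl) blast
  also have "\<dots> = (\<Sum>P\<in>Pow {..<m}. if P = P0 then f P0 Q0 else 0)"
    by (intro sum.cong refl) (auto simp: Q0_def)
  also have "\<dots> = f P0 Q0"
    by (auto simp: P0_def)
  finally have "koszul act gs vs = f P0 Q0"
    using assms(1) by (simp add: koszul_def f_def m_def Let_def)
  also have "f P0 Q0 = (- 1) ^ card {(s, t). s < t \<and> s \<in> Q0 \<and> t \<in> P0} *\<^sub>q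
      pure (map (\<lambda>k. act (gs ! k) (vs ! k)) [0..<m])"
    unfolding f_def
    by (intro arg_cong2[where f = scaleq] arg_cong[where f = pure] map_cong refl)
      (auto simp: m_def P0_def Q0_def hpart_homogeneous[OF gs] hpart_homogeneous[OF vs])
  also have "{(s, t). s < t \<and> s \<in> Q0 \<and> t \<in> P0} = {(s, t). s < t \<and> t < m \<and> q s \<and> p t}"
    by (auto simp: P0_def Q0_def)
  finally show ?thesis by (simp only: m_def)
qed

end

section \<open>Iterated comultiplication\<close>

locale linear_comult =
  fixes D :: "'u :: qspace \<Rightarrow> 'u tensor"
  assumes linear: "Vector_Spaces.linear scaleq scaleq D"
begin

lemma comult_add: "D (x + y) = D x + D y" and comult_scaleq: "D (c *\<^sub>q x) = c *\<^sub>q D x"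
  using linear by (simp_all add: Vector_Spaces.linear_iff)

text \<open>The entry at position 0 enters through the linear map \<open>D\<close>, every later
  entry sits unchanged in the tail of the pure tensors; hence the case distinction on
  \<open>us\<close>.\<close>

lemma multilinear_apply_at:
  "multilinear (\<lambda>us. if 0 < length us
    then tensor_lift (\<lambda>ds. pure (take 0 us @ ds @ drop (Suc 0) us)) (D (us ! 0)) else 0)"
    (is "multilinear ?f")
proof (rule multilinearI)
  have app: "multilinear (\<lambda>ds. pure (ds @ vs))" for vs :: "'u list"
    using multilinear_pure_append[of "[]" vs] by simp
  fix us vs :: "'u list" and a b c
  show "?f (us @ (a + b) # vs) = ?f (us @ a # vs) + ?f (us @ b # vs)"
  proof (cases us)
    case Nil
    then show ?thesis by (simp add: comult_add tensor_lift_add[OF app])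
  next
    case (Cons u us')
    then show ?thesis
      using pure_add[of "_ @ us'" a b vs] by (simp flip: tensor_lift_fun_add)
  qed
  show "?f (us @ (c *\<^sub>q a) # vs) = c *\<^sub>q ?f (us @ a # vs)"
  proof (cases us)
    case Nil
    then show ?thesis by (simp add: comult_scaleq tensor_lift_scaleq[OF app])
  next
    case (Cons u us')
    then show ?thesis
      using pure_scaleq[of "_ @ us'" c a vs] by (simp flip: tensor_lift_fun_scaleq)
  qed
qed

lemma apply_at_sum: "apply_at D 0 (\<Sum>i\<in>I. t i) = (\<Sum>i\<in>I. apply_at D 0 (t i))"
  unfolding apply_at_def by (rule tensor_lift_sum[OF multilinear_apply_at])

lemma apply_at_pure: "apply_at D 0 (pure (u # us)) = tensor_lift (\<lambda>ds. pure (ds @ us)) (D u)"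
  unfolding apply_at_def by (subst tensor_lift_pure[OF multilinear_apply_at]) simp

lemma iterated_comult_grouplike:
  assumes "D a = pure [a, a]"
  shows "iterated_comult D m a = pure (replicate (Suc m) a)"
proof (induction m)
  case (Suc m)
  then show ?case using multilinear_pure_append[of "[]" "replicate m a"]
    by (simp add: apply_at_pure assms tensor_lift_pure)
qed simp

text \<open>Only the first tensor factor is expanded. It is \<open>x\<close> in the first summand,
  which splits into two, and the grouplike \<open>a\<close> in all others, which just gain one more
  \<open>a\<close>.\<close>

lemma iterated_comult_skew_primitive:
  assumes a: "D a = pure [a, a]" and x: "D x = pure [x, b] + pure [a, x]"
  shows "iterated_comult D m x
    = (\<Sum>k = 1..Suc m. pure (replicate (k - 1) a @ x # replicate (Suc m - k) b))"
proof (induction m)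
  case (Suc m)
  have app: "multilinear (\<lambda>ds. pure (ds @ vs))" for vs :: "'u list"
    using multilinear_pure_append[of "[]" vs] by simp
  have 1: "apply_at D 0 (pure (x # replicate m b))
      = pure (x # replicate (Suc m) b) + pure (a # x # replicate m b)"
    using app by (simp add: apply_at_pure x tensor_lift_add tensor_lift_pure)
  have 2: "apply_at D 0 (pure (replicate k a @ x # replicate (m - k) b))
      = pure (replicate (Suc k) a @ x # replicate (m - k) b)" if k0: "k > 0" for k
  proof -
    obtain k' where k: "k = Suc k'" using k0 by (cases k) auto
    show ?thesis using app by (simp add: k apply_at_pure a tensor_lift_pure)
  qed
  \<comment> \<open>Counting the summands from 0 removes the truncated \<open>k - 1\<close>.\<close>
  have "iterated_comult D (Suc m) x
      = (\<Sum>k<Suc m. apply_at D 0 (pure (replicate k a @ x # replicate (m - k) b)))"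
    by (simp only: iterated_comult.simps Suc apply_at_sum One_nat_def
        sum.atLeast1_atMost_eq diff_Suc_Suc diff_zero)
  also have "\<dots> = apply_at D 0 (pure (x # replicate m b))
      + (\<Sum>k<m. apply_at D 0 (pure (replicate (Suc k) a @ x # replicate (m - Suc k) b)))"
    by (simp add: sum.lessThan_Suc_shift del: sum.lessThan_Suc)
  also have "\<dots> = pure (x # replicate (Suc m) b) + (pure (a # x # replicate m b)
      + (\<Sum>k<m. pure (replicate (Suc (Suc k)) a @ x # replicate (m - Suc k) b)))"
    by (simp only: 1 2[OF zero_less_Suc] add.assoc)
  also have "\<dots> = (\<Sum>k<Suc (Suc m). pure (replicate k a @ x # replicate (Suc m - k) b))"
    by (simp add: sum.lessThan_Suc_shift del: sum.lessThan_Suc)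
  finally show ?case
    by (simp only: One_nat_def sum.atLeast1_atMost_eq diff_Suc_Suc diff_zero)
qed simp

end

section \<open>The comultiplication of the inverse of a grouplike element\<close>

interpretation mult_action: bilinear_superaction "(*) :: 'a :: superalgebra \<Rightarrow> 'a \<Rightarrow> 'a"
  by unfold_locales (simp_all add: distrib_left distrib_right scaleq_mult_left scaleq_mult_right)

lemma hpart_add_hpart: "hpart False x + hpart True x = x"
proof -
  have "(1 / 2) *\<^sub>q (x + x) = x"
    by (simp add: scaleq_add_right scaleq_add_left[symmetric] scaleq_one)
  then show ?thesis by (simp add: hpart_def flip: scaleq_add_right)
qed

lemma par_hpart: "par (hpart p x) = (if p then - hpart p x else hpart p x)"
  by (simp add: hpart_def par_scaleq par_add par_diff par_par add.commute flip: qspace.scale_minus_right)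

context bilinear_superaction
begin

text \<open>With even arguments on the right no sign arises for any parity of \<open>a\<close> and
  \<open>b\<close>; these are split into homogeneous components and reassembled.\<close>

lemma koszul_pair_even:
  assumes "par c = c" and "par d = d"
  shows "koszul act [a, b] [c, d] = pure [act a c, act b d]"
proof -
  have hom: "koszul act [hpart p a, hpart q b] [c, d] = pure [act (hpart p a) c, act (hpart q b) d]"
    for p q
    by (subst koszul_homogeneous[where p = "\<lambda>k. if k = 0 then p else q" and q = "\<lambda>_. False"])
      (auto simp: par_hpart assms nth_Cons' upt_rec scaleq_one)
  have add1: "koszul act [x + y, z] [c, d] = koszul act [x, z] [c, d] + koszul act [y, z] [c, d]"
    and add2: "koszul act [z, x + y] [c, d] = koszul act [z, x] [c, d] + koszul act [z, y] [c, d]"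
    for x y z
    using multilinear_koszul_left[of "[c, d]", unfolded multilinear_def]
    by (metis append_Nil, metis append_Cons append_Nil)
  have padd1: "pure [x + y, z] = pure [x, z] + pure [y, z]"
    and padd2: "pure [z, x + y] = pure [z, x] + pure [z, y]" for x y z :: 'v
    using pure_add[of "[]" x y "[z]"] pure_add[of "[z]" x y "[]"] by simp_all
  have "koszul act [hpart False a + hpart True a, hpart False b + hpart True b] [c, d]
      = pure [act (hpart False a + hpart True a) c, act (hpart False b + hpart True b) d]"
    by (simp only: add1 add2 hom act_add_left padd1 padd2)
  then show ?thesis by (simp only: hpart_add_hpart)
qed

end

lemma tensor_mult_pure_even:
  "par c = c \<Longrightarrow> par d = d \<Longrightarrow> tensor_mult (pure [a, b]) (pure [c, d]) = pure [a * c, b * d]"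
  by (simp add: tensor_mult_def mult_action.tensor_act_pure_pure mult_action.koszul_pair_even)

text \<open>The comultiplication is prescribed on each \<open>uK i\<close> but not on its inverse.
  The value is forced by \<open>D l\<close> times \<open>D k\<close> being \<open>D 1\<close>:
  multiply on the right by the tensor of \<open>l\<close> and \<open>l\<close>.\<close>

lemma comult_inverse_grouplike:
  fixes D :: "'u :: superalgebra \<Rightarrow> 'u tensor"
  assumes "D 1 = pure [1, 1]" and mult: "\<And>x y. D (x * y) = tensor_mult (D x) (D y)"
    and "D l \<in> tensor_power 2" and k: "D k = pure [k, k]"
    and inv: "l * k = 1" "k * l = 1" and par: "par k = k" "par l = l"
  shows "D l = pure [l, l]"
proof -
  \<comment> \<open>Cancellation is verified on pure tensors, which span the second tensor power;
    there it reduces to \<open>k * l = 1\<close> in each factor, so associativity of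
    \<open>tensor_mult\<close> is not invoked.\<close>
  have *: "tensor_mult (tensor_mult t (pure [k, k])) (pure [l, l]) = t" if "t \<in> tensor_power 2" for t
    using that unfolding tensor_power_def
  proof (induction rule: qspace.span_induct_alt)
    case base
    show ?case by (simp add: tensor_mult_def mult_action.tensor_act_zero_left)
  next
    case (step c x y)
    then obtain vs where vs: "x = pure vs" "length vs = 2" by blast
    then obtain a b where "vs = [a, b]" by (metis length_0_conv length_Suc_conv numeral_2_eq_2)
    then have "tensor_mult (tensor_mult x (pure [k, k])) (pure [l, l]) = x"
      using par inv by (simp add: vs tensor_mult_pure_even mult.assoc)
    with step show ?case
      by (simp add: tensor_mult_def mult_action.tensor_act_add_left
          mult_action.tensor_act_scaleq_left)
  qed
  have "tensor_mult (D l) (pure [k, k]) = pure [1, 1]"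
    using mult[of l k] assms(1) k inv by simp
  then have "tensor_mult (pure [1, 1]) (pure [l, l]) = D l"
    using *[OF assms(3)] by simp
  then show ?thesis using par by (simp add: tensor_mult_pure_even)
qed

section \<open>One summand of the iterated comultiplication acting on a pure tensor\<close>

lemma prod_list_map_upt: "prod_list (map c [1..<n + 1]) = (\<Prod>i = 1..n. c i :: 'a :: comm_monoid_mult)"
proof -
  have "set [1..<n + 1] = {1..n}" by auto
  then show ?thesis using prod.distinct_set_conv_list[of "[1..<n + 1]" c] by simp
qed

lemma power_minus_one_card:
  assumes "finite S"
  shows "(- 1) ^ card {s \<in> S. q s} = (\<Prod>s\<in>S. if q s then - 1 else 1 :: qv)"
  using assms by (simp add: prod.If_cases Int_def)

context bilinear_superaction
begin

text \<open>The only operator that can be odd stands at position \<open>k\<close>, so the sign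
  counts the odd columns to its left; this is a product over the same columns as the eigenvalues of
  \<open>a\<close> and can be merged with it.\<close>

lemma koszul_skew:
  assumes par_ab: "par a = a" "par b = b" and par_x: "par x = (if p then - x else x)"
    and f: "\<And>t. t \<in> {1..n} \<Longrightarrow> par (f t) = (if q t then - f t else f t)"
    and a: "\<And>t. t \<in> {1..n} \<Longrightarrow> act a (f t) = \<alpha> t *\<^sub>q f t"
    and b: "\<And>t. t \<in> {1..n} \<Longrightarrow> act b (f t) = \<beta> t *\<^sub>q f t"
    and k: "k \<in> {1..n}"
  shows "koszul act (replicate (k - 1) a @ x # replicate (n - k) b) (map f [1..<n + 1])
    = ((\<Prod>t\<in>{1..<k}. (if p \<and> q t then - 1 else 1) * \<alpha> t) * (\<Prod>t\<in>{k<..n}. \<beta> t))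
      *\<^sub>q pure (map (f(k := act x (f k))) [1..<n + 1])"
proof -
  define gs where "gs = replicate (k - 1) a @ x # replicate (n - k) b"
  define g where "g = f(k := act x (f k))"
  define c where "c i = (if i < k then \<alpha> i else if i = k then 1 else \<beta> i)" for i
  have len: "length gs = n" using k by (auto simp: gs_def)
  have nth: "gs ! i = (if Suc i < k then a else if Suc i = k then x else b)" if "i < n" for i
    using that k by (auto simp: gs_def nth_append nth_Cons' not_less)
  have nthf: "map f [1..<n + 1] ! i = f (Suc i)" if "i < n" for i
    using that by (simp del: upt_Suc)
  have "koszul act gs (map f [1..<n + 1])
    = (- 1) ^ card {(s, t). s < t \<and> t < n \<and> q (Suc s) \<and> (p \<and> t = k - 1)} *\<^sub>q
      pure (map (\<lambda>i. act (gs ! i) (map f [1..<n + 1] ! i)) [0..<n])"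
    by (subst koszul_homogeneous[where p = "\<lambda>i. p \<and> i = k - 1" and q = "\<lambda>i. q (Suc i)"])
      (use f k len nth nthf par_ab par_x in \<open>auto simp del: upt_Suc\<close>)
  also have "map (\<lambda>i. act (gs ! i) (map f [1..<n + 1] ! i)) [0..<n]
      = map (\<lambda>i. c i *\<^sub>q g i) [1..<n + 1]"
    by (rule nth_equalityI)
      (use k in \<open>auto simp: nth nthf a b g_def c_def scaleq_one simp del: upt_Suc\<close>)
  also have "pure (map (\<lambda>i. c i *\<^sub>q g i) [1..<n + 1]) = (\<Prod>i = 1..n. c i) *\<^sub>q pure (map g [1..<n + 1])"
    using pure_map_scaleq[of "[]" c g "[1..<n + 1]"] by (simp only: prod_list_map_upt append_Nil)
  also have "(\<Prod>i = 1..n. c i) = (\<Prod>t\<in>{1..<k}. \<alpha> t) * (\<Prod>t\<in>{k<..n}. \<beta> t)"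
  proof -
    have "(\<Prod>i\<in>{1..n}. c i) = (\<Prod>i\<in>insert k ({1..<k} \<union> {k<..n}). c i)"
      by (rule prod.cong) (use k in auto)
    also have "\<dots> = c k * ((\<Prod>i\<in>{1..<k}. c i) * (\<Prod>i\<in>{k<..n}. c i))"
      by (subst prod.insert) (auto intro!: prod.union_disjoint arg_cong2[where f = "(*)"])
    finally show ?thesis by (simp add: c_def)
  qed
  also have "(- 1) ^ card {(s, t). s < t \<and> t < n \<and> q (Suc s) \<and> (p \<and> t = k - 1)}
      = (\<Prod>t\<in>{1..<k}. if p \<and> q t then - 1 else 1 :: qv)"
  proof -
    \<comment> \<open>List positions are counted from 0 and columns from 1; the second component of
      a counted pair is always \<open>k - 1\<close>.\<close>
    have "bij_betw (\<lambda>(s, t). Suc s) {(s, t). s < t \<and> t < n \<and> q (Suc s) \<and> (p \<and> t = k - 1)}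
        {t \<in> {1..<k}. p \<and> q t}"
      by (rule bij_betw_byWitness[where f' = "\<lambda>t. (t - 1, k - 1)"]) (use k in auto)
    from bij_betw_same_card[OF this] show ?thesis
      by (simp only: power_minus_one_card[OF finite_atLeastLessThan])
  qed
  finally show ?thesis
    by (simp only: scaleq_scaleq prod.distrib mult.assoc g_def gs_def)
qed

end

section \<open>Generators of the quantum queer superalgebra\<close>

lemma
  shows par_uK: "par (uK i :: 'n :: finite uq) = uK i"
    and par_uL: "par (uL i :: 'n :: finite uq) = uL i"
    and par_uE: "par (uE h :: 'n :: finite uq) = uE h"
    and par_uF: "par (uF h :: 'n :: finite uq) = uF h"
    and par_uKo: "par (uKo i :: 'n :: finite uq) = - uKo i"
  unfolding uK_def uL_def uE_def uF_def uKo_def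
  by (transfer, simp add: fpar_fgen pres_eq_def rel_ideal.zero)+

lemma
  assumes "i \<in> {1..CARD('n)}"
  shows uK_uL: "uK i * uL i = (1 :: 'n :: finite uq)" and uL_uK: "uL i * uK i = (1 :: 'n uq)"
  unfolding uK_def uL_def using assms
  by (transfer, intro relator_eqI,
      simp add: relators_ugen_def uq_relators.QQ1a uq_relators.QQ1b)+

locale uq_comult =
  fixes D :: "'n :: finite uq \<Rightarrow> 'n uq tensor"
  assumes comult: "is_uq_comult D"
begin

sublocale linear_comult D
  by (rule linear_comult.intro) (use comult in \<open>simp add: is_uq_comult_def\<close>)

lemma comult_one: "D 1 = pure [1, 1]"
  and comult_mult: "D (x * y) = tensor_mult (D x) (D y)"
  and comult_tensor_power: "D x \<in> tensor_power 2"
  and comult_uK: "i \<in> {1..CARD('n)} \<Longrightarrow> D (uK i) = pure [uK i, uK i]"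
  and comult_uE: "h \<in> {1..<CARD('n)} \<Longrightarrow>
    D (uE h) = pure [uE h, uL h * uK (h + 1)] + pure [1, uE h]"
  and comult_uF: "h \<in> {1..<CARD('n)} \<Longrightarrow>
    D (uF h) = pure [uF h, 1] + pure [uK h * uL (h + 1), uF h]"
  and comult_uKo: "D (uKo 1) = pure [uKo 1, uK 1] + pure [uL 1, uKo 1]"
  using comult unfolding is_uq_comult_def by blast+

lemma comult_uL: "i \<in> {1..CARD('n)} \<Longrightarrow> D (uL i) = pure [uL i, uL i]"
  by (rule comult_inverse_grouplike[OF comult_one comult_mult comult_tensor_power comult_uK])
    (assumption | rule uK_uL uL_uK par_uK par_uL)+

lemma comult_uK_uL:
  "i \<in> {1..CARD('n)} \<Longrightarrow> k \<in> {1..CARD('n)} \<Longrightarrow> D (uK i * uL k) = pure [uK i * uL k, uK i * uL k]"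
  by (simp add: comult_mult comult_uK comult_uL tensor_mult_pure_even par_uL)

end


section \<open>Divided power monomials\<close>

lemma par_prod_list: "par (prod_list xs) = prod_list (map par xs :: 'a :: superalgebra list)"
  by (induction xs) (simp_all add: par_one par_mult)

lemma par_power: "par (x ^ m) = par x ^ m" for x :: "'a :: superalgebra"
  by (induction m) (simp_all add: par_one par_mult)

lemma par_xX: "par (xX i :: 'n :: finite xa) = xX i"
  and par_xXo: "par (xXo i :: 'n :: finite xa) = - xXo i"
  unfolding xX_def xXo_def
  by (transfer, simp add: fpar_fgen pres_eq_def rel_ideal.zero)+

lemma par_xmono: "par (xmono a b :: 'n :: finite xa) = (- 1) ^ (\<Sum>i = 1..CARD('n). b i) *\<^sub>q xmono a b"
proof -
  have "(- xXo i :: 'n xa) = (- 1) *\<^sub>q xXo i" for i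
    by (simp add: scaleq_one)
  then have "par (xXo i ^ m) = (- 1) ^ m *\<^sub>q (xXo i ^ m :: 'n xa)" for i m
    using power_scaleq[of "- 1" "xXo i :: 'n xa" m] by (simp add: par_power par_xXo scaleq_one)
  then have "par (xmono a b :: 'n xa)
      = (\<Prod>i = 1..CARD('n). (- 1) ^ b i) *\<^sub>q xmono a b"
    unfolding xmono_def par_mult par_prod_list map_map o_def
    by (simp only: par_power[of "xX _"] par_xX prod_list_scaleq scaleq_mult_right prod_list_map_upt)
  then show ?thesis by (simp add: power_sum)
qed

text \<open>The normalisation between \<open>xmono\<close> and \<open>xdivmono\<close> for one of
  the two exponent vectors.\<close>

definition vfact :: "nat \<Rightarrow> (nat \<Rightarrow> nat) \<Rightarrow> qv" where
  "vfact n a = (\<Prod>i = 1..n. qfact (a i))"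

lemma vfact_nonzero: "vfact n a \<noteq> 0"
  by (simp add: vfact_def qfact_nonzero)

lemma xdivmono_eq:
  "(xdivmono a b :: 'n :: finite xa)
    = (1 / (vfact CARD('n) a * vfact CARD('n) b)) *\<^sub>q xmono a b"
proof -
  have inv: "prod_list (map (\<lambda>i. 1 / qfact (f i)) [1..<CARD('n) + 1]) = 1 / vfact CARD('n) f" for f
    unfolding prod_list_map_upt vfact_def by (simp add: prod_dividef)
  show ?thesis
    unfolding xdivmono_def xmono_def
    by (simp only: prod_list_scaleq scaleq_mult_left scaleq_mult_right scaleq_scaleq inv)
      (simp add: mult.commute)
qed

lemma xmono_eq:
  "(xmono a b :: 'n :: finite xa) = (vfact CARD('n) a * vfact CARD('n) b) *\<^sub>q xdivmono a b"
  by (simp add: xdivmono_eq scaleq_scaleq vfact_nonzero scaleq_one)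

lemma par_xdivmono:
  "par (xdivmono a b :: 'n :: finite xa) = (- 1) ^ (\<Sum>i = 1..CARD('n). b i) *\<^sub>q xdivmono a b"
  by (simp add: xdivmono_eq par_scaleq par_xmono scaleq_scaleq mult.commute)

lemma unit_vec_apply: "unit_vec i k = (if i = k then 1 else 0)"
  by (simp add: unit_vec_def kdelta_def)

lemma vfact_plus:
  assumes "p \<in> {1..n}"
  shows "vfact n (a + unit_vec p) = qint (int (a p) + 1) * vfact n a"
proof -
  have "(\<Prod>i\<in>{1..n} - {p}. qfact ((a + unit_vec p) i)) = (\<Prod>i\<in>{1..n} - {p}. qfact (a i))"
    by (intro prod.cong) (auto simp: unit_vec_apply)
  moreover have "qfact ((a + unit_vec p) p) = qint (int (a p) + 1) * qfact (a p)"
    by (simp add: qfact_def unit_vec_apply add.commute)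
  ultimately show ?thesis
    unfolding vfact_def prod.remove[OF finite_atLeastAtMost assms] by (simp only: mult.assoc)
qed

lemma qint_zero: "qint 0 = 0"
  by (simp add: qint_def)

text \<open>Truncated subtraction deviates only for \<open>a p = 0\<close>, and there
  \<open>qint 0 = 0\<close> kills the left side.\<close>

lemma vfact_minus:
  assumes "p \<in> {1..n}"
  shows "qint (int (a p)) * vfact n (a - unit_vec p) = of_bool (a p \<ge> 1) * vfact n a"
proof (cases "a p \<ge> 1")
  case True
  then have "(a - unit_vec p) + unit_vec p = a"
    by (auto simp: fun_eq_iff unit_vec_apply)
  with True vfact_plus[OF assms, of "a - unit_vec p"] show ?thesis
    by (simp add: unit_vec_apply of_nat_diff)
qed (simp add: qint_zero not_le)

text \<open>The quantum integer of the lowered exponent cancels the top factor of its factorial,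
  while the factorial of the raised exponent gains a new one.\<close>

lemma vfact_plus_minus:
  assumes "p \<in> {1..n}" and "q \<in> {1..n}" and "p \<noteq> q"
  shows "qint (int (a q)) * vfact n (a + unit_vec p - unit_vec q)
    = of_bool (a q \<ge> 1) * qint (int (a p) + 1) * vfact n a"
  using vfact_minus[OF assms(2), of "a + unit_vec p"] vfact_plus[OF assms(1), of a] assms(3)
  by (simp add: unit_vec_apply)

lemma vfact_minus_plus:
  assumes "p \<in> {1..n}" and "q \<in> {1..n}" and "p \<noteq> q"
  shows "qint (int (a q)) * vfact n (a - unit_vec q + unit_vec p)
    = of_bool (a q \<ge> 1) * qint (int (a p) + 1) * vfact n a"
proof -
  have "a - unit_vec q + unit_vec p = a + unit_vec p - unit_vec q"
    using assms(3) by (auto simp: fun_eq_iff unit_vec_apply)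
  with vfact_plus_minus[OF assms] show ?thesis by simp
qed

section \<open>The action on divided power monomials\<close>

locale xa_module =
  fixes act :: "'n :: finite uq \<Rightarrow> 'n xa \<Rightarrow> 'n xa"
  assumes action: "is_xa_action act"
begin

lemma act_one: "act 1 v = v"
  and act_mult: "act (x * y) v = act x (act y v)"
  using action unfolding is_xa_action_def is_supermodule_def by blast+

sublocale bilinear_superaction act
  using action unfolding is_xa_action_def is_supermodule_def Vector_Spaces.linear_iff
  by unfold_locales blast+

text \<open>The rescaling common to the generators with a two-term image: \<open>c\<close> and
  \<open>d\<close> are powers of \<upsilon>, and the last two hypotheses say what the quantum
  integers become when the normalisations of source and target are compared.\<close>

lemma act_xdivmono:
  assumes "act u (xmono a b) = (c * qint m) *\<^sub>q xmono a' b' + (d * qint l) *\<^sub>q xmono a'' b''"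
    and "qint m * (vfact CARD('n) a' * vfact CARD('n) b')
      = e * (vfact CARD('n) a * vfact CARD('n) b)"
    and "qint l * (vfact CARD('n) a'' * vfact CARD('n) b'')
      = f * (vfact CARD('n) a * vfact CARD('n) b)"
  shows "act u (xdivmono a b) = (c * e) *\<^sub>q xdivmono a' b' + (d * f) *\<^sub>q xdivmono a'' b''"
proof -
  define N :: "(nat \<Rightarrow> nat) \<Rightarrow> (nat \<Rightarrow> nat) \<Rightarrow> qv"
    where "N a b = vfact CARD('n) a * vfact CARD('n) b" for a b
  have N: "N a b \<noteq> 0" by (simp add: N_def vfact_nonzero)
  have "act u (xdivmono a b) = (1 / N a b) *\<^sub>q ((c * qint m) *\<^sub>q xmono a' b'
      + (d * qint l) *\<^sub>q xmono a'' b'')"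
    by (simp add: xdivmono_eq[of a b] act_scaleq_right assms(1) N_def)
  also have "\<dots> = (1 / N a b * (c * (qint m * N a' b'))) *\<^sub>q xdivmono a' b'
      + (1 / N a b * (d * (qint l * N a'' b''))) *\<^sub>q xdivmono a'' b''"
    unfolding xmono_eq[of a' b'] xmono_eq[of a'' b''] N_def[symmetric]
    by (simp only: scaleq_scaleq scaleq_add_right mult.assoc)
  also have "1 / N a b * (c * (qint m * N a' b')) = c * e"
    using assms(2) N by (simp add: N_def[symmetric])
  also have "1 / N a b * (d * (qint l * N a'' b'')) = d * f"
    using assms(3) N by (simp add: N_def[symmetric])
  finally show ?thesis .
qed

context
  fixes a b :: "nat \<Rightarrow> nat"
  assumes b: "\<forall>k\<in>{1..CARD('n)}. b k \<in> {0, 1}"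
begin

lemma act_uK:
  assumes "i \<in> {1..CARD('n)}"
  shows "act (uK i) (xdivmono a b) = \<upsilon> powi int (a i + b i) *\<^sub>q xdivmono a b"
proof -
  have "act (uK i) (xmono a b) = \<upsilon> powi int (a i + b i) *\<^sub>q xmono a b"
    using action b assms unfolding is_xa_action_def by blast
  then show ?thesis
    by (simp add: xdivmono_eq act_scaleq_right scaleq_scaleq mult.commute)
qed

text \<open>The value is forced by \<open>uL i * uK i = 1\<close>, since the eigenvalue of
  \<open>uK i\<close> is invertible.\<close>

lemma act_uL:
  assumes "i \<in> {1..CARD('n)}"
  shows "act (uL i) (xdivmono a b) = \<upsilon> powi (- int (a i + b i)) *\<^sub>q xdivmono a b"
proof -
  have "act (uL i * uK i) (xdivmono a b) = xdivmono a b"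
    using uL_uK[OF assms] by (simp add: act_one)
  then have "\<upsilon> powi int (a i + b i) *\<^sub>q act (uL i) (xdivmono a b) = xdivmono a b"
    by (simp add: act_mult act_uK[OF assms] act_scaleq_right)
  then have "\<upsilon> powi (- int (a i + b i)) *\<^sub>q \<upsilon> powi int (a i + b i) *\<^sub>q act (uL i) (xdivmono a b)
      = \<upsilon> powi (- int (a i + b i)) *\<^sub>q xdivmono a b"
    by simp
  then show ?thesis
    by (simp add: scaleq_scaleq power_int_minus \<upsilon>_nonzero scaleq_one del: of_nat_add)
qed

text \<open>For \<open>b h = b (h + 1) = 1\<close> the second monomial has odd exponent 2 at
  \<open>h\<close>, with coefficient \<open>qint 2\<close>.\<close>

lemma act_uE:
  assumes "h \<in> {1..<CARD('n)}"
  shows "act (uE h) (xdivmono a b) =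
    (\<upsilon> powi int (b (h + 1)) * (of_bool (a (h + 1) \<ge> 1) * qint (int (a h) + 1)))
      *\<^sub>q xdivmono (a + unit_vec h - unit_vec (h + 1)) b
    + (\<upsilon> powi (- int (a (h + 1))) * (of_bool (b (h + 1) \<ge> 1) * qint (int (b h) + 1)))
      *\<^sub>q xdivmono a (b + unit_vec h - unit_vec (h + 1))"
proof (rule act_xdivmono)
  show "act (uE h) (xmono a b) =
        (\<upsilon> powi int (b (h + 1)) * qint (int (a (h + 1))))
          *\<^sub>q xmono (a + unit_vec h - unit_vec (h + 1)) b
        + (\<upsilon> powi (- int (a (h + 1))) * qint (int (b (h + 1))))
          *\<^sub>q xmono a (b + unit_vec h - unit_vec (h + 1))"
    using action b assms unfolding is_xa_action_def by blast
qed (use assms vfact_plus_minus[of h "CARD('n)" "h + 1"] in \<open>simp_all add: mult_ac\<close>)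

lemma act_uF:
  assumes "h \<in> {1..<CARD('n)}"
  shows "act (uF h) (xdivmono a b) =
    (\<upsilon> powi (- int (b h)) * (of_bool (a h \<ge> 1) * qint (int (a (h + 1)) + 1)))
      *\<^sub>q xdivmono (a - unit_vec h + unit_vec (h + 1)) b
    + (\<upsilon> powi int (a h) * (of_bool (b h \<ge> 1) * qint (int (b (h + 1)) + 1)))
      *\<^sub>q xdivmono a (b - unit_vec h + unit_vec (h + 1))"
proof (rule act_xdivmono)
  show "act (uF h) (xmono a b) =
        (\<upsilon> powi (- int (b h)) * qint (int (a h)))
          *\<^sub>q xmono (a - unit_vec h + unit_vec (h + 1)) b
        + (\<upsilon> powi int (a h) * qint (int (b h)))
          *\<^sub>q xmono a (b - unit_vec h + unit_vec (h + 1))"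
    using action b assms unfolding is_xa_action_def by blast
qed (use assms vfact_minus_plus[of "h + 1" "CARD('n)" h] in \<open>simp_all add: mult_ac\<close>)

text \<open>Here a unit moves between the even and the odd vector, so \<open>vfact_plus\<close> is
  applied to one of them and \<open>vfact_minus\<close> to the other.\<close>

lemma act_uKo:
  "act (uKo 1) (xdivmono a b) =
    (\<upsilon> powi (- int (a 1)) * (of_bool (b 1 \<ge> 1) * qint (int (a 1) + 1)))
      *\<^sub>q xdivmono (a + unit_vec 1) (b - unit_vec 1)
    + (\<upsilon> powi int (b 1) * (of_bool (a 1 \<ge> 1) * qint (int (b 1) + 1)))
      *\<^sub>q xdivmono (a - unit_vec 1) (b + unit_vec 1)"
proof (rule act_xdivmono)
  have one: "1 \<in> {1..CARD('n)}" by (simp add: Suc_leI)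
  show "act (uKo 1) (xmono a b) =
        (\<upsilon> powi (- int (a 1)) * qint (int (b 1))) *\<^sub>q xmono (a + unit_vec 1) (b - unit_vec 1)
        + (\<upsilon> powi int (b 1) * qint (int (a 1))) *\<^sub>q xmono (a - unit_vec 1) (b + unit_vec 1)"
    using action b unfolding is_xa_action_def by blast
  show "qint (int (b 1)) * (vfact CARD('n) (a + unit_vec 1) * vfact CARD('n) (b - unit_vec 1))
      = of_bool (b 1 \<ge> 1) * qint (int (a 1) + 1) * (vfact CARD('n) a * vfact CARD('n) b)"
    using vfact_plus[OF one, of a] vfact_minus[OF one, of b] by (simp add: mult_ac)
  show "qint (int (a 1)) * (vfact CARD('n) (a - unit_vec 1) * vfact CARD('n) (b + unit_vec 1))
      = of_bool (a 1 \<ge> 1) * qint (int (b 1) + 1) * (vfact CARD('n) a * vfact CARD('n) b)"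
    using vfact_plus[OF one, of b] vfact_minus[OF one, of a] by (simp add: mult_ac)
qed

end

end

section \<open>The action on tensor monomials\<close>

lemma pure_map_upd:
  assumes "k \<in> {1..n}"
  shows "pure (map (f(k := c *\<^sub>q y + d *\<^sub>q z)) [1..<n + 1])
    = c *\<^sub>q pure (map (f(k := y)) [1..<n + 1]) + d *\<^sub>q pure (map (f(k := z)) [1..<n + 1])"
proof -
  have "[1..<n + 1] = [1..<k] @ k # [k + 1..<n + 1]"
    using assms by (metis atLeastAtMost_iff less_add_one less_le_trans add_le_mono1 Suc_eq_plus1
        upt_add_eq_append upt_conv_Cons le_Suc_ex le_imp_less_Suc less_imp_le_nat)
  then have "map (f(k := w)) [1..<n + 1] = map f [1..<k] @ w # map f [k + 1..<n + 1]" for w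
    by simp
  then show ?thesis by (simp add: pure_add pure_scaleq del: upt_Suc)
qed

lemma prod_powi: "(\<Prod>t\<in>S. \<upsilon> powi e t) = \<upsilon> powi (\<Sum>t\<in>S. e t)"
  by (induction S rule: infinite_finite_induct) (simp_all add: power_int_add \<upsilon>_nonzero)

lemma unit_mat_apply: "unit_mat i k s t = (if i = s \<and> k = t then 1 else 0)"
  by (simp add: unit_mat_def kdelta_def)

definition xcol :: "nmat \<Rightarrow> nmat \<Rightarrow> nat \<Rightarrow> 'n :: finite xa" where
  "xcol A0 A1 k = xdivmono (\<lambda>i. A0 i k) (\<lambda>i. A1 i k)"

lemma xtensor_xcol:
  "(xtensor A0 A1 :: 'n :: finite xa tensor) = pure (map (xcol A0 A1) [1..<CARD('n) + 1])"
  by (simp only: xtensor_def xcol_def[abs_def])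

text \<open>Replacing one column of a tensor monomial gives the tensor monomial of matrices changed
  in that column only.\<close>

lemma xtensor_upd:
  assumes "\<And>i t. t \<noteq> k \<Longrightarrow> B0 i t = A0 i t" and "\<And>i t. t \<noteq> k \<Longrightarrow> B1 i t = A1 i t"
    and "(\<lambda>i. B0 i k) = a" and "(\<lambda>i. B1 i k) = b"
  shows "pure (map ((xcol A0 A1)(k := xdivmono a b)) [1..<CARD('n) + 1])
    = (xtensor B0 B1 :: 'n :: finite xa tensor)"
proof -
  have "(xcol A0 A1)(k := xdivmono a b) = (xcol B0 B1 :: nat \<Rightarrow> 'n xa)"
    using assms by (simp add: fun_eq_iff xcol_def)
  then show ?thesis by (simp only: xtensor_xcol)
qed

lemma par_xcol:
  "par (xcol A0 A1 t :: 'n :: finite xa)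
    = (if odd (\<Sum>i = 1..CARD('n). A1 i t) then - xcol A0 A1 t else xcol A0 A1 t)"
  by (simp add: xcol_def par_xdivmono minus_one_power_iff scaleq_one)

locale uq_module = uq_comult D + xa_module act
  for D :: "'n :: finite uq \<Rightarrow> 'n uq tensor" and act :: "'n uq \<Rightarrow> 'n xa \<Rightarrow> 'n xa"
begin

lemma uq_tensor_act_sum:
  "uq_tensor_act D act u (\<Sum>i\<in>I. c i *\<^sub>q t i) = (\<Sum>i\<in>I. c i *\<^sub>q uq_tensor_act D act u (t i))"
  by (simp add: uq_tensor_act_def tensor_act_sum_right tensor_act_scaleq_right)

text \<open>A template for the three skew primitive generators: \<open>c\<close> and
  \<open>d\<close> are the coefficients in the changed column, and \<open>e k\<close> gathers the
  sign and the eigenvalues from the other columns.\<close>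

lemma uq_tensor_act_skew_primitive:
  assumes comult: "D a = pure [a, a]" "D x = pure [x, b] + pure [a, x]"
    and par_ab: "par a = a" "par b = b" and par_x: "par x = (if p then - x else x)"
    and f: "\<And>t. t \<in> {1..CARD('n)} \<Longrightarrow> par (f t) = (if q t then - f t else f t)"
    and a: "\<And>t. t \<in> {1..CARD('n)} \<Longrightarrow> act a (f t) = \<alpha> t *\<^sub>q f t"
    and b: "\<And>t. t \<in> {1..CARD('n)} \<Longrightarrow> act b (f t) = \<beta> t *\<^sub>q f t"
    and x: "\<And>k. k \<in> {1..CARD('n)} \<Longrightarrow> act x (f k) = c k *\<^sub>q g k + d k *\<^sub>q g' k"
    and e: "\<And>k. k \<in> {1..CARD('n)} \<Longrightarrow>
      (\<Prod>t\<in>{1..<k}. (if p \<and> q t then - 1 else 1) * \<alpha> t) * (\<Prod>t\<in>{k<..CARD('n)}. \<beta> t) = e k"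
  shows "uq_tensor_act D act x (pure (map f [1..<CARD('n) + 1]))
    = (\<Sum>k = 1..CARD('n). (e k * c k) *\<^sub>q pure (map (f(k := g k)) [1..<CARD('n) + 1])
        + (e k * d k) *\<^sub>q pure (map (f(k := g' k)) [1..<CARD('n) + 1]))"
proof -
  have n: "Suc (CARD('n) - 1) = CARD('n)" by simp
  have "uq_tensor_act D act x (pure (map f [1..<CARD('n) + 1]))
    = (\<Sum>k = 1..CARD('n). koszul act (replicate (k - 1) a @ x # replicate (CARD('n) - k) b)
        (map f [1..<CARD('n) + 1]))"
    by (simp only: uq_tensor_act_def iterated_comult_skew_primitive[OF comult] n
        tensor_act_sum_left tensor_act_pure_pure)
  also have "\<dots> = (\<Sum>k = 1..CARD('n). e k *\<^sub>q pure (map (f(k := act x (f k))) [1..<CARD('n) + 1]))"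
    by (rule sum.cong[OF refl], subst koszul_skew[OF par_ab par_x f a b]) (simp_all only: e)
  also have "\<dots> = (\<Sum>k = 1..CARD('n).
      (e k * c k) *\<^sub>q pure (map (f(k := g k)) [1..<CARD('n) + 1])
        + (e k * d k) *\<^sub>q pure (map (f(k := g' k)) [1..<CARD('n) + 1]))"
    by (rule sum.cong[OF refl]) (simp only: x pure_map_upd scaleq_add_right scaleq_scaleq)
  finally show ?thesis .
qed

context
  fixes A0 A1 :: nmat
  assumes A1: "\<forall>s\<in>{1..CARD('n)}. \<forall>t\<in>{1..CARD('n)}. A1 s t \<in> {0, 1}"
begin

lemma col_A1: "t \<in> {1..CARD('n)} \<Longrightarrow> \<forall>k\<in>{1..CARD('n)}. A1 k t \<in> {0, 1}"
  using A1 by blast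

lemma act_uK_xcol:
  "i \<in> {1..CARD('n)} \<Longrightarrow> t \<in> {1..CARD('n)} \<Longrightarrow>
    act (uK i) (xcol A0 A1 t) = \<upsilon> powi int (A0 i t + A1 i t) *\<^sub>q xcol A0 A1 t"
  unfolding xcol_def by (rule act_uK[OF col_A1])

lemma act_uL_xcol:
  "i \<in> {1..CARD('n)} \<Longrightarrow> t \<in> {1..CARD('n)} \<Longrightarrow>
    act (uL i) (xcol A0 A1 t) = \<upsilon> powi (- int (A0 i t + A1 i t)) *\<^sub>q xcol A0 A1 t"
  unfolding xcol_def by (rule act_uL[OF col_A1])

lemma uq_tensor_act_uK:
  assumes i: "i \<in> {1..CARD('n)}"
  shows "uq_tensor_act D act (uK i) (xtensor A0 A1)
    = \<upsilon> powi (\<Sum>k = 1..CARD('n). int (A0 i k + A1 i k)) *\<^sub>q xtensor A0 A1"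
proof -
  have "uq_tensor_act D act (uK i) (xtensor A0 A1)
      = koszul act (replicate CARD('n) (uK i)) (map (xcol A0 A1) [1..<CARD('n) + 1])"
    by (simp only: uq_tensor_act_def iterated_comult_grouplike[OF comult_uK[OF i]] xtensor_xcol
        tensor_act_pure_pure Suc_diff_1[OF zero_less_card_finite])
  also have "\<dots> = pure (map (\<lambda>k. act (uK i) (xcol A0 A1 (Suc k))) [0..<CARD('n)])"
    by (subst koszul_homogeneous[where p = "\<lambda>_. False"
          and q = "\<lambda>k. odd (\<Sum>i = 1..CARD('n). A1 i (Suc k))"])
      (auto simp: par_uK par_xcol scaleq_one simp del: upt_Suc intro!: arg_cong[where f = pure])
  also have "map (\<lambda>k. act (uK i) (xcol A0 A1 (Suc k))) [0..<CARD('n)]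
      = map (\<lambda>k. \<upsilon> powi int (A0 i k + A1 i k) *\<^sub>q xcol A0 A1 k) [1..<CARD('n) + 1]"
    by (rule nth_equalityI) (use i in \<open>simp_all add: act_uK_xcol del: upt_Suc of_nat_add\<close>)
  also have "pure \<dots> = (\<Prod>k = 1..CARD('n). \<upsilon> powi int (A0 i k + A1 i k)) *\<^sub>q xtensor A0 A1"
    using pure_map_scaleq[of "[]" "\<lambda>k. \<upsilon> powi int (A0 i k + A1 i k)" "xcol A0 A1 :: nat \<Rightarrow> 'n xa"]
    by (simp only: append_Nil prod_list_map_upt xtensor_xcol)
  finally show ?thesis by (simp only: prod_powi)
qed

lemma uq_tensor_act_uE:
  assumes h: "h \<in> {1..<CARD('n)}"
  shows "uq_tensor_act D act (uE h) (xtensor A0 A1) = (\<Sum>k = 1..CARD('n).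
    (\<upsilon> powi sigE_plus CARD('n) h k A0 A1 * (of_bool (A0 (h + 1) k \<ge> 1) * qint (int (A0 h k) + 1)))
      *\<^sub>q xtensor (A0 + unit_mat h k - unit_mat (h + 1) k) A1
    + (\<upsilon> powi sigE_minus CARD('n) h k A0 A1 * (of_bool (A1 (h + 1) k \<ge> 1) * qint (int (A1 h k) + 1)))
      *\<^sub>q xtensor A0 (A1 + unit_mat h k - unit_mat (h + 1) k))"
proof -
  \<comment> \<open>Here \<open>a = 1\<close>, so only the columns to the right of \<open>k\<close>
    contribute; the remaining term of \<open>sigE_plus\<close> or \<open>sigE_minus\<close> comes
    from the action on column \<open>k\<close> itself.\<close>
  define e where "e k = (\<Sum>t\<in>{k<..CARD('n)}.
    int (A0 (h + 1) t + A1 (h + 1) t) - int (A0 h t + A1 h t))" for k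
  have "uq_tensor_act D act (uE h) (xtensor A0 A1) = (\<Sum>k = 1..CARD('n).
    (\<upsilon> powi e k * (\<upsilon> powi int (A1 (h + 1) k) * (of_bool (A0 (h + 1) k \<ge> 1) * qint (int (A0 h k) + 1))))
      *\<^sub>q pure (map ((xcol A0 A1)(k := xdivmono ((\<lambda>i. A0 i k) + unit_vec h - unit_vec (h + 1))
        (\<lambda>i. A1 i k))) [1..<CARD('n) + 1])
    + (\<upsilon> powi e k * (\<upsilon> powi (- int (A0 (h + 1) k)) * (of_bool (A1 (h + 1) k \<ge> 1) * qint (int (A1 h k) + 1))))
      *\<^sub>q pure (map ((xcol A0 A1)(k := xdivmono (\<lambda>i. A0 i k)
        ((\<lambda>i. A1 i k) + unit_vec h - unit_vec (h + 1))))
        [1..<CARD('n) + 1]))"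
    unfolding xtensor_xcol
  proof (rule uq_tensor_act_skew_primitive[where p = False, OF comult_one comult_uE[OF h]])
    show "act (uL h * uK (h + 1)) (xcol A0 A1 t)
        = \<upsilon> powi (int (A0 (h + 1) t + A1 (h + 1) t) - int (A0 h t + A1 h t)) *\<^sub>q xcol A0 A1 t"
      if "t \<in> {1..CARD('n)}" for t
      using that h
      by (simp add: act_mult act_uK_xcol act_uL_xcol act_scaleq_right scaleq_scaleq
          power_int_add[symmetric] \<upsilon>_nonzero del: of_nat_add power_int_of_nat)
    show "act 1 (xcol A0 A1 t) = 1 *\<^sub>q xcol A0 A1 t" for t
      by (simp add: act_one scaleq_one)
    show "act (uE h) (xcol A0 A1 k) =
        (\<upsilon> powi int (A1 (h + 1) k) * (of_bool (A0 (h + 1) k \<ge> 1) * qint (int (A0 h k) + 1)))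
          *\<^sub>q xdivmono ((\<lambda>i. A0 i k) + unit_vec h - unit_vec (h + 1)) (\<lambda>i. A1 i k)
        + (\<upsilon> powi (- int (A0 (h + 1) k)) * (of_bool (A1 (h + 1) k \<ge> 1) * qint (int (A1 h k) + 1)))
          *\<^sub>q xdivmono (\<lambda>i. A0 i k) ((\<lambda>i. A1 i k) + unit_vec h - unit_vec (h + 1))"
      if "k \<in> {1..CARD('n)}" for k
      unfolding xcol_def by (rule act_uE[OF col_A1[OF that] h])
  qed (simp_all add: par_one par_uE par_mult par_uK par_uL par_xcol prod_powi e_def)
  also have "\<dots> = (\<Sum>k = 1..CARD('n).
    (\<upsilon> powi sigE_plus CARD('n) h k A0 A1 * (of_bool (A0 (h + 1) k \<ge> 1) * qint (int (A0 h k) + 1)))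
      *\<^sub>q xtensor (A0 + unit_mat h k - unit_mat (h + 1) k) A1
    + (\<upsilon> powi sigE_minus CARD('n) h k A0 A1 * (of_bool (A1 (h + 1) k \<ge> 1) * qint (int (A1 h k) + 1)))
      *\<^sub>q xtensor A0 (A1 + unit_mat h k - unit_mat (h + 1) k))"
  proof -
    have "sigE_plus CARD('n) h k A0 A1 = e k + int (A1 (h + 1) k)"
      and "sigE_minus CARD('n) h k A0 A1 = e k + (- int (A0 (h + 1) k))" for k
      by (simp_all add: sigE_plus_def sigE_minus_def e_def)
    then show ?thesis
      by (intro sum.cong refl arg_cong2[where f = "(+)"] arg_cong2[where f = scaleq] xtensor_upd)
        (simp_all add: power_int_add \<upsilon>_nonzero
          power_int_diff power_int_minus divide_inverse unit_mat_apply unit_vec_apply fun_eq_iff mult_ac)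
  qed
  finally show ?thesis .
qed

lemma uq_tensor_act_uF:
  assumes h: "h \<in> {1..<CARD('n)}"
  shows "uq_tensor_act D act (uF h) (xtensor A0 A1) = (\<Sum>k = 1..CARD('n).
    (\<upsilon> powi sigF_plus h k A0 A1 * (of_bool (A0 h k \<ge> 1) * qint (int (A0 (h + 1) k) + 1)))
      *\<^sub>q xtensor (A0 - unit_mat h k + unit_mat (h + 1) k) A1
    + (\<upsilon> powi sigF_minus h k A0 A1 * (of_bool (A1 h k \<ge> 1) * qint (int (A1 (h + 1) k) + 1)))
      *\<^sub>q xtensor A0 (A1 - unit_mat h k + unit_mat (h + 1) k))"
proof -
  \<comment> \<open>The mirror image of the previous case: now \<open>b = 1\<close>, and the columns
    to the left contribute.\<close>
  define e where "e k = (\<Sum>t\<in>{1..<k}.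
    int (A0 h t + A1 h t) - int (A0 (h + 1) t + A1 (h + 1) t))" for k
  have "uq_tensor_act D act (uF h) (xtensor A0 A1) = (\<Sum>k = 1..CARD('n).
    (\<upsilon> powi e k * (\<upsilon> powi (- int (A1 h k)) * (of_bool (A0 h k \<ge> 1) * qint (int (A0 (h + 1) k) + 1))))
      *\<^sub>q pure (map ((xcol A0 A1)(k := xdivmono ((\<lambda>i. A0 i k) - unit_vec h + unit_vec (h + 1))
        (\<lambda>i. A1 i k))) [1..<CARD('n) + 1])
    + (\<upsilon> powi e k * (\<upsilon> powi int (A0 h k) * (of_bool (A1 h k \<ge> 1) * qint (int (A1 (h + 1) k) + 1))))
      *\<^sub>q pure (map ((xcol A0 A1)(k := xdivmono (\<lambda>i. A0 i k)
        ((\<lambda>i. A1 i k) - unit_vec h + unit_vec (h + 1))))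
        [1..<CARD('n) + 1]))"
    unfolding xtensor_xcol
  proof (rule uq_tensor_act_skew_primitive[where p = False and a = "uK h * uL (h + 1)",
        OF _ comult_uF[OF h]])
    show "D (uK h * uL (h + 1)) = pure [uK h * uL (h + 1), uK h * uL (h + 1)]"
      using h by (intro comult_uK_uL) auto
    show "act (uK h * uL (h + 1)) (xcol A0 A1 t)
        = \<upsilon> powi (int (A0 h t + A1 h t) - int (A0 (h + 1) t + A1 (h + 1) t)) *\<^sub>q xcol A0 A1 t"
      if "t \<in> {1..CARD('n)}" for t
      using that h
      by (simp add: act_mult act_uK_xcol act_uL_xcol act_scaleq_right scaleq_scaleq
          power_int_add[symmetric] \<upsilon>_nonzero del: of_nat_add power_int_of_nat)
    show "act 1 (xcol A0 A1 t) = 1 *\<^sub>q xcol A0 A1 t" for t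
      by (simp add: act_one scaleq_one)
    show "act (uF h) (xcol A0 A1 k) =
        (\<upsilon> powi (- int (A1 h k)) * (of_bool (A0 h k \<ge> 1) * qint (int (A0 (h + 1) k) + 1)))
          *\<^sub>q xdivmono ((\<lambda>i. A0 i k) - unit_vec h + unit_vec (h + 1)) (\<lambda>i. A1 i k)
        + (\<upsilon> powi int (A0 h k) * (of_bool (A1 h k \<ge> 1) * qint (int (A1 (h + 1) k) + 1)))
          *\<^sub>q xdivmono (\<lambda>i. A0 i k) ((\<lambda>i. A1 i k) - unit_vec h + unit_vec (h + 1))"
      if "k \<in> {1..CARD('n)}" for k
      unfolding xcol_def by (rule act_uF[OF col_A1[OF that] h])
  qed (simp_all add: par_one par_uF par_mult par_uK par_uL par_xcol prod_powi e_def)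
  also have "\<dots> = (\<Sum>k = 1..CARD('n).
    (\<upsilon> powi sigF_plus h k A0 A1 * (of_bool (A0 h k \<ge> 1) * qint (int (A0 (h + 1) k) + 1)))
      *\<^sub>q xtensor (A0 - unit_mat h k + unit_mat (h + 1) k) A1
    + (\<upsilon> powi sigF_minus h k A0 A1 * (of_bool (A1 h k \<ge> 1) * qint (int (A1 (h + 1) k) + 1)))
      *\<^sub>q xtensor A0 (A1 - unit_mat h k + unit_mat (h + 1) k))"
  proof -
    have "sigF_plus h k A0 A1 = e k + (- int (A1 h k))"
      and "sigF_minus h k A0 A1 = e k + int (A0 h k)" for k
      by (simp_all add: sigF_plus_def sigF_minus_def e_def)
    then show ?thesis
      by (intro sum.cong refl arg_cong2[where f = "(+)"] arg_cong2[where f = scaleq] xtensor_upd)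
        (simp_all add: power_int_add \<upsilon>_nonzero
          power_int_diff power_int_minus divide_inverse unit_mat_apply unit_vec_apply fun_eq_iff mult_ac)
  qed
  finally show ?thesis .
qed

lemma uq_tensor_act_uKo:
  shows "uq_tensor_act D act (uKo 1) (xtensor A0 A1) = (\<Sum>k = 1..CARD('n).
    ((- 1) ^ odd_count CARD('n) k A1 * \<upsilon> powi sigK_plus CARD('n) k A0 A1
        * (of_bool (A1 1 k \<ge> 1) * qint (int (A0 1 k) + 1)))
      *\<^sub>q xtensor (A0 + unit_mat 1 k) (A1 - unit_mat 1 k)
    + ((- 1) ^ odd_count CARD('n) k A1 * \<upsilon> powi sigK_minus CARD('n) k A0 A1
        * (of_bool (A0 1 k \<ge> 1) * qint (int (A1 1 k) + 1)))
      *\<^sub>q xtensor (A0 - unit_mat 1 k) (A1 + unit_mat 1 k))"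
proof -
  have one: "1 \<in> {1..CARD('n)}" by (simp add: Suc_leI)
  \<comment> \<open>Both sides contribute: \<open>uL 1\<close> acts on the columns to the left,
    \<open>uK 1\<close> on those to the right.\<close>
  define e where "e k = - (\<Sum>t\<in>{1..<k}. int (A0 1 t + A1 1 t))
    + (\<Sum>t\<in>{k<..CARD('n)}. int (A0 1 t + A1 1 t))" for k
  define s :: "nat \<Rightarrow> qv" where "s k = (- 1) ^ odd_count CARD('n) k A1" for k
  \<comment> \<open>The parity of the total number of odd factors left of \<open>k\<close> is
    distributed over the columns, as the template needs one sign per column.\<close>
  have s: "s k = (\<Prod>t\<in>{1..<k}. if odd (\<Sum>i = 1..CARD('n). A1 i t) then - 1 else 1)" for k
    unfolding s_def odd_count_def power_sum[of _ _ "{1..<k}"]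
    by (rule prod.cong[OF refl]) (simp add: minus_one_power_iff)
  have "uq_tensor_act D act (uKo 1) (xtensor A0 A1) = (\<Sum>k = 1..CARD('n).
    (s k * \<upsilon> powi e k * (\<upsilon> powi (- int (A0 1 k)) * (of_bool (A1 1 k \<ge> 1) * qint (int (A0 1 k) + 1))))
      *\<^sub>q pure (map ((xcol A0 A1)(k := xdivmono ((\<lambda>i. A0 i k) + unit_vec 1) ((\<lambda>i. A1 i k) - unit_vec 1)))
        [1..<CARD('n) + 1])
    + (s k * \<upsilon> powi e k * (\<upsilon> powi int (A1 1 k) * (of_bool (A0 1 k \<ge> 1) * qint (int (A1 1 k) + 1))))
      *\<^sub>q pure (map ((xcol A0 A1)(k := xdivmono ((\<lambda>i. A0 i k) - unit_vec 1) ((\<lambda>i. A1 i k) + unit_vec 1)))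
        [1..<CARD('n) + 1]))"
    unfolding xtensor_xcol
  proof (rule uq_tensor_act_skew_primitive[where p = True, OF comult_uL[OF one] comult_uKo])
    show "act (uL 1) (xcol A0 A1 t) = \<upsilon> powi (- int (A0 1 t + A1 1 t)) *\<^sub>q xcol A0 A1 t"
      and "act (uK 1) (xcol A0 A1 t) = \<upsilon> powi int (A0 1 t + A1 1 t) *\<^sub>q xcol A0 A1 t"
      if "t \<in> {1..CARD('n)}" for t
      by (rule act_uL_xcol[OF one that], rule act_uK_xcol[OF one that])
    show "act (uKo 1) (xcol A0 A1 k) =
        (\<upsilon> powi (- int (A0 1 k)) * (of_bool (A1 1 k \<ge> 1) * qint (int (A0 1 k) + 1)))
          *\<^sub>q xdivmono ((\<lambda>i. A0 i k) + unit_vec 1) ((\<lambda>i. A1 i k) - unit_vec 1)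
        + (\<upsilon> powi int (A1 1 k) * (of_bool (A0 1 k \<ge> 1) * qint (int (A1 1 k) + 1)))
          *\<^sub>q xdivmono ((\<lambda>i. A0 i k) - unit_vec 1) ((\<lambda>i. A1 i k) + unit_vec 1)"
      if "k \<in> {1..CARD('n)}" for k
      unfolding xcol_def by (rule act_uKo[OF col_A1[OF that]])
    show "par (xcol A0 A1 t :: 'n xa)
      = (if odd (\<Sum>i = 1..CARD('n). A1 i t) then - xcol A0 A1 t else xcol A0 A1 t)" for t
      by (rule par_xcol)
    show "(\<Prod>t\<in>{1..<k}. (if True \<and> odd (\<Sum>i = 1..CARD('n). A1 i t) then - 1 else 1)
          * \<upsilon> powi (- int (A0 1 t + A1 1 t)))
        * (\<Prod>t\<in>{k<..CARD('n)}. \<upsilon> powi int (A0 1 t + A1 1 t)) = s k * \<upsilon> powi e k" for k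
      unfolding prod.distrib prod_powi sum_negf e_def s power_int_add[OF disjI1[OF \<upsilon>_nonzero]]
      by simp
  qed (simp_all add: par_uK par_uL par_uKo)
  also have "\<dots> = (\<Sum>k = 1..CARD('n).
    (s k * \<upsilon> powi sigK_plus CARD('n) k A0 A1
        * (of_bool (A1 1 k \<ge> 1) * qint (int (A0 1 k) + 1)))
      *\<^sub>q xtensor (A0 + unit_mat 1 k) (A1 - unit_mat 1 k)
    + (s k * \<upsilon> powi sigK_minus CARD('n) k A0 A1
        * (of_bool (A0 1 k \<ge> 1) * qint (int (A1 1 k) + 1)))
      *\<^sub>q xtensor (A0 - unit_mat 1 k) (A1 + unit_mat 1 k))"
  proof -
    have "sigK_plus CARD('n) k A0 A1 = e k - int (A0 1 k)"
      and "sigK_minus CARD('n) k A0 A1 = e k + int (A1 1 k)" for k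
      by (simp_all add: sigK_plus_def sigK_minus_def e_def)
    then show ?thesis
      by (intro sum.cong refl arg_cong2[where f = "(+)"] arg_cong2[where f = scaleq] xtensor_upd)
        (simp_all add: power_int_add \<upsilon>_nonzero
          power_int_diff power_int_minus divide_inverse unit_mat_apply unit_vec_apply fun_eq_iff mult_ac)
  qed
  finally show ?thesis by (simp only: s_def)
qed

end

end

section \<open>Summation over the diagonal\<close>

lemma diag_mat_apply: "diag_mat l s t = (if s = t then l s else 0)"
  by (simp add: diag_mat_def kdelta_def)

lemma sum_diag_mat_atLeastLessThan:
  "1 \<le> s \<Longrightarrow> (\<Sum>t\<in>{1..<k}. int (diag_mat l s t)) = of_bool (s < k) * int (l s)"
  by (simp add: diag_mat_apply if_distrib[where f = int] cong: if_cong)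

lemma sum_diag_mat_greaterThanAtMost:
  "s \<le> n \<Longrightarrow> (\<Sum>t\<in>{k<..n}. int (diag_mat l s t)) = of_bool (k < s) * int (l s)"
  by (simp add: diag_mat_apply if_distrib[where f = int] cong: if_cong)

lemma mat_sum_plus_even:
  assumes "s \<in> {1..n}" and "t \<in> {1..n}"
  shows "mat_sum n (A0 + unit_mat s t) A1 = mat_sum n A0 A1 + 1"
proof -
  have "(\<Sum>i = 1..n. \<Sum>k = 1..n. unit_mat s t i k) = (\<Sum>i = 1..n. if i = s then 1 else 0)"
    using assms by (intro sum.cong) (auto simp: unit_mat_apply)
  then show ?thesis using assms by (simp add: mat_sum_def sum.distrib add_ac)
qed

text \<open>Transfers statements about changes of the even matrix to the odd one.\<close>

lemma mat_sum_swap: "mat_sum n A0 A1 = mat_sum n A1 A0"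
  by (simp add: mat_sum_def add.commute)

lemma mat_sum_plus_odd:
  assumes "s \<in> {1..n}" and "t \<in> {1..n}"
  shows "mat_sum n A0 (A1 + unit_mat s t) = mat_sum n A0 A1 + 1"
  using mat_sum_plus_even[OF assms] by (metis mat_sum_swap)

lemma unit_mat_minus_plus: "A s t \<ge> 1 \<Longrightarrow> A - unit_mat s t + unit_mat s t = A"
  by (auto simp: fun_eq_iff unit_mat_apply)

lemma mat_sum_minus_even:
  assumes "s \<in> {1..n}" and "t \<in> {1..n}" and "A0 s t \<ge> 1"
  shows "Suc (mat_sum n (A0 - unit_mat s t) A1) = mat_sum n A0 A1"
  using mat_sum_plus_even[OF assms(1,2), of "A0 - unit_mat s t" A1]
  by (simp add: unit_mat_minus_plus[of A0 s t, OF assms(3)])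

lemma mat_sum_minus_odd:
  assumes "s \<in> {1..n}" and "t \<in> {1..n}" and "A1 s t \<ge> 1"
  shows "Suc (mat_sum n A0 (A1 - unit_mat s t)) = mat_sum n A0 A1"
  using mat_sum_minus_even[of s n t A1 A0, OF assms] by (simp only: mat_sum_swap)

lemma mat_sum_plus_minus_even:
  assumes "p \<in> {1..n}" "q \<in> {1..n}" "s \<in> {1..n}" "t \<in> {1..n}" and "A0 s t \<ge> 1"
  shows "mat_sum n (A0 + unit_mat p q - unit_mat s t) A1 = mat_sum n A0 A1"
    and "mat_sum n (A0 - unit_mat s t + unit_mat p q) A1 = mat_sum n A0 A1"
proof -
  have "(A0 + unit_mat p q) s t \<ge> 1"
    using assms(5) by simp
  from mat_sum_minus_even[of s n t "A0 + unit_mat p q", OF assms(3,4) this]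
  show "mat_sum n (A0 + unit_mat p q - unit_mat s t) A1 = mat_sum n A0 A1"
    by (simp add: mat_sum_plus_even[OF assms(1,2)])
  show "mat_sum n (A0 - unit_mat s t + unit_mat p q) A1 = mat_sum n A0 A1"
    using mat_sum_minus_even[of s n t A0, OF assms(3,4,5), of A1]
    by (simp add: mat_sum_plus_even[OF assms(1,2)])
qed

lemma mat_sum_plus_minus_odd:
  assumes "p \<in> {1..n}" "q \<in> {1..n}" "s \<in> {1..n}" "t \<in> {1..n}" and "A1 s t \<ge> 1"
  shows "mat_sum n A0 (A1 + unit_mat p q - unit_mat s t) = mat_sum n A0 A1"
    and "mat_sum n A0 (A1 - unit_mat s t + unit_mat p q) = mat_sum n A0 A1"
  using mat_sum_plus_minus_even[of p n q s t A1 A0, OF assms] by (metis mat_sum_swap)+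

lemma mat_sum_diag: "mat_sum n (A0 + diag_mat l) A1 = mat_sum n A0 A1 + (\<Sum>k = 1..n. l k)"
proof -
  have "(\<Sum>i = 1..n. \<Sum>k = 1..n. diag_mat l i k) = (\<Sum>k = 1..n. l k)"
    by (intro sum.cong) (simp_all add: diag_mat_apply)
  then show ?thesis by (simp add: mat_sum_def sum.distrib add_ac)
qed

text \<open>The exponent of \<upsilon> in the series. Its additivity in both arguments converts
  powers of \<upsilon> depending on \<lambda> into shifts of \<open>j\<close>.\<close>

definition pairing :: "nat \<Rightarrow> (nat \<Rightarrow> nat) \<Rightarrow> (nat \<Rightarrow> int) \<Rightarrow> int" where
  "pairing n l j = (\<Sum>k = 1..n. int (l k) * j k)"

lemma pairing_add: "pairing n l (i + j) = pairing n l i + pairing n l j"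
  and pairing_diff: "pairing n l (i - j) = pairing n l i - pairing n l j"
  and pairing_uminus: "pairing n l (- i) = - pairing n l i"
  and pairing_zero: "pairing n l 0 = 0"
  by (simp_all add: pairing_def distrib_left right_diff_distrib sum.distrib sum_subtractf sum_negf)

lemma pairing_add_left: "pairing n (l + m) j = pairing n l j + pairing n m j"
  by (simp add: pairing_def distrib_right sum.distrib)

lemma sum_unit_vec: "p \<in> {1..n} \<Longrightarrow> (\<Sum>k = 1..n. unit_vec p k) = (1 :: nat)"
  by (simp add: unit_vec_apply)

lemma pairing_unit_vec: "p \<in> {1..n} \<Longrightarrow> pairing n l (unit_vec p) = int (l p)"
  by (simp add: pairing_def unit_vec_apply if_distrib[where f = "(*) _"] cong: if_cong)

lemma pairing_unit_vec_left: "p \<in> {1..n} \<Longrightarrow> pairing n (unit_vec p) j = j p"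
  by (simp add: pairing_def unit_vec_apply if_distrib[where f = int]
      if_distrib[where f = "\<lambda>x. x * _"] cong: if_cong)

lemma pairing_plus_unit_vec_left:
  "p \<in> {1..n} \<Longrightarrow> pairing n (l + unit_vec p) j = pairing n l j + j p"
  by (simp only: pairing_add_left pairing_unit_vec_left)

text \<open>The index set of the degree \<open>r\<close> component of a series; the value 0 outside
  the range makes each vector occur once.\<close>

definition diagonals :: "nat \<Rightarrow> nmat \<Rightarrow> nmat \<Rightarrow> nat \<Rightarrow> (nat \<Rightarrow> nat) set" where
  "diagonals n A0 A1 r = {l. (\<forall>k. k \<notin> {1..n} \<longrightarrow> l k = 0) \<and> mat_sum n (A0 + diag_mat l) A1 = r}"

lemma finite_diagonals: "finite (diagonals n A0 A1 r)"
proof (rule finite_subset)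
  have "l k \<le> r" if "l \<in> diagonals n A0 A1 r" "k \<in> {1..n}" for l k
    using that member_le_sum[of k "{1..n}" l] by (auto simp: diagonals_def mat_sum_diag)
  then show "diagonals n A0 A1 r
      \<subseteq> {l. \<forall>k. (k \<in> {1..n} \<longrightarrow> l k \<in> {..r}) \<and> (k \<notin> {1..n} \<longrightarrow> l k = 0)}"
    by (auto simp: diagonals_def)
qed (intro finite_set_of_finite_funs; simp)

lemma diagonals_cong:
  "mat_sum n C0 C1 = mat_sum n A0 A1 \<Longrightarrow> diagonals n C0 C1 r = diagonals n A0 A1 r"
  by (simp add: diagonals_def mat_sum_diag)

text \<open>The extra unit of total degree in \<open>C0\<close>, \<open>C1\<close> is traded for a
  unit in the diagonal entry \<open>p\<close>. The condition \<open>l p \<ge> 1\<close> makes the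
  truncated subtraction a true inverse.\<close>

lemma bij_betw_diagonals:
  assumes "p \<in> {1..n}" and "mat_sum n C0 C1 = mat_sum n A0 A1 + 1"
  shows "bij_betw (\<lambda>l. l + unit_vec p) (diagonals n C0 C1 r) {l \<in> diagonals n A0 A1 r. l p \<ge> 1}"
proof (rule bij_betw_byWitness[where f' = "\<lambda>l. l - unit_vec p"])
  have inv: "l - unit_vec p + unit_vec p = l" if "l p \<ge> 1" for l :: "nat \<Rightarrow> nat"
    using that by (auto simp: fun_eq_iff unit_vec_apply)
  then show "\<forall>l\<in>{l \<in> diagonals n A0 A1 r. l p \<ge> 1}. l - unit_vec p + unit_vec p = l" by simp
  show "\<forall>l\<in>diagonals n C0 C1 r. l + unit_vec p - unit_vec p = l" by simp
  show "(\<lambda>l. l + unit_vec p) ` diagonals n C0 C1 r \<subseteq> {l \<in> diagonals n A0 A1 r. l p \<ge> 1}"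
    using assms sum_unit_vec[OF assms(1)]
    by (auto simp: diagonals_def mat_sum_diag sum.distrib unit_vec_apply)
  have "mat_sum n A0 A1 + (\<Sum>k = 1..n. l k) = mat_sum n C0 C1 + (\<Sum>k = 1..n. (l - unit_vec p) k)"
    if "l p \<ge> 1" for l
  proof -
    have "(\<Sum>k = 1..n. l k) = (\<Sum>k = 1..n. (l - unit_vec p) k + unit_vec p k)"
      using inv[of l, OF that] by (metis plus_fun_apply)
    then show ?thesis using assms sum_unit_vec[OF assms(1)] by (simp add: sum.distrib)
  qed
  then show "(\<lambda>l. l - unit_vec p) ` {l \<in> diagonals n A0 A1 r. l p \<ge> 1} \<subseteq> diagonals n C0 C1 r"
    by (auto simp: diagonals_def mat_sum_diag)
qed

section \<open>Recognising modified series as multiples of series\<close>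

lemma xseries_diagonals:
  "xseries A0 A1 j r = (\<Sum>l\<in>diagonals CARD('n) A0 A1 r.
    \<upsilon> powi pairing CARD('n) l j *\<^sub>q (xtensor (A0 + diag_mat l) A1 :: 'n :: finite xa tensor))"
  by (simp add: xseries_def diagonals_def pairing_def)

text \<open>The contribution of one kind of change in one column: every term of the series receives
  a factor and new matrices that depend on \<lambda>.\<close>

definition xseries_with :: "nmat \<Rightarrow> nmat \<Rightarrow> (nat \<Rightarrow> int) \<Rightarrow> ((nat \<Rightarrow> nat) \<Rightarrow> qv) \<Rightarrow>
    ((nat \<Rightarrow> nat) \<Rightarrow> nmat) \<Rightarrow> ((nat \<Rightarrow> nat) \<Rightarrow> nmat) \<Rightarrow> nat \<Rightarrow> 'n :: finite xa tensor" where
  "xseries_with A0 A1 j K M0 M1 r = (\<Sum>l\<in>diagonals CARD('n) A0 A1 r.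
    (\<upsilon> powi pairing CARD('n) l j * K l) *\<^sub>q xtensor (M0 l) (M1 l))"

text \<open>The total degree and hence the set of \<lambda> do not change, and the linear form with
  vector \<open>w\<close> in the exponent is absorbed by \<open>j\<close>. If \<open>P\<close>
  fails, all coefficients vanish.\<close>

lemma xseries_with_same_diagonal:
  fixes C0 C1 :: nmat
  assumes K: "\<And>l. K l = of_bool P * (d * \<upsilon> powi pairing CARD('n :: finite) l w)"
    and M: "\<And>l. P \<Longrightarrow> M0 l = C0 + diag_mat l" "\<And>l. P \<Longrightarrow> M1 l = C1"
    and "P \<Longrightarrow> mat_sum CARD('n) C0 C1 = mat_sum CARD('n) A0 A1"
    and "i = j + w" and "c = of_bool P * d"
  shows "xseries_with A0 A1 j K M0 M1 = c *\<^sub>q (xseries C0 C1 i :: nat \<Rightarrow> 'n xa tensor)"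
proof (cases P)
  case True
  with assms show ?thesis
    by (intro ext) (simp add: scaleq_fun_def xseries_with_def xseries_diagonals
        diagonals_cong[of _ C0 C1 A0 A1] qspace.scale_sum_right scaleq_scaleq pairing_add
        power_int_add \<upsilon>_nonzero mult_ac)
qed (simp add: K \<open>c = of_bool P * d\<close> fun_eq_iff scaleq_fun_def xseries_with_def)

text \<open>Terms with \<open>l p = 0\<close> drop out. Substituting \<open>l + unit_vec p\<close>
  for \<open>l\<close> in the others costs the factor \<open>\<upsilon> powi j p\<close>.\<close>

lemma xseries_with_lower_diagonal:
  fixes C0 C1 :: nmat
  assumes p: "p \<in> {1..CARD('n :: finite)}"
    and K: "\<And>l. K l = of_bool (l p \<ge> 1) * d"
    and M: "\<And>l. M0 (l + unit_vec p) = C0 + diag_mat l" "\<And>l. M1 l = C1"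
    and C: "mat_sum CARD('n) C0 C1 = mat_sum CARD('n) A0 A1 + 1"
    and c: "c = d * \<upsilon> powi j p"
  shows "xseries_with A0 A1 j K M0 M1
    = c *\<^sub>q (xseries C0 C1 j :: nat \<Rightarrow> 'n xa tensor)"
  unfolding c
proof
  fix r
  have "xseries_with A0 A1 j K M0 M1 r = (\<Sum>l\<in>{l \<in> diagonals CARD('n) A0 A1 r. l p \<ge> 1}.
      (\<upsilon> powi pairing CARD('n) l j * d) *\<^sub>q (xtensor (M0 l) C1 :: 'n xa tensor))"
    unfolding xseries_with_def sum.inter_filter[OF finite_diagonals]
    by (intro sum.cong refl) (simp add: K M(2))
  also have "\<dots> = (\<Sum>l\<in>diagonals CARD('n) C0 C1 r.
      (\<upsilon> powi pairing CARD('n) (l + unit_vec p) j * d) *\<^sub>q xtensor (M0 (l + unit_vec p)) C1)"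
    by (rule sum.reindex_bij_betw[OF bij_betw_diagonals[OF p C], symmetric])
  also have "\<dots> = ((d * \<upsilon> powi j p) *\<^sub>q xseries C0 C1 j) r"
    by (simp add: M pairing_plus_unit_vec_left[OF p] scaleq_fun_def xseries_diagonals
        qspace.scale_sum_right scaleq_scaleq power_int_add \<upsilon>_nonzero mult_ac)
  finally show "xseries_with A0 A1 j K M0 M1 r
      = ((d * \<upsilon> powi j p) *\<^sub>q (xseries C0 C1 j :: nat \<Rightarrow> 'n xa tensor)) r" .
qed

text \<open>With \<open>m = l + unit_vec p\<close> the quantum integer is that of
  \<open>m p\<close>, and its two powers of \<upsilon> shift the vector by plus or minus
  \<open>unit_vec p\<close>. The factor with exponent \<open>- j p - w p\<close> compensates for
  pairing \<open>j + w\<close> with \<open>m\<close> instead of \<open>l\<close>.\<close>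

lemma xseries_with_raise_diagonal:
  fixes C0 C1 :: nmat
  assumes p: "p \<in> {1..CARD('n :: finite)}"
    and K: "\<And>l. K l = of_bool P * (d * \<upsilon> powi pairing CARD('n) l w * qint (int (l p) + 1))"
    and M: "\<And>l. P \<Longrightarrow> M0 l = C0 + diag_mat (l + unit_vec p)" "\<And>l. P \<Longrightarrow> M1 l = C1"
    and C: "P \<Longrightarrow> mat_sum CARD('n) A0 A1 = mat_sum CARD('n) C0 C1 + 1"
    and j: "j' = j + w + unit_vec p" "j'' = j + w - unit_vec p"
    and c: "c = of_bool P * (d * \<upsilon> powi (- j p - w p)) / (\<upsilon> - inverse \<upsilon>)"
  shows "xseries_with A0 A1 j K M0 M1
    = c *\<^sub>q (xseries C0 C1 j' - (xseries C0 C1 j'' :: nat \<Rightarrow> 'n xa tensor))"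
proof (cases P)
  case True
  show ?thesis
    unfolding c
  proof
    fix r
    define c where "c = d * \<upsilon> powi (- j p - w p) / (\<upsilon> - inverse \<upsilon>)"
    let ?S = "diagonals CARD('n) C0 C1 r"
    let ?X = "\<lambda>m. xtensor (C0 + diag_mat m) C1 :: 'n xa tensor"
    have "(c *\<^sub>q (xseries C0 C1 j' - xseries C0 C1 j'')) r
      = (\<Sum>m\<in>?S. (c * (\<upsilon> powi pairing CARD('n) m j' - \<upsilon> powi pairing CARD('n) m j'')) *\<^sub>q ?X m)"
      by (simp add: scaleq_fun_def xseries_diagonals qspace.scale_sum_right
          qspace.scale_left_diff_distrib scaleq_scaleq right_diff_distrib sum_subtractf
          qspace.scale_right_diff_distrib)
    \<comment> \<open>For \<open>m p = 0\<close> both shifts give the same power, so the surplus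
      terms of the two series cancel.\<close>
    also have "\<dots> = (\<Sum>m\<in>{m \<in> ?S. m p \<ge> 1}.
        (c * (\<upsilon> powi pairing CARD('n) m j' - \<upsilon> powi pairing CARD('n) m j'')) *\<^sub>q ?X m)"
      by (rule sum.mono_neutral_right)
        (auto simp: finite_diagonals j pairing_add pairing_diff pairing_unit_vec[OF p] not_le)
    also have "\<dots> = (\<Sum>l\<in>diagonals CARD('n) A0 A1 r.
        (c * (\<upsilon> powi pairing CARD('n) (l + unit_vec p) j' - \<upsilon> powi pairing CARD('n) (l + unit_vec p) j''))
          *\<^sub>q ?X (l + unit_vec p))"
      by (rule sum.reindex_bij_betw[OF bij_betw_diagonals[OF p C[OF True]], symmetric])
    also have "\<dots> = xseries_with A0 A1 j K M0 M1 r"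
      unfolding xseries_with_def
    proof (intro sum.cong refl arg_cong2[where f = scaleq])
      fix l :: "nat \<Rightarrow> nat"
      define e where "e = pairing CARD('n) l j + pairing CARD('n) l w"
      have "\<upsilon> powi pairing CARD('n) (l + unit_vec p) j'
          = \<upsilon> powi (e + j p + w p) * \<upsilon> powi (int (l p) + 1)"
        and "\<upsilon> powi pairing CARD('n) (l + unit_vec p) j''
          = \<upsilon> powi (e + j p + w p) * \<upsilon> powi (- (int (l p) + 1))"
        by (simp_all only: j pairing_add pairing_diff pairing_plus_unit_vec_left[OF p]
            pairing_unit_vec[OF p] power_int_add[symmetric] \<upsilon>_nonzero simp_thms e_def
            plus_fun_apply unit_vec_apply if_True)
          (simp_all add: algebra_simps unit_vec_apply)
      then have "c * (\<upsilon> powi pairing CARD('n) (l + unit_vec p) j'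
            - \<upsilon> powi pairing CARD('n) (l + unit_vec p) j'')
          = (\<upsilon> powi (- j p - w p) * \<upsilon> powi (e + j p + w p)) * d * qint (int (l p) + 1)"
        by (simp add: c_def qint_def right_diff_distrib diff_divide_distrib mult_ac)
      also have "\<upsilon> powi (- j p - w p) * \<upsilon> powi (e + j p + w p) = \<upsilon> powi e"
        by (simp add: power_int_add[symmetric] \<upsilon>_nonzero)
      also have "\<upsilon> powi e * d * qint (int (l p) + 1) = \<upsilon> powi pairing CARD('n) l j * K l"
        using True by (simp add: K e_def power_int_add \<upsilon>_nonzero mult_ac)
      finally show "c * (\<upsilon> powi pairing CARD('n) (l + unit_vec p) j'
          - \<upsilon> powi pairing CARD('n) (l + unit_vec p) j'') = \<upsilon> powi pairing CARD('n) l j * K l" .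
    qed (simp add: M[OF True])
    finally show "xseries_with A0 A1 j K M0 M1 r
      = ((of_bool P * (d * \<upsilon> powi (- j p - w p)) / (\<upsilon> - inverse \<upsilon>))
        *\<^sub>q (xseries C0 C1 j' - (xseries C0 C1 j'' :: nat \<Rightarrow> 'n xa tensor))) r"
      using True by (simp add: c_def)
  qed
qed (simp add: K c fun_eq_iff scaleq_fun_def xseries_with_def)

section \<open>Sums over columns and the exponents on the diagonal\<close>

lemma sum_fun_apply: "(\<Sum>k\<in>S. f k) x = (\<Sum>k\<in>S. f k x :: 'a :: comm_monoid_add)"
  by (induction S rule: infinite_finite_induct) simp_all

text \<open>Moves the side condition of a sum into the coefficient, the form in which the series
  lemmas produce it.\<close>

lemma sum_filter_scaleq:
  "finite S \<Longrightarrow> (\<Sum>k\<in>{k \<in> S. P k}. c k *\<^sub>q f k) = (\<Sum>k\<in>S. (of_bool (P k) * c k) *\<^sub>q f k)"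
  by (simp add: sum.inter_filter) (intro sum.cong refl, simp)

text \<open>Rows \<open>h\<close> and \<open>h + 1\<close> meet the diagonal in columns
  \<open>h\<close> and \<open>h + 1\<close> only, so these need separate treatment.\<close>

lemma sum_split_adjacent:
  fixes g :: "nat \<Rightarrow> 'a :: ab_group_add"
  assumes "h \<in> {1..<n}"
  shows "(\<Sum>k = 1..n. g k)
    = (\<Sum>k = 1..h - 1. g k) + g h + g (h + 1) + (\<Sum>k = h + 2..n. g k)"
proof -
  have "{1..n} = {1..h - 1} \<union> insert h (insert (h + 1) {h + 2..n})"
    using assms by auto
  then show ?thesis
    by (simp only:) (subst sum.union_disjoint, auto simp: add.assoc)
qed

context uq_module
begin

lemma uq_hat_act_xseries:
  assumes "\<And>l. uq_tensor_act D act u (xtensor (A0 + diag_mat l) A1)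
    = (\<Sum>k\<in>I. K k l *\<^sub>q xtensor (M0 k l) (M1 k l) + K' k l *\<^sub>q xtensor (N0 k l) (N1 k l))"
  shows "uq_hat_act D act u (xseries A0 A1 j)
    = (\<Sum>k\<in>I. xseries_with A0 A1 j (K k) (M0 k) (M1 k))
      + (\<Sum>k\<in>I. xseries_with A0 A1 j (K' k) (N0 k) (N1 k))"
proof
  fix r
  show "uq_hat_act D act u (xseries A0 A1 j) r
    = ((\<Sum>k\<in>I. xseries_with A0 A1 j (K k) (M0 k) (M1 k))
      + (\<Sum>k\<in>I. xseries_with A0 A1 j (K' k) (N0 k) (N1 k))) r"
    unfolding plus_fun_apply sum_fun_apply xseries_with_def sum.distrib[symmetric]
    by (subst sum.swap)
      (simp add: uq_hat_act_def xseries_diagonals uq_tensor_act_sum assms qspace.scale_sum_right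
        scaleq_add_right scaleq_scaleq)
qed

end

text \<open>A diagonal entry counts in the sum exactly if its column lies to the right of
  \<open>k\<close>. In \<open>sigE_minus\<close> the leading entry of \<open>A0\<close> adds a
  contribution when it is itself diagonal. The resulting linear form in \<lambda> dictates the
  vector \<open>w\<close> below.\<close>

lemma sigE_plus_diag:
  "h + 1 \<le> n \<Longrightarrow> sigE_plus n h k (A0 + diag_mat l) A1
    = sigE_plus n h k A0 A1 + (of_bool (k < h + 1) * int (l (h + 1)) - of_bool (k < h) * int (l h))"
  and sigE_minus_diag:
  "h + 1 \<le> n \<Longrightarrow> sigE_minus n h k (A0 + diag_mat l) A1
    = sigE_minus n h k A0 A1 + (of_bool (k < h + 1) * int (l (h + 1)) - of_bool (k < h) * int (l h)
      - of_bool (k = h + 1) * int (l (h + 1)))"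
  using sum_diag_mat_greaterThanAtMost[of "h + 1" n l k] sum_diag_mat_greaterThanAtMost[of h n l k]
  by (simp_all add: sigE_plus_def sigE_minus_def sum.distrib sum_subtractf)
    (simp_all add: diag_mat_apply)

lemma sigF_plus_diag:
  "1 \<le> h \<Longrightarrow> sigF_plus h k (A0 + diag_mat l) A1
    = sigF_plus h k A0 A1 + (of_bool (h < k) * int (l h) - of_bool (h + 1 < k) * int (l (h + 1)))"
  and sigF_minus_diag:
  "1 \<le> h \<Longrightarrow> sigF_minus h k (A0 + diag_mat l) A1
    = sigF_minus h k A0 A1 + (of_bool (h < k) * int (l h) - of_bool (h + 1 < k) * int (l (h + 1))
      + of_bool (k = h) * int (l h))"
  using sum_diag_mat_atLeastLessThan[of "h + 1" l k] sum_diag_mat_atLeastLessThan[of h l k]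
  by (simp_all add: sigF_plus_def sigF_minus_def sum.distrib sum_subtractf)
    (simp_all add: diag_mat_apply)

text \<open>In \<open>sigK_plus\<close> each column \<open>k \<ge> 1\<close> contributes
  \<open>- int (l 1)\<close>, at \<open>k = 1\<close> through the leading entry and afterwards
  through the left sum; in \<open>sigK_minus\<close> this happens only for
  \<open>k > 1\<close>.\<close>

lemma sigK_plus_diag:
  "1 \<le> n \<Longrightarrow> sigK_plus n k (A0 + diag_mat l) A1
    = sigK_plus n k A0 A1 + (of_bool (k < 1) * int (l 1) - of_bool (1 < k) * int (l 1)
      - of_bool (k = 1) * int (l 1))"
  and sigK_minus_diag:
  "1 \<le> n \<Longrightarrow> sigK_minus n k (A0 + diag_mat l) A1
    = sigK_minus n k A0 A1 + (of_bool (k < 1) * int (l 1) - of_bool (1 < k) * int (l 1))"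
  using sum_diag_mat_atLeastLessThan[of 1 l k] sum_diag_mat_greaterThanAtMost[of 1 n l k]
  by (simp_all add: sigK_plus_def sigK_minus_def sum.distrib sum_subtractf)
    (simp_all add: diag_mat_apply)

section \<open>The multiplication formulas\<close>

theorem theorem7p3:
  fixes D :: "'n :: finite uq \<Rightarrow> 'n uq tensor"
    and act :: "'n uq \<Rightarrow> 'n xa \<Rightarrow> 'n xa"
    and A0 A1 :: nmat
    and j :: "nat \<Rightarrow> int"
    and n i h :: nat
  assumes "n = CARD('n)" and "n \<ge> 2"
    and "is_uq_comult D"
    and "is_xa_action act"
    and "\<forall>s\<in>{1..n}. A0 s s = 0"
    and "\<forall>s\<in>{1..n}. \<forall>t\<in>{1..n}. A1 s t \<in> {0, 1}"
    and "1 \<le> i" and "i \<le> n"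
    and "1 \<le> h" and "h \<le> n - 1"
  shows "(uq_hat_act D act (uK i) (xseries A0 A1 j)
      = \<upsilon> powi (\<Sum>k = 1..n. int (A0 i k + A1 i k)) *\<^sub>q xseries A0 A1 (j + unit_vec i))
    \<and> (uq_hat_act D act (uE h) (xseries A0 A1 j)
      = (\<Sum>k\<in>{k \<in> {1..h - 1}. A0 (h + 1) k \<ge> 1}.
            (\<upsilon> powi sigE_plus n h k A0 A1 * qint (int (A0 h k) + 1))
              *\<^sub>q xseries (A0 + unit_mat h k - unit_mat (h + 1) k) A1 (j - alpha_vec h))
        + (of_bool (A0 (h + 1) h \<ge> 1) * \<upsilon> powi (sigE_plus n h h A0 A1 - j h) / (\<upsilon> - inverse \<upsilon>))
            *\<^sub>q (xseries (A0 - unit_mat (h + 1) h) A1 (j + beta_vec h)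
               - xseries (A0 - unit_mat (h + 1) h) A1 (j - alpha_vec h))
        + (\<upsilon> powi (sigE_plus n h (h + 1) A0 A1 + j (h + 1)) * qint (int (A0 h (h + 1)) + 1))
            *\<^sub>q xseries (A0 + unit_mat h (h + 1)) A1 j
        + (\<Sum>k\<in>{k \<in> {h + 2..n}. A0 (h + 1) k \<ge> 1}.
            (\<upsilon> powi sigE_plus n h k A0 A1 * qint (int (A0 h k) + 1))
              *\<^sub>q xseries (A0 + unit_mat h k - unit_mat (h + 1) k) A1 j)
        + (\<Sum>k\<in>{k \<in> {1..h - 1}. A1 (h + 1) k = 1}.
            (\<upsilon> powi sigE_minus n h k A0 A1 * qint (int (A1 h k) + 1))
              *\<^sub>q xseries A0 (A1 + unit_mat h k - unit_mat (h + 1) k) (j - alpha_vec h))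
        + (of_bool (A1 (h + 1) h = 1) * \<upsilon> powi sigE_minus n h h A0 A1 * qint (int (A1 h h) + 1))
            *\<^sub>q xseries A0 (A1 + unit_mat h h - unit_mat (h + 1) h) (j + unit_vec (h + 1))
        + (of_bool (A1 (h + 1) (h + 1) = 1) * \<upsilon> powi sigE_minus n h (h + 1) A0 A1
              * qint (int (A1 h (h + 1)) + 1))
            *\<^sub>q xseries A0 (A1 + unit_mat h (h + 1) - unit_mat (h + 1) (h + 1)) (j - unit_vec (h + 1))
        + (\<Sum>k\<in>{k \<in> {h + 2..n}. A1 (h + 1) k = 1}.
            (\<upsilon> powi sigE_minus n h k A0 A1 * qint (int (A1 h k) + 1))
              *\<^sub>q xseries A0 (A1 + unit_mat h k - unit_mat (h + 1) k) j))
    \<and> (uq_hat_act D act (uF h) (xseries A0 A1 j)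
      = (\<Sum>k\<in>{k \<in> {1..h - 1}. A0 h k \<ge> 1}.
            (\<upsilon> powi sigF_plus h k A0 A1 * qint (int (A0 (h + 1) k) + 1))
              *\<^sub>q xseries (A0 - unit_mat h k + unit_mat (h + 1) k) A1 j)
        + (\<upsilon> powi (sigF_plus h h A0 A1 + j h) * qint (int (A0 (h + 1) h) + 1))
            *\<^sub>q xseries (A0 + unit_mat (h + 1) h) A1 j
        + (of_bool (A0 h (h + 1) \<ge> 1) * \<upsilon> powi (sigF_plus h (h + 1) A0 A1 - j (h + 1))
              / (\<upsilon> - inverse \<upsilon>))
            *\<^sub>q (xseries (A0 - unit_mat h (h + 1)) A1 (j + beta_vec h)
               - xseries (A0 - unit_mat h (h + 1)) A1 (j + alpha_vec h))
        + (\<Sum>k\<in>{k \<in> {h + 2..n}. A0 h k \<ge> 1}.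
            (\<upsilon> powi sigF_plus h k A0 A1 * qint (int (A0 (h + 1) k) + 1))
              *\<^sub>q xseries (A0 - unit_mat h k + unit_mat (h + 1) k) A1 (j + alpha_vec h))
        + (\<Sum>k\<in>{k \<in> {1..h - 1}. A1 h k = 1}.
            (\<upsilon> powi sigF_minus h k A0 A1 * qint (int (A1 (h + 1) k) + 1))
              *\<^sub>q xseries A0 (A1 - unit_mat h k + unit_mat (h + 1) k) j)
        + (of_bool (A1 h h = 1) * \<upsilon> powi sigF_minus h h A0 A1 * qint (int (A1 (h + 1) h) + 1))
            *\<^sub>q xseries A0 (A1 - unit_mat h h + unit_mat (h + 1) h) (j + unit_vec h)
        + (of_bool (A1 h (h + 1) = 1) * \<upsilon> powi sigF_minus h (h + 1) A0 A1
              * qint (int (A1 (h + 1) (h + 1)) + 1))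
            *\<^sub>q xseries A0 (A1 - unit_mat h (h + 1) + unit_mat (h + 1) (h + 1)) (j + unit_vec h)
        + (\<Sum>k\<in>{k \<in> {h + 2..n}. A1 h k = 1}.
            (\<upsilon> powi sigF_minus h k A0 A1 * qint (int (A1 (h + 1) k) + 1))
              *\<^sub>q xseries A0 (A1 - unit_mat h k + unit_mat (h + 1) k) (j + alpha_vec h)))
    \<and> (uq_hat_act D act (uKo 1) (xseries A0 A1 j)
      = (of_bool (A1 1 1 = 1) * \<upsilon> powi (sigK_plus n 1 A0 A1 - j 1 + 1) / (\<upsilon> - inverse \<upsilon>))
            *\<^sub>q (xseries A0 (A1 - unit_mat 1 1) j
               - xseries A0 (A1 - unit_mat 1 1) (j - 2 * unit_vec 1))
        + (\<Sum>k\<in>{k \<in> {2..n}. A1 1 k = 1}.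
            ((- 1) ^ odd_count n k A1 * \<upsilon> powi sigK_plus n k A0 A1 * qint (int (A0 1 k) + 1))
              *\<^sub>q xseries (A0 + unit_mat 1 k) (A1 - unit_mat 1 k) (j - unit_vec 1))
        + (\<upsilon> powi (sigK_minus n 1 A0 A1 + j 1) * qint (int (A1 1 1) + 1))
            *\<^sub>q xseries A0 (A1 + unit_mat 1 1) j
        + (\<Sum>k\<in>{k \<in> {2..n}. A0 1 k \<ge> 1}.
            ((- 1) ^ odd_count n k A1 * \<upsilon> powi sigK_minus n k A0 A1 * qint (int (A1 1 k) + 1))
              *\<^sub>q xseries (A0 - unit_mat 1 k) (A1 + unit_mat 1 k) (j - unit_vec 1)))"
proof -
  interpret uq_module D act
    by (intro uq_module.intro uq_comult.intro xa_module.intro assms)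
  note n = assms(1)
  have A1: "\<forall>s\<in>{1..CARD('n)}. \<forall>t\<in>{1..CARD('n)}. A1 s t \<in> {0, 1}"
    using assms(1,6) by simp
  have i: "i \<in> {1..CARD('n)}" and h: "h \<in> {1..<CARD('n)}" and h': "h \<in> {1..<n}"
    using assms(1,7-10) by auto
  have diag: "A0 s s = 0" if "s \<in> {1..n}" for s
    using assms(5) that by blast
  \<comment> \<open>Reconciles the condition \<open>\<ge> 1\<close> of the tensor formulas with the
    condition \<open>= 1\<close> of the claim.\<close>
  have odd: "Suc 0 \<le> A1 s t \<longleftrightarrow> A1 s t = Suc 0" if "s \<in> {1..n}" "t \<in> {1..n}" for s t
    using assms(6) that by force
  note pairing_simps = pairing_add pairing_diff pairing_uminus pairing_zero pairing_unit_vec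
  note powi_simps = power_int_add power_int_diff power_int_minus divide_inverse \<upsilon>_nonzero
  note mat_simps = fun_eq_iff unit_mat_apply diag_mat_apply unit_vec_apply
  note mat_sums = mat_sum_plus_even mat_sum_plus_odd mat_sum_minus_even mat_sum_minus_odd
    mat_sum_plus_minus_even mat_sum_plus_minus_odd
  note term_simps = pairing_simps powi_simps mat_simps mat_sums diag odd n[symmetric]
  show ?thesis
  proof (intro conjI, goal_cases K E F Ko)
    case K
    show ?case
    proof
      fix r
      \<comment> \<open>Row \<open>i\<close> meets the diagonal once, in the entry
        \<open>l i\<close>.\<close>
      have row: "(\<Sum>k = 1..n. int ((A0 + diag_mat l) i k + A1 i k))
          = (\<Sum>k = 1..n. int (A0 i k + A1 i k)) + pairing n l (unit_vec i)" for l
        using i by (simp add: n sum.distrib pairing_unit_vec mat_simps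
            if_distrib[where f = int] cong: if_cong)
      have "uq_hat_act D act (uK i) (xseries A0 A1 j) r = (\<Sum>l\<in>diagonals CARD('n) A0 A1 r.
          (\<upsilon> powi pairing CARD('n) l j * \<upsilon> powi (\<Sum>k = 1..n. int ((A0 + diag_mat l) i k + A1 i k)))
            *\<^sub>q xtensor (A0 + diag_mat l) A1)"
        by (simp only: uq_hat_act_def xseries_diagonals uq_tensor_act_sum uq_tensor_act_uK[OF A1 i]
            scaleq_scaleq n)
      then show "uq_hat_act D act (uK i) (xseries A0 A1 j) r
          = (\<upsilon> powi (\<Sum>k = 1..n. int (A0 i k + A1 i k)) *\<^sub>q xseries A0 A1 (j + unit_vec i)) r"
        unfolding row
        by (simp add: scaleq_fun_def xseries_diagonals qspace.scale_sum_right scaleq_scaleq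
            pairing_add powi_simps n mult_ac)
    qed
  next
    case E
    \<comment> \<open>\<open>P k\<close> collects the changes of even entries in column
      \<open>k\<close>, \<open>M k\<close> those of odd entries.\<close>
    define P :: "nat \<Rightarrow> nat \<Rightarrow> 'n xa tensor" where "P k = xseries_with A0 A1 j
      (\<lambda>l. \<upsilon> powi sigE_plus n h k (A0 + diag_mat l) A1
        * (of_bool ((A0 + diag_mat l) (h + 1) k \<ge> 1) * qint (int ((A0 + diag_mat l) h k) + 1)))
      (\<lambda>l. A0 + diag_mat l + unit_mat h k - unit_mat (h + 1) k) (\<lambda>_. A1)" for k
    define M :: "nat \<Rightarrow> nat \<Rightarrow> 'n xa tensor" where "M k = xseries_with A0 A1 j
      (\<lambda>l. \<upsilon> powi sigE_minus n h k (A0 + diag_mat l) A1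
        * (of_bool (A1 (h + 1) k \<ge> 1) * qint (int (A1 h k) + 1)))
      (\<lambda>l. A0 + diag_mat l) (\<lambda>_. A1 + unit_mat h k - unit_mat (h + 1) k)" for k
    have hat: "uq_hat_act D act (uE h) (xseries A0 A1 j) = (\<Sum>k = 1..n. P k) + (\<Sum>k = 1..n. M k)"
      unfolding P_def M_def n by (rule uq_hat_act_xseries[OF uq_tensor_act_uE[OF A1 h]])
    have P_less: "(\<Sum>k = 1..h - 1. P k) = (\<Sum>k\<in>{k \<in> {1..h - 1}. A0 (h + 1) k \<ge> 1}.
        (\<upsilon> powi sigE_plus n h k A0 A1 * qint (int (A0 h k) + 1))
          *\<^sub>q xseries (A0 + unit_mat h k - unit_mat (h + 1) k) A1 (j - alpha_vec h))"
    proof (subst sum_filter_scaleq[OF finite_atLeastAtMost], rule sum.cong[OF refl])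
      fix k assume "k \<in> {1..h - 1}"
      then show "P k
          = (of_bool (A0 (h + 1) k \<ge> 1) * (\<upsilon> powi sigE_plus n h k A0 A1 * qint (int (A0 h k) + 1)))
          *\<^sub>q xseries (A0 + unit_mat h k - unit_mat (h + 1) k) A1 (j - alpha_vec h)"
        unfolding P_def using h'
        \<comment> \<open>Both relevant diagonal entries lie to the right of \<open>k\<close> and
          enter the exponent with opposite signs.\<close>
        by (intro xseries_with_same_diagonal[where w = "unit_vec (h + 1) - unit_vec h"
              and d = "\<upsilon> powi sigE_plus n h k A0 A1 * qint (int (A0 h k) + 1)"
              and P = "A0 (h + 1) k \<ge> 1"])
          (auto simp: sigE_plus_diag sigE_minus_diag term_simps)
    qed
    have P_h: "P h = (of_bool (A0 (h + 1) h \<ge> 1) * \<upsilon> powi (sigE_plus n h h A0 A1 - j h) / (\<upsilon> - inverse \<upsilon>))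
          *\<^sub>q (xseries (A0 - unit_mat (h + 1) h) A1 (j + beta_vec h)
            - xseries (A0 - unit_mat (h + 1) h) A1 (j - alpha_vec h))"
      unfolding P_def using h'
      \<comment> \<open>The entry raised is the diagonal one of row \<open>h\<close>; only the
        diagonal entry of row \<open>h + 1\<close> still lies to the right. Adding plus or minus
        \<open>unit_vec h\<close> to this \<open>w\<close> gives \<open>beta_vec h\<close> and
        \<open>- alpha_vec h\<close>.\<close>
      by (intro xseries_with_raise_diagonal[where p = "h" and w = "unit_vec (h + 1)"
            and d = "\<upsilon> powi sigE_plus n h h A0 A1"
            and P = "A0 (h + 1) h \<ge> 1"])
        (auto simp: sigE_plus_diag sigE_minus_diag term_simps)
    have P_Suc: "P (h + 1) = (\<upsilon> powi (sigE_plus n h (h + 1) A0 A1 + j (h + 1)) * qint (int (A0 h (h + 1)) + 1))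
          *\<^sub>q xseries (A0 + unit_mat h (h + 1)) A1 j"
      unfolding P_def using h'
      \<comment> \<open>The lowered entry is \<open>l (h + 1)\<close>, since \<open>A0\<close>
        vanishes on the diagonal, and the exponent no longer depends on \<lambda>.\<close>
      by (intro xseries_with_lower_diagonal[where p = "h + 1"
            and d = "\<upsilon> powi sigE_plus n h (h + 1) A0 A1 * qint (int (A0 h (h + 1)) + 1)"])
        (auto simp: sigE_plus_diag sigE_minus_diag term_simps)
    have P_greater: "(\<Sum>k = h + 2..n. P k) = (\<Sum>k\<in>{k \<in> {h + 2..n}. A0 (h + 1) k \<ge> 1}.
        (\<upsilon> powi sigE_plus n h k A0 A1 * qint (int (A0 h k) + 1))
          *\<^sub>q xseries (A0 + unit_mat h k - unit_mat (h + 1) k) A1 j)"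
    proof (subst sum_filter_scaleq[OF finite_atLeastAtMost], rule sum.cong[OF refl])
      fix k assume "k \<in> {h + 2..n}"
      then show "P k
          = (of_bool (A0 (h + 1) k \<ge> 1) * (\<upsilon> powi sigE_plus n h k A0 A1 * qint (int (A0 h k) + 1)))
          *\<^sub>q xseries (A0 + unit_mat h k - unit_mat (h + 1) k) A1 j"
        unfolding P_def using h'
        by (intro xseries_with_same_diagonal[where w = "0"
              and d = "\<upsilon> powi sigE_plus n h k A0 A1 * qint (int (A0 h k) + 1)"
              and P = "A0 (h + 1) k \<ge> 1"])
          (auto simp: sigE_plus_diag sigE_minus_diag term_simps)
    qed
    \<comment> \<open>Changes of odd entries leave \<lambda> alone, so all columns fall under the
      case of an unchanged diagonal and differ only in \<open>w\<close>.\<close>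
    have M_less: "(\<Sum>k = 1..h - 1. M k) = (\<Sum>k\<in>{k \<in> {1..h - 1}. A1 (h + 1) k = 1}.
        (\<upsilon> powi sigE_minus n h k A0 A1 * qint (int (A1 h k) + 1))
          *\<^sub>q xseries A0 (A1 + unit_mat h k - unit_mat (h + 1) k) (j - alpha_vec h))"
    proof (subst sum_filter_scaleq[OF finite_atLeastAtMost], rule sum.cong[OF refl])
      fix k assume "k \<in> {1..h - 1}"
      then show "M k
          = (of_bool (A1 (h + 1) k = 1) * (\<upsilon> powi sigE_minus n h k A0 A1 * qint (int (A1 h k) + 1)))
          *\<^sub>q xseries A0 (A1 + unit_mat h k - unit_mat (h + 1) k) (j - alpha_vec h)"
        unfolding M_def using h'
        by (intro xseries_with_same_diagonal[where w = "unit_vec (h + 1) - unit_vec h"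
              and d = "\<upsilon> powi sigE_minus n h k A0 A1 * qint (int (A1 h k) + 1)"
              and P = "A1 (h + 1) k = 1"])
          (auto simp: sigE_plus_diag sigE_minus_diag term_simps)
    qed
    have M_h: "M h = (of_bool (A1 (h + 1) h = 1) * \<upsilon> powi sigE_minus n h h A0 A1 * qint (int (A1 h h) + 1))
          *\<^sub>q xseries A0 (A1 + unit_mat h h - unit_mat (h + 1) h) (j + unit_vec (h + 1))"
      unfolding M_def using h'
      by (intro xseries_with_same_diagonal[where w = "unit_vec (h + 1)"
            and d = "\<upsilon> powi sigE_minus n h h A0 A1 * qint (int (A1 h h) + 1)"
            and P = "A1 (h + 1) h = 1"])
        (auto simp: sigE_plus_diag sigE_minus_diag term_simps)
    have M_Suc: "M (h + 1) = (of_bool (A1 (h + 1) (h + 1) = 1) * \<upsilon> powi sigE_minus n h (h + 1) A0 A1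
          * qint (int (A1 h (h + 1)) + 1))
          *\<^sub>q xseries A0 (A1 + unit_mat h (h + 1) - unit_mat (h + 1) (h + 1)) (j - unit_vec (h + 1))"
      unfolding M_def using h'
      \<comment> \<open>The shift comes from the leading term of \<open>sigE_minus\<close>, which is
        a diagonal entry here.\<close>
      by (intro xseries_with_same_diagonal[where w = "- unit_vec (h + 1)"
            and d = "\<upsilon> powi sigE_minus n h (h + 1) A0 A1 * qint (int (A1 h (h + 1)) + 1)"
            and P = "A1 (h + 1) (h + 1) = 1"])
        (auto simp: sigE_plus_diag sigE_minus_diag term_simps)
    have M_greater: "(\<Sum>k = h + 2..n. M k) = (\<Sum>k\<in>{k \<in> {h + 2..n}. A1 (h + 1) k = 1}.
        (\<upsilon> powi sigE_minus n h k A0 A1 * qint (int (A1 h k) + 1))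
          *\<^sub>q xseries A0 (A1 + unit_mat h k - unit_mat (h + 1) k) j)"
    proof (subst sum_filter_scaleq[OF finite_atLeastAtMost], rule sum.cong[OF refl])
      fix k assume "k \<in> {h + 2..n}"
      then show "M k
          = (of_bool (A1 (h + 1) k = 1) * (\<upsilon> powi sigE_minus n h k A0 A1 * qint (int (A1 h k) + 1)))
          *\<^sub>q xseries A0 (A1 + unit_mat h k - unit_mat (h + 1) k) j"
        unfolding M_def using h'
        by (intro xseries_with_same_diagonal[where w = "0"
              and d = "\<upsilon> powi sigE_minus n h k A0 A1 * qint (int (A1 h k) + 1)"
              and P = "A1 (h + 1) k = 1"])
          (auto simp: sigE_plus_diag sigE_minus_diag term_simps)
    qed
    show ?case
      unfolding hat sum_split_adjacent[OF h'] P_less P_h P_Suc P_greater M_less M_h M_Suc M_greater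
      by (simp only: add_ac)
  next
    case F
    define P :: "nat \<Rightarrow> nat \<Rightarrow> 'n xa tensor" where "P k = xseries_with A0 A1 j
      (\<lambda>l. \<upsilon> powi sigF_plus h k (A0 + diag_mat l) A1
        * (of_bool ((A0 + diag_mat l) h k \<ge> 1) * qint (int ((A0 + diag_mat l) (h + 1) k) + 1)))
      (\<lambda>l. A0 + diag_mat l - unit_mat h k + unit_mat (h + 1) k) (\<lambda>_. A1)" for k
    define M :: "nat \<Rightarrow> nat \<Rightarrow> 'n xa tensor" where "M k = xseries_with A0 A1 j
      (\<lambda>l. \<upsilon> powi sigF_minus h k (A0 + diag_mat l) A1
        * (of_bool (A1 h k \<ge> 1) * qint (int (A1 (h + 1) k) + 1)))
      (\<lambda>l. A0 + diag_mat l) (\<lambda>_. A1 - unit_mat h k + unit_mat (h + 1) k)" for k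
    have hat: "uq_hat_act D act (uF h) (xseries A0 A1 j) = (\<Sum>k = 1..n. P k) + (\<Sum>k = 1..n. M k)"
      unfolding P_def M_def n by (rule uq_hat_act_xseries[OF uq_tensor_act_uF[OF A1 h]])
    have P_less: "(\<Sum>k = 1..h - 1. P k) = (\<Sum>k\<in>{k \<in> {1..h - 1}. A0 h k \<ge> 1}.
        (\<upsilon> powi sigF_plus h k A0 A1 * qint (int (A0 (h + 1) k) + 1))
          *\<^sub>q xseries (A0 - unit_mat h k + unit_mat (h + 1) k) A1 j)"
    proof (subst sum_filter_scaleq[OF finite_atLeastAtMost], rule sum.cong[OF refl])
      fix k assume "k \<in> {1..h - 1}"
      then show "P k
          = (of_bool (A0 h k \<ge> 1) * (\<upsilon> powi sigF_plus h k A0 A1 * qint (int (A0 (h + 1) k) + 1)))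
          *\<^sub>q xseries (A0 - unit_mat h k + unit_mat (h + 1) k) A1 j"
        unfolding P_def using h'
        by (intro xseries_with_same_diagonal[where w = "0"
              and d = "\<upsilon> powi sigF_plus h k A0 A1 * qint (int (A0 (h + 1) k) + 1)"
              and P = "A0 h k \<ge> 1"])
          (auto simp: sigF_plus_diag sigF_minus_diag term_simps)
    qed
    \<comment> \<open>Compared with the previous generator the roles are exchanged: column
      \<open>h\<close> lowers a diagonal entry and column \<open>h + 1\<close> raises one.\<close>
    have P_h: "P h = (\<upsilon> powi (sigF_plus h h A0 A1 + j h) * qint (int (A0 (h + 1) h) + 1))
          *\<^sub>q xseries (A0 + unit_mat (h + 1) h) A1 j"
      unfolding P_def using h'
      by (intro xseries_with_lower_diagonal[where p = "h"
            and d = "\<upsilon> powi sigF_plus h h A0 A1 * qint (int (A0 (h + 1) h) + 1)"])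
        (auto simp: sigF_plus_diag sigF_minus_diag term_simps)
    have P_Suc: "P (h + 1) = (of_bool (A0 h (h + 1) \<ge> 1) * \<upsilon> powi (sigF_plus h (h + 1) A0 A1 - j (h + 1))
          / (\<upsilon> - inverse \<upsilon>))
          *\<^sub>q (xseries (A0 - unit_mat h (h + 1)) A1 (j + beta_vec h)
            - xseries (A0 - unit_mat h (h + 1)) A1 (j + alpha_vec h))"
      unfolding P_def using h'
      by (intro xseries_with_raise_diagonal[where p = "h + 1" and w = "unit_vec h"
            and d = "\<upsilon> powi sigF_plus h (h + 1) A0 A1"
            and P = "A0 h (h + 1) \<ge> 1"])
        (auto simp: sigF_plus_diag sigF_minus_diag term_simps)
    have P_greater: "(\<Sum>k = h + 2..n. P k) = (\<Sum>k\<in>{k \<in> {h + 2..n}. A0 h k \<ge> 1}.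
        (\<upsilon> powi sigF_plus h k A0 A1 * qint (int (A0 (h + 1) k) + 1))
          *\<^sub>q xseries (A0 - unit_mat h k + unit_mat (h + 1) k) A1 (j + alpha_vec h))"
    proof (subst sum_filter_scaleq[OF finite_atLeastAtMost], rule sum.cong[OF refl])
      fix k assume "k \<in> {h + 2..n}"
      then show "P k
          = (of_bool (A0 h k \<ge> 1) * (\<upsilon> powi sigF_plus h k A0 A1 * qint (int (A0 (h + 1) k) + 1)))
          *\<^sub>q xseries (A0 - unit_mat h k + unit_mat (h + 1) k) A1 (j + alpha_vec h)"
        unfolding P_def using h'
        \<comment> \<open>Now both diagonal entries lie to the left of \<open>k\<close>, where the
          exponent is collected.\<close>
        by (intro xseries_with_same_diagonal[where w = "alpha_vec h"
              and d = "\<upsilon> powi sigF_plus h k A0 A1 * qint (int (A0 (h + 1) k) + 1)"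
              and P = "A0 h k \<ge> 1"])
          (auto simp: sigF_plus_diag sigF_minus_diag term_simps)
    qed
    have M_less: "(\<Sum>k = 1..h - 1. M k) = (\<Sum>k\<in>{k \<in> {1..h - 1}. A1 h k = 1}.
        (\<upsilon> powi sigF_minus h k A0 A1 * qint (int (A1 (h + 1) k) + 1))
          *\<^sub>q xseries A0 (A1 - unit_mat h k + unit_mat (h + 1) k) j)"
    proof (subst sum_filter_scaleq[OF finite_atLeastAtMost], rule sum.cong[OF refl])
      fix k assume "k \<in> {1..h - 1}"
      then show "M k
          = (of_bool (A1 h k = 1) * (\<upsilon> powi sigF_minus h k A0 A1 * qint (int (A1 (h + 1) k) + 1)))
          *\<^sub>q xseries A0 (A1 - unit_mat h k + unit_mat (h + 1) k) j"
        unfolding M_def using h'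
        by (intro xseries_with_same_diagonal[where w = "0"
              and d = "\<upsilon> powi sigF_minus h k A0 A1 * qint (int (A1 (h + 1) k) + 1)"
              and P = "A1 h k = 1"])
          (auto simp: sigF_plus_diag sigF_minus_diag term_simps)
    qed
    \<comment> \<open>The same shift occurs in columns \<open>h\<close> and \<open>h + 1\<close>,
      first from the leading diagonal entry of \<open>sigF_minus\<close>, then from column
      \<open>h\<close> in its left sum.\<close>
    have M_h: "M h = (of_bool (A1 h h = 1) * \<upsilon> powi sigF_minus h h A0 A1 * qint (int (A1 (h + 1) h) + 1))
          *\<^sub>q xseries A0 (A1 - unit_mat h h + unit_mat (h + 1) h) (j + unit_vec h)"
      unfolding M_def using h'
      by (intro xseries_with_same_diagonal[where w = "unit_vec h"
            and d = "\<upsilon> powi sigF_minus h h A0 A1 * qint (int (A1 (h + 1) h) + 1)"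
            and P = "A1 h h = 1"])
        (auto simp: sigF_plus_diag sigF_minus_diag term_simps)
    have M_Suc: "M (h + 1) = (of_bool (A1 h (h + 1) = 1) * \<upsilon> powi sigF_minus h (h + 1) A0 A1
          * qint (int (A1 (h + 1) (h + 1)) + 1))
          *\<^sub>q xseries A0 (A1 - unit_mat h (h + 1) + unit_mat (h + 1) (h + 1)) (j + unit_vec h)"
      unfolding M_def using h'
      by (intro xseries_with_same_diagonal[where w = "unit_vec h"
            and d = "\<upsilon> powi sigF_minus h (h + 1) A0 A1 * qint (int (A1 (h + 1) (h + 1)) + 1)"
            and P = "A1 h (h + 1) = 1"])
        (auto simp: sigF_plus_diag sigF_minus_diag term_simps)
    have M_greater: "(\<Sum>k = h + 2..n. M k) = (\<Sum>k\<in>{k \<in> {h + 2..n}. A1 h k = 1}.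
        (\<upsilon> powi sigF_minus h k A0 A1 * qint (int (A1 (h + 1) k) + 1))
          *\<^sub>q xseries A0 (A1 - unit_mat h k + unit_mat (h + 1) k) (j + alpha_vec h))"
    proof (subst sum_filter_scaleq[OF finite_atLeastAtMost], rule sum.cong[OF refl])
      fix k assume "k \<in> {h + 2..n}"
      then show "M k
          = (of_bool (A1 h k = 1) * (\<upsilon> powi sigF_minus h k A0 A1 * qint (int (A1 (h + 1) k) + 1)))
          *\<^sub>q xseries A0 (A1 - unit_mat h k + unit_mat (h + 1) k) (j + alpha_vec h)"
        unfolding M_def using h'
        by (intro xseries_with_same_diagonal[where w = "alpha_vec h"
              and d = "\<upsilon> powi sigF_minus h k A0 A1 * qint (int (A1 (h + 1) k) + 1)"
              and P = "A1 h k = 1"])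
          (auto simp: sigF_plus_diag sigF_minus_diag term_simps)
    qed
    show ?case
      unfolding hat sum_split_adjacent[OF h'] P_less P_h P_Suc P_greater M_less M_h M_Suc M_greater
      by (simp only: add_ac)
  next
    case Ko
    \<comment> \<open>\<open>P k\<close> turns an odd factor of column \<open>k\<close> into an even
      one, \<open>M k\<close> does the converse. The diagonal matters in column 1 only.\<close>
    define P :: "nat \<Rightarrow> nat \<Rightarrow> 'n xa tensor" where "P k = xseries_with A0 A1 j
      (\<lambda>l. (- 1) ^ odd_count n k A1 * \<upsilon> powi sigK_plus n k (A0 + diag_mat l) A1
        * (of_bool (A1 1 k \<ge> 1) * qint (int ((A0 + diag_mat l) 1 k) + 1)))
      (\<lambda>l. A0 + diag_mat l + unit_mat 1 k) (\<lambda>_. A1 - unit_mat 1 k)" for k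
    define M :: "nat \<Rightarrow> nat \<Rightarrow> 'n xa tensor" where "M k = xseries_with A0 A1 j
      (\<lambda>l. (- 1) ^ odd_count n k A1 * \<upsilon> powi sigK_minus n k (A0 + diag_mat l) A1
        * (of_bool ((A0 + diag_mat l) 1 k \<ge> 1) * qint (int (A1 1 k) + 1)))
      (\<lambda>l. A0 + diag_mat l - unit_mat 1 k) (\<lambda>_. A1 + unit_mat 1 k)" for k
    have hat: "uq_hat_act D act (uKo 1) (xseries A0 A1 j) = (\<Sum>k = 1..n. P k) + (\<Sum>k = 1..n. M k)"
      unfolding P_def M_def n by (rule uq_hat_act_xseries[OF uq_tensor_act_uKo[OF A1]])
    have P_1: "P 1 = (of_bool (A1 1 1 = 1) * \<upsilon> powi (sigK_plus n 1 A0 A1 - j 1 + 1) / (\<upsilon> - inverse \<upsilon>))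
          *\<^sub>q (xseries A0 (A1 - unit_mat 1 1) j - xseries A0 (A1 - unit_mat 1 1) (j - 2 * unit_vec 1))"
      unfolding P_def using h'
      \<comment> \<open>The vectors \<open>w + unit_vec 1\<close> and \<open>w - unit_vec 1\<close>
        are 0 and \<open>- 2 * unit_vec 1\<close>, and \<open>- w 1\<close> is the summand 1 of the
        exponent. No column precedes the first one, so there is no sign.\<close>
      by (intro xseries_with_raise_diagonal[where p = "1" and w = "- unit_vec 1"
            and d = "\<upsilon> powi sigK_plus n 1 A0 A1"
            and P = "A1 1 1 = 1"])
        (auto simp: sigK_plus_diag sigK_minus_diag odd_count_def term_simps)
    have P_greater: "(\<Sum>k = 2..n. P k) = (\<Sum>k\<in>{k \<in> {2..n}. A1 1 k = 1}.
        ((- 1) ^ odd_count n k A1 * \<upsilon> powi sigK_plus n k A0 A1 * qint (int (A0 1 k) + 1))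
          *\<^sub>q xseries (A0 + unit_mat 1 k) (A1 - unit_mat 1 k) (j - unit_vec 1))"
    proof (subst sum_filter_scaleq[OF finite_atLeastAtMost], rule sum.cong[OF refl])
      fix k assume "k \<in> {2..n}"
      then show "P k
          = (of_bool (A1 1 k = 1) * ((- 1) ^ odd_count n k A1 * \<upsilon> powi sigK_plus n k A0 A1 * qint (int (A0 1 k) + 1)))
          *\<^sub>q xseries (A0 + unit_mat 1 k) (A1 - unit_mat 1 k) (j - unit_vec 1)"
        unfolding P_def using h'
        \<comment> \<open>For \<open>k > 1\<close> the diagonal entry \<open>l 1\<close> belongs to
          the left sum, which enters with a minus sign.\<close>
        by (intro xseries_with_same_diagonal[where w = "- unit_vec 1"
              and d = "(- 1) ^ odd_count n k A1 * \<upsilon> powi sigK_plus n k A0 A1 * qint (int (A0 1 k) + 1)"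
              and P = "A1 1 k = 1"])
          (auto simp: sigK_plus_diag sigK_minus_diag odd_count_def term_simps)
    qed
    have M_1: "M 1 = (\<upsilon> powi (sigK_minus n 1 A0 A1 + j 1) * qint (int (A1 1 1) + 1))
          *\<^sub>q xseries A0 (A1 + unit_mat 1 1) j"
      unfolding M_def using h'
      by (intro xseries_with_lower_diagonal[where p = "1"
            and d = "\<upsilon> powi sigK_minus n 1 A0 A1 * qint (int (A1 1 1) + 1)"])
        (auto simp: sigK_plus_diag sigK_minus_diag odd_count_def term_simps)
    have M_greater: "(\<Sum>k = 2..n. M k) = (\<Sum>k\<in>{k \<in> {2..n}. A0 1 k \<ge> 1}.
        ((- 1) ^ odd_count n k A1 * \<upsilon> powi sigK_minus n k A0 A1 * qint (int (A1 1 k) + 1))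
          *\<^sub>q xseries (A0 - unit_mat 1 k) (A1 + unit_mat 1 k) (j - unit_vec 1))"
    proof (subst sum_filter_scaleq[OF finite_atLeastAtMost], rule sum.cong[OF refl])
      fix k assume "k \<in> {2..n}"
      then show "M k
          = (of_bool (A0 1 k \<ge> 1) * ((- 1) ^ odd_count n k A1 * \<upsilon> powi sigK_minus n k A0 A1 * qint (int (A1 1 k) + 1)))
          *\<^sub>q xseries (A0 - unit_mat 1 k) (A1 + unit_mat 1 k) (j - unit_vec 1)"
        unfolding M_def using h'
        by (intro xseries_with_same_diagonal[where w = "- unit_vec 1"
              and d = "(- 1) ^ odd_count n k A1 * \<upsilon> powi sigK_minus n k A0 A1 * qint (int (A1 1 k) + 1)"
              and P = "A0 1 k \<ge> 1"])
          (auto simp: sigK_plus_diag sigK_minus_diag odd_count_def term_simps)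
    qed
    have split: "(\<Sum>k = 1..n. g k) = g 1 + (\<Sum>k = 2..n. g k)" for g :: "nat \<Rightarrow> nat \<Rightarrow> 'n xa tensor"
      using assms(2) sum.atLeast_Suc_atMost[of 1 n g] by (simp add: numeral_2_eq_2)
    show ?case
      unfolding hat split P_1 P_greater M_1 M_greater
      by (simp only: add_ac)
  qed
qed

end
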